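(* Let $d\ge 1$ be an integer and let $2\le p,q<\infty$ satisfy $\frac{d}{p}+\frac{2}{q}=\frac{d}{2}$. For $t\in\mathbb{R}$ let $\mathcal{H}^t$ be the linear operator on $L^2(\mathbb{R}^d,\mathrm{d}\gamma_d)$ determined by $$\mathcal{H}^t: H_{\boldsymbol m}(\boldsymbol x)\mapsto e^{2\pi |\boldsymbol m| i t}\,H_{\boldsymbol m}\big(\sqrt{2/p}\,\boldsymbol x\big),\qquad \boldsymbol m\in\mathbb{Z}_+^d .$$ Let $f\in L^2(\mathbb{R}^d,\mathrm{d}\boldsymbol x)$ have the expansion $f(\boldsymbol x)=\sum_{\boldsymbol m\in\mathbb{Z}_+^d}\alpha(\boldsymbol m)\Phi_{\boldsymbol m}(\boldsymbol x)$ and put $g(\boldsymbol x)=\sum_{\boldsymbol m\in\mathbb{Z}_+^d}\alpha(\boldsymbol m)H_{\boldsymbol m}(\boldsymbol x)$. Then $$\frac{\big\|\,\|e^{it\Delta}f(\boldsymbol x)\|_{L^p(\mathrm{d}\boldsymbol x)}\big\|_{L^q(\mathrm{d}t)}}{(p^{-1/2p}\,2^{1/p-1/2})^d}=\left(\int_{-1/2}^{1/2}\bigg(\int_{\mathbb{R}^d}|\mathcal{H}^t T_{-i}g(\boldsymbol x)|^p\,\mathrm{d}\gamma_d(\boldsymbol x)\bigg)^{q/p}\mathrm{d}t\right)^{1/q}$$ and $$\frac{C(p,d)}{(p^{-1/2p}\,2^{1/p-1/2})^d}\,\|f\|_{L^2(\mathrm{d}\boldsymbol x)}=\bigg(\int_{\mathbb{R}^d}|g(\boldsymbol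 x)|^2\,\mathrm{d}\gamma_d(\boldsymbol x)\bigg)^{1/2}.$$
   Context: Notation: $\mathbb{Z}_+=\{0,1,2,\dots\}$; for $\boldsymbol m=(m_1,\dots,m_d)\in\mathbb{Z}_+^d$, $|\boldsymbol m|=m_1+\dots+m_d$. The exponent $p^{-1/2p}$ means $p^{-1/(2p)}$. Functions are complex valued. $e^{it\Delta}f(\boldsymbol x)$ is the solution of the Schr\"odinger equation $\partial_t u(\boldsymbol x,t)=i\Delta u(\boldsymbol x,t)$ on $\mathbb{R}^d\times\mathbb{R}$ with $u(\boldsymbol x,0)=f(\boldsymbol x)$; the $L^q(\mathrm{d}t)$ norm is over $t\in\mathbb{R}$. $\mathrm{d}\gamma_d(\boldsymbol x)=(2\pi)^{-d/2}e^{-\|\boldsymbol x\|^2/2}\,\mathrm{d}\boldsymbol x$ is the normal distribution on $\mathbb{R}^d$. $H_m(x)$ ($m\ge0$) are the monic orthogonal (Hermite) polynomials for $(2\pi)^{-1/2}e^{-x^2/2}\mathrm{d}x$ on $\mathbb{R}$, and $H_{\boldsymbol m}(\boldsymbol x)=H_{m_1}(x_1)\cdots H_{m_d}(x_d)$. The $H_{\boldsymbol m}$ form an orthogonal basis of $L^2(\mathbb{R}^d,\mathrm{d}\gamma_d)$ with $\int|H_{\boldsymbol m}|^2\mathrm{d}\gamma_d=\boldsymbol m!:=m_1!\cdots m_d!$. The functions $\Phi_{\boldsymbol m}(\boldsymbol x)=H_{\boldsymbol m}(\sqrt{4\pi}\,\boldsymbol x)e^{-\pi\|\boldsymbol x\|^2}$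 form an orthogonal basis of $L^2(\mathbb{R}^d,\mathrm{d}\boldsymbol x)$. Operators defined on the basis $H_{\boldsymbol m}$ are extended linearly and continuously to $L^2(\mathbb{R}^d,\mathrm{d}\gamma_d)$. For $\omega\in\mathbb{C}$ with $|\omega|\le1$, $T_\omega:L^2(\mathbb{R}^d,\mathrm{d}\gamma_d)\to L^2(\mathbb{R}^d,\mathrm{d}\gamma_d)$ is the linear operator with $T_\omega(H_{\boldsymbol m})=\omega^{|\boldsymbol m|}H_{\boldsymbol m}$. $C(p,d)=\big(p^{-1/2p}\,2^{1/p-1/4}\big)^d$. *)

theory Defs
  imports "HOL-Probability.Probability"
begin

section \<open>\<open>L\<^sup>p\<close> norms and \<open>L\<^sup>2\<close> spaces\<close>

text \<open>Norms take values in \<open>[0, \<infinity>]\<close>. The power below is only used with exponents \<open>a > 0\<close>.\<close>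

definition ennreal_powr :: "ennreal \<Rightarrow> real \<Rightarrow> ennreal"
  where "ennreal_powr x a = (if x = \<top> then \<top> else ennreal (enn2real x powr a))"

definition Lp_norm_ennreal :: "'a measure \<Rightarrow> real \<Rightarrow> ('a \<Rightarrow> ennreal) \<Rightarrow> ennreal"
  where "Lp_norm_ennreal M p F = ennreal_powr (\<integral>\<^sup>+x. ennreal_powr (F x) p \<partial>M) (1 / p)"

definition Lp_norm :: "'a measure \<Rightarrow> real \<Rightarrow> ('a \<Rightarrow> complex) \<Rightarrow> ennreal"
  where "Lp_norm M p f = Lp_norm_ennreal M p (\<lambda>x. ennreal (cmod (f x)))"

text \<open>Elements of \<open>L\<^sup>2\<close> are represented by functions. Objects determined only up to null sets
  (\<open>L\<^sup>2\<close> sums, operators on \<open>L\<^sup>2\<close>, solutions of the Schroedinger equation) are below picked by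
  \<open>SOME\<close>: the choice is one of representatives.\<close>

definition L2 :: "'a measure \<Rightarrow> ('a \<Rightarrow> complex) set"
  where "L2 M = {f \<in> borel_measurable M. integrable M (\<lambda>x. (cmod (f x))\<^sup>2)}"

definition L2_has_sum :: "'a measure \<Rightarrow> ('i \<Rightarrow> 'a \<Rightarrow> complex) \<Rightarrow> ('a \<Rightarrow> complex) \<Rightarrow> bool"
  where "L2_has_sum M F f \<longleftrightarrow>
    (\<forall>i. F i \<in> L2 M) \<and> f \<in> L2 M \<and>
    ((\<lambda>I. Lp_norm M 2 (\<lambda>x. f x - (\<Sum>i\<in>I. F i x))) \<longlongrightarrow> 0) (finite_subsets_at_top UNIV)"

definition L2_sum :: "'a measure \<Rightarrow> ('i \<Rightarrow> 'a \<Rightarrow> complex) \<Rightarrow> 'a \<Rightarrow> complex"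
  where "L2_sum M F = (SOME f. L2_has_sum M F f)"

text \<open>Continuous linear operators on \<open>L\<^sup>2\<close>. Linearity and boundedness together imply that
  functions equal almost everywhere have images equal almost everywhere.\<close>

definition L2_operator :: "'a measure \<Rightarrow> (('a \<Rightarrow> complex) \<Rightarrow> 'a \<Rightarrow> complex) \<Rightarrow> bool"
  where "L2_operator M T \<longleftrightarrow>
    (\<forall>f\<in>L2 M. T f \<in> L2 M) \<and>
    (\<forall>f\<in>L2 M. \<forall>g\<in>L2 M. AE x in M. T (\<lambda>y. f y + g y) x = T f x + T g x) \<and>
    (\<forall>c. \<forall>f\<in>L2 M. AE x in M. T (\<lambda>y. c * f y) x = c * T f x) \<and>
    (\<exists>B::real. \<forall>f\<in>L2 M. Lp_norm M 2 (T f) \<le> ennreal B * Lp_norm M 2 f)"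


section \<open>Gaussian measure and Hermite polynomials\<close>

definition gauss :: "(real ^ 'n) measure"
  where "gauss = density lborel
    (\<lambda>x. ennreal ((2 * pi) powr (- real CARD('n) / 2) * exp (- (norm x)\<^sup>2 / 2)))"

definition hermite :: "nat \<Rightarrow> real poly"
  where "hermite = (THE H.
    (\<forall>m. degree (H m) = m \<and> lead_coeff (H m) = 1) \<and>
    (\<forall>m n. m \<noteq> n \<longrightarrow>
      (\<integral>x. poly (H m) x * poly (H n) x \<partial>density lborel std_normal_density) = 0))"

definition multi_abs :: "nat ^ 'n \<Rightarrow> nat"
  where "multi_abs m = (\<Sum>i\<in>UNIV. m $ i)"

definition hermite_multi :: "nat ^ 'n \<Rightarrow> real ^ 'n \<Rightarrow> complex"
  where "hermite_multi m x = complex_of_real (\<Prod>i\<in>UNIV. poly (hermite (m $ i)) (x $ i))"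

definition hermite_fun :: "nat ^ 'n \<Rightarrow> real ^ 'n \<Rightarrow> complex"
  where "hermite_fun m x =
    hermite_multi m (sqrt (4 * pi) *\<^sub>R x) * complex_of_real (exp (- pi * (norm x)\<^sup>2))"

definition hermite_operator ::
    "(nat ^ 'n \<Rightarrow> real ^ 'n \<Rightarrow> complex) \<Rightarrow> (real ^ 'n \<Rightarrow> complex) \<Rightarrow> real ^ 'n \<Rightarrow> complex"
  where "hermite_operator A = (SOME T. L2_operator gauss T \<and>
    (\<forall>m. AE x in gauss. T (hermite_multi m) x = A m x))"

definition T_op :: "complex \<Rightarrow> (real ^ 'n \<Rightarrow> complex) \<Rightarrow> real ^ 'n \<Rightarrow> complex"
  where "T_op \<omega> = hermite_operator (\<lambda>m x. \<omega> ^ multi_abs m * hermite_multi m x)"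

definition H_op :: "real \<Rightarrow> real \<Rightarrow> (real ^ 'n \<Rightarrow> complex) \<Rightarrow> real ^ 'n \<Rightarrow> complex"
  where "H_op p t = hermite_operator
    (\<lambda>m x. exp (2 * complex_of_real pi * of_nat (multi_abs m) * \<i> * complex_of_real t)
      * hermite_multi m (sqrt (2 / p) *\<^sub>R x))"


section \<open>The free Schroedinger evolution\<close>

definition partial :: "'n \<Rightarrow> (real ^ 'n \<Rightarrow> complex) \<Rightarrow> real ^ 'n \<Rightarrow> complex"
  where "partial i f x = frechet_derivative f (at x) (axis i 1)"

definition laplacian :: "(real ^ 'n \<Rightarrow> complex) \<Rightarrow> real ^ 'n \<Rightarrow> complex"
  where "laplacian f x = (\<Sum>i\<in>UNIV. partial i (partial i f) x)"

definition schwartz :: "(real ^ 'n \<Rightarrow> complex) \<Rightarrow> bool"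
  where "schwartz f \<longleftrightarrow> (\<forall>is.
    foldr partial is f differentiable_on UNIV \<and>
    (\<forall>k::nat. bounded (range (\<lambda>x. (norm x ^ k) *\<^sub>R foldr partial is f x))))"

text \<open>For initial data in \<open>L\<^sup>2\<close> the equation \<open>\<partial>\<^sub>t u = i \<Delta> u\<close> is understood in the usual way:
  \<open>u\<close> is a continuous curve in \<open>L\<^sup>2\<close> that satisfies it in the sense of tempered distributions.\<close>

definition schroedinger_solution ::
    "(real ^ 'n \<Rightarrow> complex) \<Rightarrow> (real \<Rightarrow> real ^ 'n \<Rightarrow> complex) \<Rightarrow> bool"
  where "schroedinger_solution f u \<longleftrightarrow>
    (\<forall>t. u t \<in> L2 lborel) \<and>
    (\<forall>t. ((\<lambda>s. Lp_norm lborel 2 (\<lambda>x. u s x - u t x)) \<longlongrightarrow> 0) (at t)) \<and>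
    (AE x in lborel. u 0 x = f x) \<and>
    (\<forall>\<phi>. schwartz \<phi> \<longrightarrow> (\<forall>t.
      ((\<lambda>s. \<integral>x. u s x * \<phi> x \<partial>lborel) has_vector_derivative
        \<i> * (\<integral>x. u t x * laplacian \<phi> x \<partial>lborel)) (at t)))"

definition schroedinger :: "real \<Rightarrow> (real ^ 'n \<Rightarrow> complex) \<Rightarrow> real ^ 'n \<Rightarrow> complex"
  where "schroedinger t f = (SOME u. schroedinger_solution f u) t"


definition C_const :: "real \<Rightarrow> nat \<Rightarrow> real"
  where "C_const p d = (p powr (- 1 / (2 * p)) * 2 powr (1 / p - 1 / 4)) ^ d"

end

theory Submission
  imports Defs "HOL-Complex_Analysis.Cauchy_Integral_Formula"
begin

text \<open>The theorem rests on the fact that the free Schroedinger evolution maps Hermite functions to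
  rescaled Hermite functions. Put \<open>b = 1 / (4\<pi>)\<close>, \<open>z = b + i t\<close>, \<open>s = \<bar>z\<bar> / b = \<surd>(1 + (4\<pi>t)\<^sup>2)\<close> and
  \<open>\<omega> = \<bar>z\<bar> / z = exp (- i arctan (4\<pi>t))\<close>. Then the evolution of \<open>\<Phi>\<^sub>m\<close> at time \<open>t\<close> is
  \<open>(\<surd>b / \<surd>z)\<^sup>d \<omega>\<^bsup>|m|\<^esup> H\<^sub>m(\<surd>(4\<pi>) x / s) exp (- \<parallel>x\<parallel>\<^sup>2 / (4z))\<close>
  (\<open>heat_solution_hermite_heat\<close>, \<open>hermite_heat_hermite\<close>). So time acts on an expansion
  \<open>\<Sum> \<alpha>(m) \<Phi>\<^sub>m\<close> by rotating its coefficients to \<open>\<alpha>(m) \<omega>\<^bsup>|m|\<^esup>\<close>, followed by a dilation with a Gaussian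
  factor, the lens transform.

  In the \<open>L\<^sup>p\<close> norm, the variable \<open>y = \<surd>(2\<pi>p) x / s\<close> turns the Gaussian factor into the Gaussian measure
  and leaves (\<open>nn_integral_lens_transform\<close>) the \<open>p\<close>-th power
  \<open>s\<^bsup>d - dp/2\<^esup> p\<^bsup>-d/2\<^esup> \<integral> |\<Sum> \<alpha>(m) \<omega>\<^bsup>|m|\<^esup> H\<^sub>m(\<surd>(2/p) y)|\<^sup>p d\<gamma>(y)\<close>.
  By the relation between \<open>p\<close>, \<open>q\<close> and \<open>d\<close> the power of \<open>s\<close> becomes \<open>s\<^bsup>-2\<^esup>\<close> in the \<open>q\<close>-th power of the
  \<open>L\<^sup>p\<close> norm, which is the Jacobian of the angle \<open>arctan (4\<pi>t)\<close> up to a constant. The time integral is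
  therefore an integral over the half circle swept by \<open>\<omega>\<close> (\<open>nn_integral_arctan_time\<close>). Since
  \<open>H\<^sub>m(- x) = (- 1)\<^bsup>|m|\<^esup> H\<^sub>m(x)\<close>, the integrand is invariant under \<open>\<omega> \<mapsto> - \<omega>\<close>
  (\<open>hermite_mean_minus\<close>), so the half circle contributes half of the full circle; the operator
  \<open>T\<close> with parameter \<open>- i\<close> only shifts the angle. The second identity is the case \<open>t = 0\<close>, \<open>p = 2\<close> of the
  same change of variable.

  Evolution and operators are given only through their characterisations, so existence and
  uniqueness are part of the argument. A solution for square integrable data is the limit, in
  \<open>L\<^sup>2\<close> and uniformly in time, of the explicit solutions for partial sums
  (\<open>schroedinger_solution_limit\<close>). It is unique because pairing any solution with a Gaussian that
  evolves backwards in time gives a constant (\<open>solution_pairing\<close>), and Gaussians separate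
  the functions in \<open>L\<^sup>2\<close> (\<open>AE_zero_of_gaussians\<close>). The operators exist by Bessel's inequality and
  Riesz-Fischer (\<open>hermite_operator_spec\<close>) and are evaluated on series by continuity
  (\<open>L2_operator_series\<close>).

  The change of variable in time needs an integrand that is measurable in time. The series
  \<open>\<Sum> \<alpha>(m) \<omega>\<^bsup>|m|\<^esup> H\<^sub>m\<close> is therefore represented by a pointwise limit along one sequence of finite index
  sets, chosen from the numbers \<open>|\<alpha>(m)|\<^sup>2 m!\<close> alone (\<open>exhausts\<close>, \<open>hermite_series\<close>) and so
  good for all \<open>\<omega>\<close> at once.\<close>

section \<open>Powers of extended nonnegative reals\<close>

lemma ennreal_powr_ennreal: "0 \<le> x \<Longrightarrow> ennreal_powr (ennreal x) a = ennreal (x powr a)"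
  by (simp add: ennreal_powr_def)

lemma ennreal_powr_powr:
  assumes "0 < a" "0 < b"
  shows "ennreal_powr (ennreal_powr x a) b = ennreal_powr x (a * b)"
  using assms by (auto simp: ennreal_powr_def powr_powr)

lemma ennreal_powr_one: "ennreal_powr x 1 = x"
  by (auto simp: ennreal_powr_def ennreal_enn2real_if)

lemma ennreal_powr_mult_const:
  assumes "0 < c" "0 < a"
  shows "ennreal_powr (ennreal c * x) a = ennreal (c powr a) * ennreal_powr x a"
  using assms
  by (cases x) (auto simp: ennreal_powr_def ennreal_mult_top ennreal_mult'[symmetric] powr_mult ennreal_mult_eq_top_iff)

lemma ennreal_powr_mono:
  assumes "x \<le> y" "0 < a" shows "ennreal_powr x a \<le> ennreal_powr y a"
  using assms
  by (cases x; cases y) (auto simp: ennreal_powr_def top_unique intro!: ennreal_leI powr_mono2)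

lemma borel_measurable_ennreal_powr [measurable]:
  assumes [measurable]: "f \<in> borel_measurable M"
  shows "(\<lambda>x. ennreal_powr (f x) a) \<in> borel_measurable M"
  unfolding ennreal_powr_def by measurable

section \<open>Square integrable functions\<close>

text \<open>All \<open>L\<^sup>2\<close> estimates are done with the square of the norm. It is an integral, so Fatou and
  monotone convergence apply to it directly, and the inequality
  \<open>\<parallel>f + g\<parallel>\<^sup>2 \<le> 2 \<parallel>f\<parallel>\<^sup>2 + 2 \<parallel>g\<parallel>\<^sup>2\<close> replaces Minkowski's wherever only convergence to \<open>0\<close>
  or finiteness is at stake.\<close>

definition sqnorm :: "'a measure \<Rightarrow> ('a \<Rightarrow> complex) \<Rightarrow> ennreal"
  where "sqnorm M f = (\<integral>\<^sup>+x. ennreal ((cmod (f x))\<^sup>2) \<partial>M)"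

lemma Lp_norm_2: "Lp_norm M 2 f = ennreal_powr (sqnorm M f) (1 / 2)"
  unfolding Lp_norm_def Lp_norm_ennreal_def sqnorm_def
  by (intro arg_cong2[where f=ennreal_powr] nn_integral_cong) (auto simp: ennreal_powr_ennreal)

text \<open>Near \<open>0\<close> one has \<open>s \<le> \<surd>s\<close>, and conversely \<open>s < e\<^sup>2\<close> gives \<open>\<surd>s < e\<close>.\<close>

lemma ennreal_powr_half_tendsto_0_iff:
  "((\<lambda>i. ennreal_powr (s i) (1/2)) \<longlongrightarrow> 0) F \<longleftrightarrow> (s \<longlongrightarrow> 0) F"
proof
  assume l: "((\<lambda>i. ennreal_powr (s i) (1/2)) \<longlongrightarrow> 0) F"
  have eq: "s i = ennreal_powr (s i) (1/2) * ennreal_powr (s i) (1/2)" for i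
    by (cases "s i") (auto simp: ennreal_powr_def ennreal_mult[symmetric] powr_half_sqrt ennreal_top_mult)
  have fin: "eventually (\<lambda>i. ennreal_powr (s i) (1/2) < 1) F"
    using order_tendstoD(2)[OF l, of 1] by simp
  show "(s \<longlongrightarrow> 0) F"
  proof (rule tendsto_sandwich[OF _ _ tendsto_const l])
    show "\<forall>\<^sub>F n in F. s n \<le> ennreal_powr (s n) (1 / 2)"
      using fin
    proof eventually_elim
      case (elim i)
      have "s i = ennreal_powr (s i) (1/2) * ennreal_powr (s i) (1/2)" by (rule eq)
      also have "\<dots> \<le> ennreal_powr (s i) (1/2) * 1" using elim by (intro mult_left_mono) auto
      finally show ?case by simp
    qed
  qed auto
next
  assume l: "(s \<longlongrightarrow> 0) F"
  show "((\<lambda>i. ennreal_powr (s i) (1/2)) \<longlongrightarrow> 0) F"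
  proof (rule order_tendstoI)
    fix a :: ennreal assume "0 < a"
    then obtain e where e: "0 < e" "ennreal e \<le> a"
    proof (cases a)
      case (real r) then show ?thesis using \<open>0 < a\<close> that[of r] by auto
    qed (auto intro: that[of 1])
    have "eventually (\<lambda>i. s i < ennreal (e\<^sup>2)) F"
      using order_tendstoD(2)[OF l, of "ennreal (e\<^sup>2)"] e by simp
    then show "eventually (\<lambda>i. ennreal_powr (s i) (1/2) < a) F"
    proof eventually_elim
      case (elim i)
      obtain r where r: "s i = ennreal r" "0 \<le> r" using elim by (cases "s i") auto
      have "sqrt r < e" using elim r e by (auto simp: ennreal_less_iff intro: real_less_lsqrt)
      then have "ennreal (sqrt r) < ennreal e" using r by (simp add: ennreal_less_iff)
      then show ?case using r e by (auto simp: ennreal_powr_ennreal powr_half_sqrt)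
    qed
  qed auto
qed

lemma Lp_norm_2_tendsto_0_iff:
  "((\<lambda>i. Lp_norm M 2 (f i)) \<longlongrightarrow> 0) F \<longleftrightarrow> ((\<lambda>i. sqnorm M (f i)) \<longlongrightarrow> 0) F"
  unfolding Lp_norm_2 by (rule ennreal_powr_half_tendsto_0_iff)

lemma Lp_norm_2_bound:
  assumes "sqnorm M g \<le> ennreal B * sqnorm N f" "0 < B"
  shows "Lp_norm M 2 g \<le> ennreal (sqrt B) * Lp_norm N 2 f"
  unfolding Lp_norm_2 using ennreal_powr_mono[OF assms(1), of "1/2"] assms(2)
  by (simp add: ennreal_powr_mult_const powr_half_sqrt)

lemma Lp_norm_2_boundD:
  assumes "Lp_norm M 2 g \<le> ennreal B * Lp_norm N 2 f"
  shows "sqnorm M g \<le> ennreal ((\<bar>B\<bar> + 1)\<^sup>2) * sqnorm N f"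
proof -
  have "Lp_norm M 2 g \<le> ennreal (\<bar>B\<bar> + 1) * Lp_norm N 2 f"
    using assms
  proof (rule order_trans)
    have "ennreal B \<le> ennreal (\<bar>B\<bar> + 1)" by (intro ennreal_leI) auto
    then show "ennreal B * Lp_norm N 2 f \<le> ennreal (\<bar>B\<bar> + 1) * Lp_norm N 2 f"
      by (rule mult_right_mono) auto
  qed
  then have "ennreal_powr (ennreal_powr (sqnorm M g) (1/2)) 2
      \<le> ennreal_powr (ennreal (\<bar>B\<bar> + 1) * ennreal_powr (sqnorm N f) (1/2)) 2"
    unfolding Lp_norm_2 by (rule ennreal_powr_mono) simp
  then show ?thesis
    by (subst (asm) ennreal_powr_mult_const) (auto simp: ennreal_powr_powr ennreal_powr_one)
qed

lemma L2_iff: "f \<in> L2 M \<longleftrightarrow> f \<in> borel_measurable M \<and> sqnorm M f < \<infinity>"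
  unfolding L2_def sqnorm_def by (auto simp: integrable_iff_bounded)

lemma L2_measurable: "f \<in> L2 M \<Longrightarrow> f \<in> borel_measurable M"
  by (simp add: L2_iff)

lemma L2_finite: "f \<in> L2 M \<Longrightarrow> sqnorm M f < \<infinity>"
  by (simp add: L2_iff)

lemma sqnorm_eq_integral: "f \<in> L2 M \<Longrightarrow> sqnorm M f = ennreal (\<integral>x. (cmod (f x))\<^sup>2 \<partial>M)"
  unfolding L2_def sqnorm_def by (auto intro!: nn_integral_eq_integral)

lemma sqnorm_cong_AE: "AE x in M. f x = g x \<Longrightarrow> sqnorm M f = sqnorm M g"
  unfolding sqnorm_def by (intro nn_integral_cong_AE) auto

lemma sqnorm_eq_0_iff:
  "f \<in> borel_measurable M \<Longrightarrow> sqnorm M f = 0 \<longleftrightarrow> (AE x in M. f x = 0)"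
  unfolding sqnorm_def by (subst nn_integral_0_iff_AE) auto

lemma sqnorm_zero [simp]: "sqnorm M (\<lambda>x. 0) = 0"
  by (simp add: sqnorm_def)

lemma sqnorm_cmult:
  assumes [measurable]: "f \<in> borel_measurable M"
  shows "sqnorm M (\<lambda>x. c * f x) = ennreal ((cmod c)\<^sup>2) * sqnorm M f"
  unfolding sqnorm_def
  by (subst nn_integral_cmult[symmetric]) (auto simp: norm_mult power_mult_distrib ennreal_mult)

lemma sqnorm_minus_commute: "sqnorm M (\<lambda>x. f x - g x) = sqnorm M (\<lambda>x. g x - f x)"
  by (simp add: sqnorm_def norm_minus_commute)

lemma cmod_add_square_le: "(cmod (a + b))\<^sup>2 \<le> 2 * (cmod a)\<^sup>2 + 2 * (cmod b)\<^sup>2"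
proof -
  have "(cmod (a + b))\<^sup>2 \<le> (cmod a + cmod b)\<^sup>2"
    by (intro power_mono norm_triangle_ineq) auto
  also have "\<dots> \<le> 2 * (cmod a)\<^sup>2 + 2 * (cmod b)\<^sup>2"
    using zero_le_power2[of "cmod a - cmod b"] by (simp add: power2_eq_square algebra_simps)
  finally show ?thesis .
qed

lemma sqnorm_add_le:
  assumes [measurable]: "f \<in> borel_measurable M" "g \<in> borel_measurable M"
  shows "sqnorm M (\<lambda>x. f x + g x) \<le> 2 * sqnorm M f + 2 * sqnorm M g"
proof -
  have "sqnorm M (\<lambda>x. f x + g x) \<le>
      (\<integral>\<^sup>+x. 2 * ennreal ((cmod (f x))\<^sup>2) + 2 * ennreal ((cmod (g x))\<^sup>2) \<partial>M)"
    unfolding sqnorm_def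
  proof (rule nn_integral_mono)
    fix x
    have "2 * ennreal ((cmod (f x))\<^sup>2) + 2 * ennreal ((cmod (g x))\<^sup>2)
      = ennreal (2 * (cmod (f x))\<^sup>2 + 2 * (cmod (g x))\<^sup>2)"
      by (simp add: ennreal_plus ennreal_mult')
    then show "ennreal ((cmod (f x + g x))\<^sup>2) \<le> 2 * ennreal ((cmod (f x))\<^sup>2) + 2 * ennreal ((cmod (g x))\<^sup>2)"
      using ennreal_leI[OF cmod_add_square_le[of "f x" "g x"]] by metis
  qed
  also have "\<dots> = 2 * sqnorm M f + 2 * sqnorm M g"
    unfolding sqnorm_def by (subst nn_integral_add) (auto simp: nn_integral_cmult)
  finally show ?thesis .
qed

lemma sqnorm_diff_le:
  assumes "f \<in> borel_measurable M" "g \<in> borel_measurable M" "h \<in> borel_measurable M"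
  shows "sqnorm M (\<lambda>x. f x - h x) \<le> 2 * sqnorm M (\<lambda>x. f x - g x) + 2 * sqnorm M (\<lambda>x. g x - h x)"
  using sqnorm_add_le[of "\<lambda>x. f x - g x" M "\<lambda>x. g x - h x"] assms by simp

lemma L2_add:
  assumes "f \<in> L2 M" "g \<in> L2 M" shows "(\<lambda>x. f x + g x) \<in> L2 M"
proof -
  have [measurable]: "f \<in> borel_measurable M" "g \<in> borel_measurable M"
    using assms by (auto dest: L2_measurable)
  have "sqnorm M (\<lambda>x. f x + g x) \<le> 2 * sqnorm M f + 2 * sqnorm M g"
    by (rule sqnorm_add_le) auto
  also have "\<dots> < \<infinity>"
    using assms[THEN L2_finite] by (auto simp: ennreal_mult_less_top)
  finally show ?thesis by (simp add: L2_iff)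
qed

lemma L2_cmult: "f \<in> L2 M \<Longrightarrow> (\<lambda>x. c * f x) \<in> L2 M"
  by (auto simp: L2_iff sqnorm_cmult ennreal_mult_less_top)

lemma L2_zero [simp]: "(\<lambda>x. 0) \<in> L2 M"
  by (simp add: L2_iff)

lemma L2_diff: "f \<in> L2 M \<Longrightarrow> g \<in> L2 M \<Longrightarrow> (\<lambda>x. f x - g x) \<in> L2 M"
  using L2_add[of f M "\<lambda>x. (- 1) * g x"] L2_cmult[of g M "- 1"] by simp

lemma L2_finite_sum: "(\<And>i. i \<in> I \<Longrightarrow> f i \<in> L2 M) \<Longrightarrow> (\<lambda>x. \<Sum>i\<in>I. f i x) \<in> L2 M"
  by (induction I rule: infinite_finite_induct) (auto intro: L2_add)

lemma L2_lincomb: "(\<And>i. e i \<in> L2 M) \<Longrightarrow> (\<lambda>x. \<Sum>i\<in>I. c i * e i x) \<in> L2 M"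
  by (intro L2_finite_sum L2_cmult) auto

lemma L2_cnj: "f \<in> L2 M \<Longrightarrow> (\<lambda>x. cnj (f x)) \<in> L2 M"
  by (auto simp: L2_iff sqnorm_def intro: borel_measurable_continuous_on[OF continuous_on_cnj[OF continuous_on_id]])

lemma tendsto_2_mult_ennreal: "(f \<longlongrightarrow> 0) F \<Longrightarrow> ((\<lambda>i. 2 * f i :: ennreal) \<longlongrightarrow> 0) F"
  using ennreal_tendsto_cmult[of 2 f 0 F] by simp

lemma L2_limit_unique:
  assumes "f \<in> borel_measurable M" "g \<in> borel_measurable M" "\<And>i. s i \<in> borel_measurable M"
    and "((\<lambda>i. sqnorm M (\<lambda>x. f x - s i x)) \<longlongrightarrow> 0) F" "((\<lambda>i. sqnorm M (\<lambda>x. g x - s i x)) \<longlongrightarrow> 0) F"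
    and "F \<noteq> bot"
  shows "AE x in M. f x = g x"
proof -
  have "((\<lambda>i. 2 * sqnorm M (\<lambda>x. f x - s i x) + 2 * sqnorm M (\<lambda>x. g x - s i x)) \<longlongrightarrow> 0 + 0) F"
    using assms(4,5) by (intro tendsto_add tendsto_2_mult_ennreal)
  moreover have "sqnorm M (\<lambda>x. f x - g x) \<le> 2 * sqnorm M (\<lambda>x. f x - s i x) + 2 * sqnorm M (\<lambda>x. g x - s i x)" for i
    using sqnorm_diff_le[OF assms(1) assms(3)[of i] assms(2)] by (simp add: sqnorm_minus_commute[of M g])
  ultimately have "sqnorm M (\<lambda>x. f x - g x) \<le> 0"
    by (intro tendsto_lowerbound[of "\<lambda>i. 2 * sqnorm M (\<lambda>x. f x - s i x) + 2 * sqnorm M (\<lambda>x. g x - s i x)" 0 F]) (use assms(6) in auto)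
  then show ?thesis using assms(1,2) by (subst (asm) le_zero_eq, subst (asm) sqnorm_eq_0_iff) auto
qed

lemma integrable_L2_mult:
  assumes "f \<in> L2 M" "g \<in> L2 M"
  shows "integrable M (\<lambda>x. f x * g x)"
proof (rule Bochner_Integration.integrable_bound)
  show "integrable M (\<lambda>x. (cmod (f x))\<^sup>2 + (cmod (g x))\<^sup>2)"
    using assms by (auto simp: L2_def)
  show "(\<lambda>x. f x * g x) \<in> borel_measurable M"
    using assms by (auto simp: L2_def)
  have "cmod a * cmod b \<le> (cmod a)\<^sup>2 + (cmod b)\<^sup>2" for a b
  proof -
    have "0 \<le> (cmod a)\<^sup>2 - 2 * cmod a * cmod b + (cmod b)\<^sup>2" "0 \<le> cmod a * cmod b"
      using zero_le_power2[of "cmod a - cmod b"] by (auto simp: power2_diff)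
    then show ?thesis by linarith
  qed
  then show "AE x in M. norm (f x * g x) \<le> norm ((cmod (f x))\<^sup>2 + (cmod (g x))\<^sup>2)"
    by (auto simp: norm_mult)
qed

lemma integral_mult_le_sqnorm:
  assumes "f \<in> L2 M" "g \<in> L2 M"
  shows "ennreal ((cmod (\<integral>x. f x * g x \<partial>M))\<^sup>2) \<le> sqnorm M f * sqnorm M g"
proof -
  have "ennreal (cmod (\<integral>x. f x * g x \<partial>M)) \<le> (\<integral>\<^sup>+x. ennreal (cmod (f x * g x)) \<partial>M)"
    by (rule integral_norm_bound_ennreal[OF integrable_L2_mult[OF assms]])
  also have "\<dots> = (\<integral>\<^sup>+x. ennreal (cmod (f x)) * ennreal (cmod (g x)) \<partial>M)"
    by (simp add: norm_mult ennreal_mult)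
  finally have "(ennreal (cmod (\<integral>x. f x * g x \<partial>M)))\<^sup>2 \<le> (\<integral>\<^sup>+x. ennreal (cmod (f x)) * ennreal (cmod (g x)) \<partial>M)\<^sup>2"
    by (rule power_mono) auto
  also have "\<dots> \<le> (\<integral>\<^sup>+x. (ennreal (cmod (f x)))\<^sup>2 \<partial>M) * (\<integral>\<^sup>+x. (ennreal (cmod (g x)))\<^sup>2 \<partial>M)"
    using assms by (intro Cauchy_Schwarz_nn_integral) (auto simp: L2_def)
  finally show ?thesis by (simp add: sqnorm_def ennreal_power)
qed

lemma tendsto_0_of_square_ennreal:
  fixes a :: "'i \<Rightarrow> complex"
  assumes "eventually (\<lambda>i. ennreal ((cmod (a i))\<^sup>2) \<le> s i) F" "(s \<longlongrightarrow> 0) F"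
  shows "(a \<longlongrightarrow> 0) F"
proof -
  have "((\<lambda>i. ennreal ((cmod (a i))\<^sup>2)) \<longlongrightarrow> ennreal 0) F"
    using tendsto_sandwich[OF _ assms(1) tendsto_const[of 0] assms(2)] by auto
  then have "((\<lambda>i. (cmod (a i))\<^sup>2) \<longlongrightarrow> 0) F"
    by (subst (asm) tendsto_ennreal_iff) auto
  then have "((\<lambda>i. sqrt ((cmod (a i))\<^sup>2)) \<longlongrightarrow> sqrt 0) F" by (rule tendsto_real_sqrt)
  then show ?thesis by (simp add: tendsto_norm_zero_iff)
qed

text \<open>Write \<open>f g - f\<^sub>0 g\<^sub>0 = f\<^sub>0 (g - g\<^sub>0) + g\<^sub>0 (f - f\<^sub>0) + (f - f\<^sub>0)(g - g\<^sub>0)\<close> and apply the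
  Cauchy-Schwarz inequality to each of the three terms.\<close>

lemma L2_pairing_tendsto:
  assumes "\<And>i. f i \<in> L2 M" "\<And>i. g i \<in> L2 M" "f0 \<in> L2 M" "g0 \<in> L2 M"
    and f: "((\<lambda>i. sqnorm M (\<lambda>x. f i x - f0 x)) \<longlongrightarrow> 0) F"
    and g: "((\<lambda>i. sqnorm M (\<lambda>x. g i x - g0 x)) \<longlongrightarrow> 0) F"
  shows "((\<lambda>i. \<integral>x. f i x * g i x \<partial>M) \<longlongrightarrow> (\<integral>x. f0 x * g0 x \<partial>M)) F"
proof -
  let ?D = "\<lambda>i x. f i x - f0 x" and ?E = "\<lambda>i x. g i x - g0 x"
  have L: "?D i \<in> L2 M" "?E i \<in> L2 M" for i using assms(1-4) by (auto intro: L2_diff)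
  have z1: "((\<lambda>i. \<integral>x. f0 x * ?E i x \<partial>M) \<longlongrightarrow> 0) F"
  proof (rule tendsto_0_of_square_ennreal)
    show "((\<lambda>i. sqnorm M f0 * sqnorm M (?E i)) \<longlongrightarrow> 0) F"
      using ennreal_tendsto_cmult[OF L2_finite[OF assms(3), unfolded infinity_ennreal_def] g] by simp
  qed (use integral_mult_le_sqnorm[OF assms(3) L(2)] in auto)
  have z2: "((\<lambda>i. \<integral>x. g0 x * ?D i x \<partial>M) \<longlongrightarrow> 0) F"
  proof (rule tendsto_0_of_square_ennreal)
    show "((\<lambda>i. sqnorm M g0 * sqnorm M (?D i)) \<longlongrightarrow> 0) F"
      using ennreal_tendsto_cmult[OF L2_finite[OF assms(4), unfolded infinity_ennreal_def] f] by simp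
  qed (use integral_mult_le_sqnorm[OF assms(4) L(1)] in auto)
  have z3: "((\<lambda>i. \<integral>x. ?D i x * ?E i x \<partial>M) \<longlongrightarrow> 0) F"
  proof (rule tendsto_0_of_square_ennreal)
    have "eventually (\<lambda>i. sqnorm M (?D i) < 1) F" using order_tendstoD(2)[OF f, of 1] by simp
    then show "eventually (\<lambda>i. ennreal ((cmod (\<integral>x. ?D i x * ?E i x \<partial>M))\<^sup>2) \<le> sqnorm M (?E i)) F"
    proof eventually_elim
      case (elim i)
      have "sqnorm M (?D i) * sqnorm M (?E i) \<le> 1 * sqnorm M (?E i)"
        using elim by (intro mult_right_mono) auto
      with integral_mult_le_sqnorm[OF L[of i]] show ?case unfolding mult_1 by (rule order_trans)
    qed
  qed (rule g)
  have "(\<integral>x. f i x * g i x \<partial>M) = (\<integral>x. f0 x * g0 x \<partial>M) + (\<integral>x. f0 x * ?E i x \<partial>M)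
      + (\<integral>x. g0 x * ?D i x \<partial>M) + (\<integral>x. ?D i x * ?E i x \<partial>M)" for i
  proof -
    have "f i x * g i x = f0 x * g0 x + f0 x * ?E i x + g0 x * ?D i x + ?D i x * ?E i x" for x
      by (simp add: algebra_simps)
    then have "(\<integral>x. f i x * g i x \<partial>M) = (\<integral>x. f0 x * g0 x + f0 x * ?E i x + g0 x * ?D i x + ?D i x * ?E i x \<partial>M)"
      by (rule Bochner_Integration.integral_cong[OF refl])
    also have "\<dots> = (\<integral>x. f0 x * g0 x \<partial>M) + (\<integral>x. f0 x * ?E i x \<partial>M)
      + (\<integral>x. g0 x * ?D i x \<partial>M) + (\<integral>x. ?D i x * ?E i x \<partial>M)"
      using integrable_L2_mult[OF assms(3,4)] integrable_L2_mult[OF assms(3) L(2)[of i]]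
        integrable_L2_mult[OF assms(4) L(1)[of i]] integrable_L2_mult[OF L[of i]]
      by (simp only: Bochner_Integration.integral_add Bochner_Integration.integrable_add)
    finally show ?thesis .
  qed
  then show ?thesis
    using tendsto_add[OF tendsto_add[OF tendsto_add[OF tendsto_const z1] z2] z3, of "\<integral>x. f0 x * g0 x \<partial>M"] by simp
qed

section \<open>Completeness of \<open>L\<^sup>2\<close>\<close>

lemma sqnorm_Fatou:
  assumes [measurable]: "\<And>k. S k \<in> borel_measurable M" "g \<in> borel_measurable M"
    and lim: "AE x in M. (\<lambda>k. S k x) \<longlonglongrightarrow> F x"
    and bd: "\<And>k. k \<ge> K \<Longrightarrow> sqnorm M (\<lambda>x. S k x - g x) \<le> c"
  shows "sqnorm M (\<lambda>x. F x - g x) \<le> c"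
proof -
  have "sqnorm M (\<lambda>x. F x - g x) = (\<integral>\<^sup>+x. liminf (\<lambda>k. ennreal ((cmod (S k x - g x))\<^sup>2)) \<partial>M)"
    unfolding sqnorm_def
  proof (rule nn_integral_cong_AE, use lim in eventually_elim)
    case (elim x)
    have "(\<lambda>k. ennreal ((cmod (S k x - g x))\<^sup>2)) \<longlonglongrightarrow> ennreal ((cmod (F x - g x))\<^sup>2)"
      by (intro tendsto_ennrealI tendsto_intros elim)
    from lim_imp_Liminf[OF _ this] show ?case by simp
  qed
  also have "\<dots> \<le> liminf (\<lambda>k. sqnorm M (\<lambda>x. S k x - g x))"
    unfolding sqnorm_def by (rule nn_integral_liminf) measurable
  also have "\<dots> \<le> c"
    using bd by (intro Liminf_le) (auto simp: eventually_sequentially)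
  finally show ?thesis .
qed

text \<open>The terms of the convergent series are bounded, so the increments are \<open>O(2\<^bsup>-k/2\<^esup>)\<close> and therefore
  absolutely summable. The square of the increment is kept in the hypothesis because its integral is
  a square norm.\<close>

lemma convergent_of_fast_increments:
  fixes s :: "nat \<Rightarrow> complex"
  assumes "(\<Sum>k. ennreal (2 ^ k * (cmod (s (Suc k) - s k))\<^sup>2)) \<noteq> \<infinity>"
  shows "convergent s"
proof -
  let ?a = "\<lambda>k. 2 ^ k * (cmod (s (Suc k) - s k))\<^sup>2"
  have sm: "summable ?a"
    using assms by (intro summable_suminf_not_top) auto
  have bound: "cmod (s (Suc k) - s k) \<le> (1 / sqrt 2) ^ k * sqrt (\<Sum>k. ?a k)" for k
  proof -
    have "?a k \<le> (\<Sum>k. ?a k)"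
      using sum_le_suminf[OF sm, of "{k}"] by auto
    then have "sqrt (?a k) \<le> sqrt (\<Sum>k. ?a k)" by simp
    moreover have "sqrt (?a k) = (sqrt 2) ^ k * cmod (s (Suc k) - s k)"
      by (simp add: real_sqrt_mult real_sqrt_power)
    ultimately show ?thesis by (simp add: field_simps power_divide)
  qed
  have "summable (\<lambda>k. (1 / sqrt 2) ^ k * sqrt (\<Sum>k. ?a k))"
    by (intro summable_mult2 summable_geometric) auto
  then have "summable (\<lambda>k. s (Suc k) - s k)"
    by (rule summable_comparison_test'[where N = 0]) (rule bound)
  then have "convergent (\<lambda>n. \<Sum>k<n. s (Suc k) - s k)"
    by (simp add: summable_iff_convergent)
  then have "convergent (\<lambda>n. s n - s 0)"
    by (simp only: sum_lessThan_telescope)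
  from convergent_add[OF this convergent_const[of "s 0"]] show ?thesis by simp
qed

text \<open>Riesz-Fischer with an explicit limit: the function \<open>F\<close> is the pointwise limit of the sequence
  itself and not merely some member of its \<open>L\<^sup>2\<close> class. If \<open>S\<close> depends measurably on a parameter,
  then so does \<open>F\<close>, which later makes the time integrals meaningful. The rate \<open>1/8\<close> leaves room
  for the weights \<open>2\<^sup>k\<close> that force convergence almost everywhere.\<close>

lemma L2_limit_pointwise:
  assumes S: "\<And>k. S k \<in> L2 M"
    and fast: "\<And>k j. k \<le> j \<Longrightarrow> sqnorm M (\<lambda>x. S j x - S k x) \<le> ennreal ((1 / 8) ^ k)"
  defines "F \<equiv> \<lambda>x. lim (\<lambda>k. S k x)"
  shows "F \<in> L2 M" "AE x in M. (\<lambda>k. S k x) \<longlonglongrightarrow> F x"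
    "sqnorm M (\<lambda>x. F x - S k x) \<le> ennreal ((1 / 8) ^ k)"
proof -
  have [measurable]: "\<And>k. S k \<in> borel_measurable M" using S by (rule L2_measurable)
  have mF [measurable]: "F \<in> borel_measurable M" unfolding F_def by measurable
  have "(\<integral>\<^sup>+x. (\<Sum>k. ennreal (2 ^ k * (cmod (S (Suc k) x - S k x))\<^sup>2)) \<partial>M)
      = (\<Sum>k. \<integral>\<^sup>+x. ennreal (2 ^ k * (cmod (S (Suc k) x - S k x))\<^sup>2) \<partial>M)"
    by (rule nn_integral_suminf) measurable
  also have "\<dots> = (\<Sum>k. ennreal (2 ^ k) * sqnorm M (\<lambda>x. S (Suc k) x - S k x))"
    unfolding sqnorm_def by (intro suminf_cong) (auto simp: ennreal_mult nn_integral_cmult)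
  also have "\<dots> \<le> (\<Sum>k. ennreal ((1 / 4) ^ k))"
  proof (intro suminf_le summableI)
    fix k
    have "ennreal (2 ^ k) * sqnorm M (\<lambda>x. S (Suc k) x - S k x) \<le> ennreal (2 ^ k) * ennreal ((1 / 8) ^ k)"
      by (intro mult_left_mono fast) auto
    also have "\<dots> = ennreal ((1 / 4) ^ k)"
      by (simp add: ennreal_mult[symmetric] power_mult_distrib[symmetric])
    finally show "ennreal (2 ^ k) * sqnorm M (\<lambda>x. S (Suc k) x - S k x) \<le> ennreal ((1 / 4) ^ k)" .
  qed
  also have "\<dots> < \<infinity>"
    by (subst suminf_ennreal2) (auto intro: summable_geometric)
  finally have "AE x in M. (\<Sum>k. ennreal (2 ^ k * (cmod (S (Suc k) x - S k x))\<^sup>2)) \<noteq> \<infinity>"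
    by (intro nn_integral_PInf_AE) auto
  then show lim: "AE x in M. (\<lambda>k. S k x) \<longlonglongrightarrow> F x"
    unfolding F_def
    by eventually_elim (rule convergent_of_fast_increments[THEN convergent_LIMSEQ_iff[THEN iffD1]], simp)
  show bd: "sqnorm M (\<lambda>x. F x - S k x) \<le> ennreal ((1 / 8) ^ k)" for k
    by (rule sqnorm_Fatou[where S = S and K = k, OF _ _ lim]) (auto intro: fast)
  have "(\<lambda>x. F x - S 0 x) \<in> L2 M"
    using le_less_trans[OF bd[of 0] ennreal_less_top] by (simp add: L2_iff)
  from L2_add[OF this S[of 0]] show "F \<in> L2 M" by simp
qed

section \<open>Orthogonal series\<close>

definition orthogonal_family :: "'a measure \<Rightarrow> ('i \<Rightarrow> 'a \<Rightarrow> complex) \<Rightarrow> bool"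
  where "orthogonal_family M e \<longleftrightarrow>
    (\<forall>i. e i \<in> L2 M) \<and> (\<forall>i j. i \<noteq> j \<longrightarrow> (\<integral>x. e i x * cnj (e j x) \<partial>M) = 0)"

definition series_weight :: "'a measure \<Rightarrow> ('i \<Rightarrow> 'a \<Rightarrow> complex) \<Rightarrow> ('i \<Rightarrow> complex) \<Rightarrow> 'i \<Rightarrow> real"
  where "series_weight M e c i = (cmod (c i))\<^sup>2 * (\<integral>x. (cmod (e i x))\<^sup>2 \<partial>M)"

lemma series_weight_nonneg: "0 \<le> series_weight M e c i"
  by (simp add: series_weight_def)

lemma integral_cnj_self:
  "(\<integral>x. f x * cnj (f x) \<partial>M) = complex_of_real (\<integral>x. (cmod (f x))\<^sup>2 \<partial>M)"
  by (subst integral_complex_of_real[symmetric])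
    (auto intro!: Bochner_Integration.integral_cong simp: complex_norm_square simp del: of_real_power)

text \<open>Pythagoras: only the diagonal terms of the double sum survive integration.\<close>

lemma orthogonal_sqnorm_sum:
  assumes e: "orthogonal_family M e" and fin: "finite I"
  shows "sqnorm M (\<lambda>x. \<Sum>i\<in>I. c i * e i x) = ennreal (\<Sum>i\<in>I. series_weight M e c i)"
proof -
  let ?S = "\<lambda>x. \<Sum>i\<in>I. c i * e i x"
  have L: "e i \<in> L2 M" and o: "i \<noteq> j \<Longrightarrow> (\<integral>x. e i x * cnj (e j x) \<partial>M) = 0" for i j
    using e by (auto simp: orthogonal_family_def)
  have int: "integrable M (\<lambda>x. e i x * cnj (e j x))" for i j
    by (intro integrable_L2_mult L2_cnj L)
  have "complex_of_real (\<integral>x. (cmod (?S x))\<^sup>2 \<partial>M) = (\<integral>x. ?S x * cnj (?S x) \<partial>M)"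
    by (rule integral_cnj_self[symmetric])
  also have "\<dots> = (\<integral>x. (\<Sum>i\<in>I. \<Sum>j\<in>I. (c i * cnj (c j)) * (e i x * cnj (e j x))) \<partial>M)"
    by (rule Bochner_Integration.integral_cong[OF refl]) (simp add: sum_product mult_ac)
  also have "\<dots> = (\<Sum>i\<in>I. \<Sum>j\<in>I. (c i * cnj (c j)) * (\<integral>x. e i x * cnj (e j x) \<partial>M))"
    by (simp add: Bochner_Integration.integral_sum int)
  also have "\<dots> = (\<Sum>i\<in>I. \<Sum>j\<in>I. if j = i then complex_of_real (series_weight M e c i) else 0)"
  proof (intro sum.cong refl)
    fix i j
    show "(c i * cnj (c j)) * (\<integral>x. e i x * cnj (e j x) \<partial>M)
      = (if j = i then complex_of_real (series_weight M e c i) else 0)"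
      using o[of i j]
      by (cases "i = j") (auto simp: series_weight_def integral_cnj_self complex_norm_square[symmetric] simp del: of_real_power)
  qed
  also have "\<dots> = complex_of_real (\<Sum>i\<in>I. series_weight M e c i)"
    using fin by simp
  finally have "(\<integral>x. (cmod (?S x))\<^sup>2 \<partial>M) = (\<Sum>i\<in>I. series_weight M e c i)"
    by (simp only: of_real_eq_iff)
  moreover have "?S \<in> L2 M" by (rule L2_lincomb[OF L])
  ultimately show ?thesis by (simp add: sqnorm_eq_integral)
qed

text \<open>An exhaustion of the index set along which the tails of \<open>a\<close> decay geometrically. When
  \<open>a\<close> is the weight of an orthogonal series, the partial sums along it converge almost everywhere.
  It depends on the moduli of the coefficients alone, so that one exhaustion serves a whole family of
  series whose coefficients differ by phases.\<close>

definition exhausts :: "('i \<Rightarrow> real) \<Rightarrow> (nat \<Rightarrow> 'i set) \<Rightarrow> bool"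
  where "exhausts a I \<longleftrightarrow> (\<forall>k. finite (I k)) \<and> (\<forall>k j. k \<le> j \<longrightarrow> I k \<subseteq> I j) \<and>
    (\<forall>k J. finite J \<longrightarrow> J \<inter> I k = {} \<longrightarrow> sum a J \<le> (1 / 8) ^ k)"

text \<open>Finite sums of \<open>a\<close> come arbitrarily close to their supremum, and what is left for a set
  disjoint from an almost optimal one is small.\<close>

lemma exhausts_exists:
  fixes a :: "'i \<Rightarrow> real"
  assumes nn: "\<And>i. 0 \<le> a i" and bd: "\<And>I. finite I \<Longrightarrow> sum a I \<le> B"
  shows "\<exists>I. exhausts a I"
proof -
  define s where "s = (SUP I\<in>{I. finite I}. sum a I)"
  have bdd: "bdd_above (sum a ` {I. finite I})"
    using bd by (auto simp: bdd_above_def)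
  have ub: "sum a I \<le> s" if "finite I" for I
    unfolding s_def using that by (intro cSUP_upper bdd) auto
  have "\<exists>I. finite I \<and> s - (1 / 8) ^ k < sum a I" for k :: nat
  proof -
    have "s - (1 / 8) ^ k < s" by simp
    then show ?thesis
      unfolding s_def by (subst (asm) less_cSUP_iff) (auto intro: bdd)
  qed
  then obtain A where A: "\<And>k. finite (A k)" "\<And>k. s - (1 / 8) ^ k < sum a (A k)"
    by metis
  have "exhausts a (\<lambda>k. \<Union>j\<le>k. A j)"
    unfolding exhausts_def
  proof (intro conjI allI impI)
    fix k :: nat and J assume J: "finite J" "J \<inter> (\<Union>j\<le>k. A j) = {}"
    have "sum a J + sum a (A k) = sum a (J \<union> A k)"
      using J A by (subst sum.union_disjoint) auto
    also have "\<dots> \<le> s" using J A by (intro ub) auto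
    finally show "sum a J \<le> (1 / 8) ^ k" using A(2)[of k] by linarith
  qed (use A in \<open>auto intro: order_trans\<close>)
  then show ?thesis by (intro exI)
qed

lemma exhausts_tail: "exhausts a I \<Longrightarrow> finite J \<Longrightarrow> J \<inter> I k = {} \<Longrightarrow> sum a J \<le> (1 / 8) ^ k"
  unfolding exhausts_def by blast

lemma sum_symmetric_difference:
  fixes f :: "'i \<Rightarrow> complex"
  assumes "finite A" "finite B"
  shows "sum f A - sum f B = (\<Sum>i\<in>(A - B) \<union> (B - A). (if i \<in> A then 1 else -1) * f i)"
proof -
  have "sum f A = sum f (A \<inter> B) + sum f (A - B)" "sum f B = sum f (A \<inter> B) + sum f (B - A)"
    using sum.Int_Diff[OF assms(1), of f B] sum.Int_Diff[OF assms(2), of f A] by (simp_all only: Int_commute)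
  moreover have "(\<Sum>i\<in>(A - B) \<union> (B - A). (if i \<in> A then 1 else -1) * f i)
      = (\<Sum>i\<in>A - B. (if i \<in> A then 1 else -1) * f i) + (\<Sum>i\<in>B - A. (if i \<in> A then 1 else -1) * f i)"
    using assms by (intro sum.union_disjoint) auto
  moreover have "(\<Sum>i\<in>A - B. (if i \<in> A then 1 else -1) * f i) = sum f (A - B)"
    by (rule sum.cong) auto
  moreover have "(\<Sum>i\<in>B - A. (if i \<in> A then 1 else -1) * f i) = - sum f (B - A)"
    by (subst sum_negf[symmetric], rule sum.cong) auto
  ultimately show ?thesis by simp
qed

text \<open>The difference of two partial sums is a signed sum over the symmetric difference of the index
  sets, and that avoids \<open>I k\<close>.\<close>

lemma exhausts_sum_diff_le:
  assumes e: "orthogonal_family M e" and I: "exhausts (series_weight M e c) I"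
    and A: "finite A" "I k \<subseteq> A" and B: "finite B" "I k \<subseteq> B"
  shows "sqnorm M (\<lambda>x. (\<Sum>i\<in>A. c i * e i x) - (\<Sum>i\<in>B. c i * e i x)) \<le> ennreal ((1 / 8) ^ k)"
proof -
  let ?D = "(A - B) \<union> (B - A)"
  let ?c = "\<lambda>i. (if i \<in> A then 1 else -1) * c i"
  have "sqnorm M (\<lambda>x. (\<Sum>i\<in>A. c i * e i x) - (\<Sum>i\<in>B. c i * e i x))
      = sqnorm M (\<lambda>x. \<Sum>i\<in>?D. ?c i * e i x)"
    by (simp only: sum_symmetric_difference[OF A(1) B(1)] mult.assoc)
  also have "\<dots> = ennreal (\<Sum>i\<in>?D. series_weight M e ?c i)"
    using A B by (intro orthogonal_sqnorm_sum e) auto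
  also have "(\<Sum>i\<in>?D. series_weight M e ?c i) = (\<Sum>i\<in>?D. series_weight M e c i)"
    by (rule sum.cong) (auto simp: series_weight_def norm_mult)
  also have "\<dots> \<le> (1 / 8) ^ k"
    using A B by (intro exhausts_tail[OF I]) auto
  finally show ?thesis by (simp add: ennreal_leI)
qed

text \<open>The estimate holds for every finite index set above \<open>I k\<close>, which upgrades convergence along the
  sequence \<open>I\<close> to convergence of the unordered sum.\<close>

lemma orthogonal_series_limit:
  assumes e: "orthogonal_family M e" and I: "exhausts (series_weight M e c) I"
  defines "F \<equiv> \<lambda>x. lim (\<lambda>k. \<Sum>i\<in>I k. c i * e i x)"
  shows "F \<in> L2 M"
    and "\<And>J. finite J \<Longrightarrow> I k \<subseteq> J \<Longrightarrow> sqnorm M (\<lambda>x. F x - (\<Sum>i\<in>J. c i * e i x)) \<le> ennreal ((1 / 8) ^ k)"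
    and "AE x in M. (\<lambda>k. \<Sum>i\<in>I k. c i * e i x) \<longlonglongrightarrow> F x"
proof -
  have L: "(\<lambda>x. \<Sum>i\<in>J. c i * e i x) \<in> L2 M" for J
    using e by (intro L2_lincomb) (auto simp: orthogonal_family_def)
  have fast: "sqnorm M (\<lambda>x. (\<Sum>i\<in>I j. c i * e i x) - (\<Sum>i\<in>I k. c i * e i x)) \<le> ennreal ((1 / 8) ^ k)"
    if "k \<le> j" for k j
    using I that by (intro exhausts_sum_diff_le[OF e I]) (auto simp: exhausts_def)
  note lim = L2_limit_pointwise[where S = "\<lambda>k x. \<Sum>i\<in>I k. c i * e i x", OF L fast]
  show "F \<in> L2 M" "AE x in M. (\<lambda>k. \<Sum>i\<in>I k. c i * e i x) \<longlonglongrightarrow> F x"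
    unfolding F_def by (rule lim; assumption)+
  show "sqnorm M (\<lambda>x. F x - (\<Sum>i\<in>J. c i * e i x)) \<le> ennreal ((1 / 8) ^ k)"
    if "finite J" "I k \<subseteq> J" for J
    unfolding F_def
  proof (rule sqnorm_Fatou[OF _ _ lim(2), where K = k])
    fix j assume "k \<le> j"
    then show "sqnorm M (\<lambda>x. (\<Sum>i\<in>I j. c i * e i x) - (\<Sum>i\<in>J. c i * e i x)) \<le> ennreal ((1 / 8) ^ k)"
      using I that by (intro exhausts_sum_diff_le[OF e I]) (auto simp: exhausts_def)
  qed (use L in \<open>auto dest: L2_measurable\<close>)
qed

lemma power_eighth_tendsto_0: "(\<lambda>k. ennreal ((1 / 8) ^ k)) \<longlonglongrightarrow> 0"
  using tendsto_ennrealI[OF LIMSEQ_realpow_zero[of "1/8"]] by simp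

lemma orthogonal_series_limit_seq:
  assumes e: "orthogonal_family M e" and I: "exhausts (series_weight M e c) I"
  shows "(\<lambda>k. sqnorm M (\<lambda>x. lim (\<lambda>k. \<Sum>i\<in>I k. c i * e i x) - (\<Sum>i\<in>I k. c i * e i x))) \<longlonglongrightarrow> 0"
  using I by (intro tendsto_sandwich[OF _ _ tendsto_const power_eighth_tendsto_0] always_eventually)
    (auto simp: exhausts_def intro!: orthogonal_series_limit(2)[OF e I])

lemma L2_has_sum_iff_sqnorm:
  "L2_has_sum M F f \<longleftrightarrow> (\<forall>i. F i \<in> L2 M) \<and> f \<in> L2 M \<and>
    ((\<lambda>I. sqnorm M (\<lambda>x. f x - (\<Sum>i\<in>I. F i x))) \<longlongrightarrow> 0) (finite_subsets_at_top UNIV)"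
  by (simp add: L2_has_sum_def Lp_norm_2_tendsto_0_iff)

lemma L2_has_sum_orthogonal:
  assumes e: "orthogonal_family M e" and I: "exhausts (series_weight M e c) I"
  shows "L2_has_sum M (\<lambda>i x. c i * e i x) (\<lambda>x. lim (\<lambda>k. \<Sum>i\<in>I k. c i * e i x))"
  unfolding L2_has_sum_iff_sqnorm
proof (intro conjI allI)
  show "(\<lambda>x. c i * e i x) \<in> L2 M" for i
    using e by (intro L2_cmult) (auto simp: orthogonal_family_def)
  show "(\<lambda>x. lim (\<lambda>k. \<Sum>i\<in>I k. c i * e i x)) \<in> L2 M"
    by (rule orthogonal_series_limit[OF e I])
  let ?F = "\<lambda>x. lim (\<lambda>k. \<Sum>i\<in>I k. c i * e i x)"
  show "((\<lambda>J. sqnorm M (\<lambda>x. ?F x - (\<Sum>i\<in>J. c i * e i x))) \<longlongrightarrow> 0) (finite_subsets_at_top UNIV)"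
  proof (rule order_tendstoI)
    fix r :: ennreal assume "0 < r"
    then obtain k where k: "ennreal ((1 / 8) ^ k) < r"
      using order_tendstoD(2)[OF power_eighth_tendsto_0] by (auto simp: eventually_sequentially)
    show "eventually (\<lambda>J. sqnorm M (\<lambda>x. ?F x - (\<Sum>i\<in>J. c i * e i x)) < r) (finite_subsets_at_top UNIV)"
      unfolding eventually_finite_subsets_at_top
    proof (intro exI[of _ "I k"] conjI allI impI subset_UNIV)
      show "finite (I k)" using I by (auto simp: exhausts_def)
      fix J assume "finite J \<and> I k \<subseteq> J \<and> J \<subseteq> UNIV"
      then show "sqnorm M (\<lambda>x. ?F x - (\<Sum>i\<in>J. c i * e i x)) < r"
        using orthogonal_series_limit(2)[OF e I, of J k] k by (auto intro: le_less_trans)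
    qed
  qed auto
qed

text \<open>Adding indices to a partial sum increases its norm, by orthogonality, and from some finite set
  on the partial sums are close to \<open>f\<close>.\<close>

lemma L2_has_sum_weights_bounded:
  assumes e: "orthogonal_family M e" and s: "L2_has_sum M (\<lambda>i x. c i * e i x) f"
  shows "\<exists>B. \<forall>I. finite I \<longrightarrow> sum (series_weight M e c) I \<le> B"
proof -
  have L: "(\<lambda>x. \<Sum>i\<in>J. c i * e i x) \<in> L2 M" for J
    using e by (intro L2_lincomb) (auto simp: orthogonal_family_def)
  have f: "f \<in> L2 M" using s by (simp add: L2_has_sum_def)
  have "eventually (\<lambda>J. sqnorm M (\<lambda>x. f x - (\<Sum>i\<in>J. c i * e i x)) < 1) (finite_subsets_at_top UNIV)"
    using s by (intro order_tendstoD(2)) (auto simp: L2_has_sum_iff_sqnorm)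
  then obtain X where X: "finite X"
    "\<And>J. finite J \<Longrightarrow> X \<subseteq> J \<Longrightarrow> sqnorm M (\<lambda>x. f x - (\<Sum>i\<in>J. c i * e i x)) < 1"
    by (auto simp: eventually_finite_subsets_at_top)
  let ?B = "2 * (\<integral>x. (cmod (f x))\<^sup>2 \<partial>M) + 2"
  have "sum (series_weight M e c) I \<le> ?B" if "finite I" for I
  proof -
    let ?J = "I \<union> X"
    have "sum (series_weight M e c) I \<le> sum (series_weight M e c) ?J"
      using that X by (intro sum_mono2) (auto simp: series_weight_nonneg)
    also have "ennreal \<dots> = sqnorm M (\<lambda>x. \<Sum>i\<in>?J. c i * e i x)"
      using that X by (subst orthogonal_sqnorm_sum[OF e]) auto
    also have "\<dots> = sqnorm M (\<lambda>x. (\<Sum>i\<in>?J. c i * e i x) - 0)" by simp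
    also have "\<dots> \<le> 2 * sqnorm M (\<lambda>x. (\<Sum>i\<in>?J. c i * e i x) - f x) + 2 * sqnorm M (\<lambda>x. f x - 0)"
      using L2_measurable[OF L] L2_measurable[OF f] by (intro sqnorm_diff_le) auto
    also have "\<dots> \<le> 2 * 1 + 2 * ennreal (\<integral>x. (cmod (f x))\<^sup>2 \<partial>M)"
      using X(2)[of ?J] X(1) that f
      by (intro add_mono mult_left_mono) (auto simp: sqnorm_minus_commute[of M _ f] sqnorm_eq_integral)
    also have "\<dots> = ennreal ?B"
      by (subst add.commute, subst ennreal_plus) (auto simp: ennreal_mult')
    finally have "ennreal (sum (series_weight M e c) I) \<le> ennreal ?B"
      using ennreal_leI by blast
    then show ?thesis by (subst (asm) ennreal_le_iff) auto
  qed
  then show ?thesis by blast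
qed

lemma L2_has_sum_unique:
  assumes "L2_has_sum M F f" "L2_has_sum M F g"
  shows "AE x in M. f x = g x"
  using assms unfolding L2_has_sum_iff_sqnorm
  by (intro L2_limit_unique[where s="\<lambda>I x. \<Sum>i\<in>I. F i x" and F="finite_subsets_at_top UNIV"])
    (auto intro!: L2_measurable L2_finite_sum)

lemma L2_sum_has_sum: "L2_has_sum M F f \<Longrightarrow> L2_has_sum M F (L2_sum M F)"
  unfolding L2_sum_def by (rule someI[where P = "L2_has_sum M F"])

section \<open>Hermite polynomials\<close>

text \<open>The recursion is the creation operator \<open>p \<mapsto> x p - p'\<close>. This form turns Gaussian integration by
  parts into the rule \<open>gauss_mean_he_Suc_mult\<close>, from which orthogonality and the norms follow.\<close>

fun he :: "nat \<Rightarrow> real poly" where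
  "he 0 = 1"
| "he (Suc n) = pCons 0 (he n) - pderiv (he n)"

lemma pderiv_he: "pderiv (he (Suc n)) = smult (real (Suc n)) (he n)"
proof (induction n)
  case 0
  show ?case by (simp add: pderiv_pCons)
next
  case (Suc n)
  have "pderiv (he (Suc (Suc n))) = he (Suc n) + pCons 0 (pderiv (he (Suc n))) - pderiv (pderiv (he (Suc n)))"
    by (simp only: he.simps(2)[of "Suc n"] pderiv_diff pderiv_pCons)
  also have "\<dots> = he (Suc n) + smult (real (Suc n)) (he (Suc n))"
    by (simp add: Suc pderiv_smult smult_diff_right del: he.simps) (simp add: smult_diff_right)
  also have "\<dots> = smult (real (Suc (Suc n))) (he (Suc n))"
    using smult_add_left[of 1 "real (Suc n)" "he (Suc n)"] by (simp del: he.simps)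
  finally show ?case .
qed

lemma poly_he_recurrence:
  "poly (he (Suc (Suc n))) x = x * poly (he (Suc n)) x - real (Suc n) * poly (he n) x"
  by (subst he.simps(2)) (simp add: pderiv_he del: he.simps)

lemma poly_he_minus: "poly (he n) (- x) = (- 1) ^ n * poly (he n) x"
proof (induction n rule: induct_nat_012)
  case (ge2 n)
  then show ?case by (simp add: poly_he_recurrence algebra_simps del: he.simps)
qed (auto simp: pderiv_pCons)

lemma degree_he: "degree (he n) = n \<and> lead_coeff (he n) = 1"
proof (induction n)
  case (Suc n)
  then have nz: "he n \<noteq> 0" by auto
  have deg: "degree (pCons 0 (he n)) = Suc n" using nz Suc by simp
  have low: "degree (pderiv (he n)) < degree (pCons 0 (he n))"
    using deg degree_pderiv[of "he n"] Suc by simp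
  have c: "coeff (he n) n = 1" using Suc by metis
  from low have "degree (he (Suc n)) = Suc n"
    using deg degree_add_eq_left[of "- pderiv (he n)" "pCons 0 (he n)"] by simp
  moreover have "coeff (he (Suc n)) (Suc n) = 1"
    using Suc c by (simp add: coeff_eq_0 degree_pderiv)
  ultimately show ?case by (simp del: he.simps)
qed simp

lemma coeff_he: "coeff (he n) n = 1"
  using degree_he[of n] by metis

abbreviation std_gauss :: "real measure"
  where "std_gauss \<equiv> density lborel std_normal_density"

lemma prob_space_std_gauss: "prob_space std_gauss"
  by (rule prob_space_normal_density) simp

lemma integrable_power_std_gauss: "integrable std_gauss (\<lambda>x. x ^ k)"
  by (subst integrable_density) (auto simp: integrable_std_normal_moment)

lemma borel_measurable_poly [measurable]: "poly (p :: real poly) \<in> borel_measurable borel"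
  by (intro borel_measurable_continuous_onI continuous_intros)

lemma integrable_poly_std_gauss: "integrable std_gauss (poly p)"
proof -
  have "poly p = (\<lambda>x. \<Sum>i\<le>degree p. coeff p i * x ^ i)" by (auto simp: poly_altdef)
  then show ?thesis by (auto intro!: integrable_power_std_gauss)
qed

definition gauss_mean :: "real poly \<Rightarrow> real"
  where "gauss_mean p = (\<integral>x. poly p x \<partial>std_gauss)"

lemma gauss_mean_add: "gauss_mean (p + q) = gauss_mean p + gauss_mean q"
  and gauss_mean_diff: "gauss_mean (p - q) = gauss_mean p - gauss_mean q"
  and gauss_mean_smult: "gauss_mean (smult c p) = c * gauss_mean p"
  and gauss_mean_0: "gauss_mean 0 = 0"
  by (simp_all add: gauss_mean_def integrable_poly_std_gauss)

lemma gauss_mean_monom: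
  "gauss_mean (monom 1 k) = (if even k then fact k / (2 ^ (k div 2) * fact (k div 2)) else 0)"
proof -
  have *: "gauss_mean (monom 1 k) = (\<integral>x. std_normal_density x * x ^ k \<partial>lborel)"
    unfolding gauss_mean_def by (subst integral_density) (auto simp: poly_monom)
  show ?thesis
  proof (cases "even k")
    case True
    then obtain j where j: "k = 2 * j" by (elim evenE)
    show ?thesis using * j integral_std_normal_moment_even[of j] by simp
  next
    case False
    then obtain j where j: "k = 2 * j + 1" by (elim oddE)
    show ?thesis using * j integral_std_normal_moment_odd[of j] by simp
  qed
qed

text \<open>The moments of the normal distribution are the only analytic input for the Hermite polynomials.\<close>

lemma gauss_mean_monom_Suc:
  "gauss_mean (monom 1 (Suc (Suc k))) = real (Suc k) * gauss_mean (monom 1 k)"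
proof (cases "even k")
  case True
  then obtain j where j: "k = 2 * j" by (elim evenE)
  have "Suc (Suc k) div 2 = Suc j" "k div 2 = j" using j by auto
  moreover have "(a + 1) * F / (p * f) * (a + 2) / (a + 2) = (a + 1) * (F / (p * f))" if "a + 2 \<noteq> 0" for a F p f :: real
    using that by simp
  from this[of "real k" "fact k" "2 ^ j" "fact j"]
  have "(real k + 2) * ((real k + 1) * fact k) / (2 * 2 ^ j * ((real j + 1) * fact j)) = (real k + 1) * (fact k / (2 ^ j * fact j))"
    unfolding j by (simp add: divide_simps mult_ac)
  ultimately show ?thesis using True by (simp add: gauss_mean_monom add_ac)
qed (simp add: gauss_mean_monom)

text \<open>Both sides are linear in \<open>p\<close>, and splitting off the constant coefficient of \<open>p\<close> raises the
  power of the monomial. The power \<open>k\<close> therefore has to be arbitrary in the induction.\<close>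

lemma gauss_mean_by_parts_aux:
  "gauss_mean (monom 1 (Suc k) * p) = gauss_mean (pderiv (monom 1 k * p))"
proof (induction p arbitrary: k)
  case (pCons a p)
  have split: "monom 1 j * pCons a p = smult a (monom 1 j) + monom 1 (Suc j) * p" for j
  proof -
    have "pCons a p = [:a:] + monom 1 1 * p" by (simp add: monom_Suc)
    then show ?thesis by (simp add: distrib_left mult.assoc[symmetric] mult_monom mult.commute[of _ "[:a:]"])
  qed
  have "gauss_mean (monom 1 (Suc k)) = gauss_mean (pderiv (monom 1 k))"
  proof (cases k)
    case 0 then show ?thesis by (simp add: gauss_mean_monom gauss_mean_0)
  next
    case (Suc j)
    have "pderiv (monom 1 (Suc j)) = smult (real (Suc j)) (monom 1 j)"
      by (simp add: pderiv_monom smult_monom)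
    then show ?thesis unfolding Suc gauss_mean_monom_Suc by (simp add: gauss_mean_smult)
  qed
  then show ?case
    by (simp only: split gauss_mean_add gauss_mean_smult pCons.IH pderiv_add pderiv_smult)
qed (simp add: gauss_mean_0)

lemma gauss_mean_by_parts: "gauss_mean (pCons 0 p) = gauss_mean (pderiv p)"
  using gauss_mean_by_parts_aux[of 0 p] by (simp add: monom_Suc)

lemma gauss_mean_he_Suc_mult: "gauss_mean (he (Suc n) * p) = gauss_mean (he n * pderiv p)"
proof -
  have "he (Suc n) * p = pCons 0 (he n * p) - pderiv (he n) * p"
    by (simp add: left_diff_distrib)
  then show ?thesis
    by (simp add: gauss_mean_diff gauss_mean_by_parts pderiv_mult gauss_mean_add mult.commute del: he.simps)
qed

lemma gauss_mean_he_mult_low_degree: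
  "degree p < n \<Longrightarrow> gauss_mean (he n * p) = 0"
proof (induction n arbitrary: p)
  case (Suc n)
  show ?case
  proof (cases "degree p = 0")
    case True
    then have "pderiv p = 0" by (simp add: pderiv_eq_0_iff)
    then show ?thesis by (simp only: gauss_mean_he_Suc_mult) (simp add: gauss_mean_0)
  next
    case False
    then have "degree (pderiv p) < n" using Suc.prems by (simp add: degree_pderiv)
    then show ?thesis by (simp only: gauss_mean_he_Suc_mult Suc.IH)
  qed
qed simp

lemma gauss_mean_he_square: "gauss_mean (he n * he n) = fact n"
proof (induction n)
  case 0
  show ?case using gauss_mean_monom[of 0] by simp
next
  case (Suc n)
  show ?case
    by (simp only: gauss_mean_he_Suc_mult pderiv_he mult_smult_right gauss_mean_smult Suc) simp
qed

lemma gauss_mean_he: "gauss_mean (he m * he n) = (if m = n then fact m else 0)"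
  using gauss_mean_he_mult_low_degree[of "he m" n] gauss_mean_he_mult_low_degree[of "he n" m]
  by (cases m n rule: linorder_cases) (auto simp: degree_he gauss_mean_he_square mult.commute)

text \<open>A nonzero polynomial vanishes only on a finite set, which has Gaussian measure \<open>0\<close>.\<close>

lemma gauss_mean_square_eq_0: 
  assumes "gauss_mean (p * p) = 0" shows "p = 0"
proof (rule ccontr)
  assume nz: "p \<noteq> 0"
  interpret prob_space std_gauss by (rule prob_space_std_gauss)
  have "AE x in std_gauss. poly (p * p) x = 0"
    using assms unfolding gauss_mean_def
    by (subst (asm) integral_nonneg_eq_0_iff_AE[OF integrable_poly_std_gauss]) auto
  moreover have "AE x in std_gauss. x \<notin> {x. poly p x = 0}"
  proof -
    have "AE x in lborel. x \<notin> {x. poly p x = 0}"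
      by (intro AE_not_in finite_imp_null_set_lborel poly_roots_finite nz)
    then show ?thesis by (subst AE_density) auto
  qed
  ultimately have "AE x in std_gauss. False" by eventually_elim auto
  then show False by (simp add: AE_False)
qed

text \<open>Subtracting a multiple of \<open>H (degree p)\<close> from \<open>p\<close> lowers the degree, so the \<open>H j\<close> with
  \<open>j < n\<close> span all polynomials of degree below \<open>n\<close>.\<close>

lemma monic_orthogonal_low_degree:
  assumes H: "\<And>m. degree (H m) = m" "\<And>m. lead_coeff (H m) = (1::real)"
    and o: "\<And>m n. m \<noteq> n \<Longrightarrow> gauss_mean (H m * H n) = 0"
    and "degree p < n"
  shows "gauss_mean (H n * p) = 0"
  using \<open>degree p < n\<close>
proof (induction "degree p" arbitrary: p rule: less_induct)
  case less
  define q where "q = p - smult (lead_coeff p) (H (degree p))"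
  have p: "p = q + smult (lead_coeff p) (H (degree p))" by (simp add: q_def)
  have "gauss_mean (H n * q) = 0"
  proof (cases "q = 0")
    case False
    have "degree q \<le> degree p"
      unfolding q_def using H(1) by (intro degree_diff_le) (auto intro: order_trans[OF degree_smult_le])
    moreover have "coeff q (degree p) = 0" using H[of "degree p"] by (simp add: q_def)
    ultimately have "degree q < degree p"
      using False by (metis leading_coeff_0_iff le_neq_implies_less)
    then show ?thesis using less by simp
  qed (simp add: gauss_mean_0)
  then show ?case
    using o[of n "degree p"] less.prems
    by (subst p) (simp add: distrib_left gauss_mean_add gauss_mean_smult)
qed

text \<open>Two sequences of monic orthogonal polynomials agree: the difference \<open>D\<close> of their members of
  degree \<open>m\<close> has lower degree, hence is orthogonal to both members and so to itself.\<close>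

lemma hermite_eq_he: "hermite = he"
  unfolding hermite_def
proof (rule the_equality)
  have mean: "(\<integral>x. poly p x * poly q x \<partial>std_gauss) = gauss_mean (p * q)" for p q
    by (simp add: gauss_mean_def)
  show "(\<forall>m. degree (he m) = m \<and> lead_coeff (he m) = 1) \<and>
    (\<forall>m n. m \<noteq> n \<longrightarrow> (\<integral>x. poly (he m) x * poly (he n) x \<partial>std_gauss) = 0)"
    using degree_he coeff_he by (simp add: mean gauss_mean_he)
  fix H assume "(\<forall>m. degree (H m) = m \<and> lead_coeff (H m) = 1) \<and>
    (\<forall>m n. m \<noteq> n \<longrightarrow> (\<integral>x. poly (H m) x * poly (H n) x \<partial>std_gauss) = 0)"
  then have H: "degree (H m) = m" "lead_coeff (H m) = 1" "coeff (H m) m = 1"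
    and o: "m \<noteq> n \<Longrightarrow> gauss_mean (H m * H n) = 0" for m n
    by (metis, metis, metis, metis mean)
  show "H = he"
  proof
    fix m
    define D where "D = H m - he m"
    have "D = 0"
    proof (rule ccontr)
      assume nz: "D \<noteq> 0"
      have "degree D \<le> m" unfolding D_def using H(1) degree_he by (intro degree_diff_le) auto
      moreover have "coeff D m = 0" using H[of m] coeff_he[of m] by (simp add: D_def)
      ultimately have "degree D < m" using nz by (metis leading_coeff_0_iff le_neq_implies_less)
      then have "gauss_mean (H m * D) = 0" "gauss_mean (he m * D) = 0"
        using monic_orthogonal_low_degree[of H, OF H(1,2) o] gauss_mean_he_mult_low_degree by auto
      then have "gauss_mean (D * D) = 0"
        by (simp add: D_def left_diff_distrib gauss_mean_diff)
      then show False using nz gauss_mean_square_eq_0 by blast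
    qed
    then show "H m = he m" by (simp add: D_def)
  qed
qed

section \<open>The Gaussian measure\<close>

text \<open>The Lebesgue measure is a product over the basis vectors; this map turns them back into indices.\<close>

definition coord_of :: "real ^ 'n \<Rightarrow> 'n" where "coord_of b = (SOME i. b = axis i 1)"

lemma coord_of_axis [simp]: "coord_of (axis i 1) = i"
  unfolding coord_of_def by (rule some_equality) (auto simp: axis_eq_axis)

lemma bij_betw_axis: "bij_betw (\<lambda>i. axis i 1) UNIV (Basis :: (real ^ 'n) set)"
  unfolding bij_betw_def by (auto simp: inj_on_def axis_eq_axis Basis_vec_def)

lemma prod_Basis_vec: "(\<Prod>b\<in>(Basis :: (real ^ 'n) set). f (coord_of b) (x \<bullet> b)) = (\<Prod>i\<in>UNIV. f i (x $ i))"
  by (subst prod.reindex_bij_betw[OF bij_betw_axis, symmetric]) (simp add: inner_axis)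

lemma
  fixes f :: "'n::finite \<Rightarrow> real \<Rightarrow> real"
  assumes int: "\<And>i. integrable lborel (f i)"
  shows integrable_lborel_vec_prod: "integrable lborel (\<lambda>x :: real ^ 'n. \<Prod>i\<in>UNIV. f i (x $ i))"
    and integral_lborel_vec_prod: "(\<integral>x. (\<Prod>i\<in>UNIV. f i (x $ i)) \<partial>(lborel :: (real ^ 'n) measure)) = (\<Prod>i\<in>UNIV. \<integral>x. f i x \<partial>lborel)"
proof -
  interpret product_sigma_finite "\<lambda>_ :: real ^ 'n. lborel :: real measure"
    by (rule product_sigma_finite.intro) (rule sigma_finite_lborel)
  let ?S = "\<lambda>g :: real ^ 'n \<Rightarrow> real. \<Sum>b\<in>Basis. g b *\<^sub>R b"
  let ?M = "\<Pi>\<^sub>M b\<in>(Basis :: (real ^ 'n) set). (lborel :: real measure)"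
  let ?F = "\<lambda>x :: real ^ 'n. \<Prod>i\<in>UNIV. f i (x $ i)"
  have [measurable]: "f i \<in> borel_measurable borel" for i using int[of i] by auto
  have F: "?F = (\<lambda>x. \<Prod>b\<in>Basis. f (coord_of b) (x \<bullet> b))" by (simp add: prod_Basis_vec)
  have S [measurable]: "?S \<in> ?M \<rightarrow>\<^sub>M borel" by measurable
  have FS: "?F (?S g) = (\<Prod>b\<in>Basis. f (coord_of b) (g b))" for g
  proof -
    have "?F (?S g) = (\<Prod>b\<in>Basis. f (coord_of b) (?S g \<bullet> b))"
      by (rule prod_Basis_vec[symmetric])
    also have "\<dots> = (\<Prod>b\<in>Basis. f (coord_of b) (g b))"
      by (rule prod.cong) auto
    finally show ?thesis .
  qed
  have mF [measurable]: "?F \<in> borel_measurable borel" unfolding F by measurable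
  have "integrable ?M (\<lambda>g. \<Prod>b\<in>Basis. f (coord_of b) (g b))"
    by (rule product_integrable_prod) (auto intro: int)
  then show "integrable lborel ?F"
    by (subst lborel_eq) (simp add: integrable_distr_eq FS del: sum_component)
  have "(\<integral>x. ?F x \<partial>lborel) = (\<integral>g. (\<Prod>b\<in>Basis. f (coord_of b) (g b)) \<partial>?M)"
    by (subst lborel_eq) (simp add: integral_distr FS del: sum_component)
  also have "\<dots> = (\<Prod>b\<in>(Basis :: (real ^ 'n) set). \<integral>x. f (coord_of b) x \<partial>lborel)"
    by (rule product_integral_prod) (auto intro: int)
  also have "\<dots> = (\<Prod>i\<in>UNIV. \<integral>x. f i x \<partial>lborel)"
    by (subst prod.reindex_bij_betw[OF bij_betw_axis, symmetric]) simp
  finally show "(\<integral>x. ?F x \<partial>lborel) = (\<Prod>i\<in>UNIV. \<integral>x. f i x \<partial>lborel)" .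
qed

definition gauss_density :: "real ^ 'n \<Rightarrow> real"
  where "gauss_density x = (2 * pi) powr (- real CARD('n) / 2) * exp (- (norm x)\<^sup>2 / 2)"

lemma gauss_density_nonneg [simp]: "0 \<le> gauss_density x"
  by (simp add: gauss_density_def)

lemma gauss_eq: "gauss = density lborel (\<lambda>x. ennreal (gauss_density x))"
  by (simp add: gauss_def gauss_density_def)

lemma borel_measurable_gauss_density [measurable]: "gauss_density \<in> borel_measurable borel"
  unfolding gauss_density_def by measurable

lemma sets_gauss [measurable_cong, simp]: "sets gauss = sets borel"
  by (simp add: gauss_eq)

lemma space_gauss [simp]: "space gauss = UNIV"
  by (simp add: gauss_eq)

lemma norm_vec_square: "(norm (x :: real ^ 'n))\<^sup>2 = (\<Sum>i\<in>UNIV. (x $ i)\<^sup>2)"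
  by (simp add: norm_vec_def L2_set_def sum_nonneg)

lemma gauss_density_prod: "gauss_density (x :: real ^ 'n) = (\<Prod>i\<in>UNIV. std_normal_density (x $ i))"
proof -
  have "(\<Prod>i\<in>(UNIV::'n set). std_normal_density (x $ i)) = (1 / sqrt (2 * pi)) ^ CARD('n) * exp (\<Sum>i\<in>UNIV. - (x $ i)\<^sup>2 / 2)"
    by (simp add: std_normal_density_def prod_dividef exp_sum power_one_over)
  also have "(1 / sqrt (2 * pi)) ^ CARD('n) = (2 * pi) powr (- real CARD('n) / 2)"
  proof -
    have "1 / sqrt (2 * pi) = (2 * pi) powr (- (1 / 2))"
      by (simp only: powr_minus powr_half_sqrt[OF order.strict_implies_order[OF mult_pos_pos[OF zero_less_numeral pi_gt_zero]]] inverse_eq_divide)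
    then show ?thesis by (simp add: powr_power)
  qed
  also have "(\<Sum>i\<in>(UNIV::'n set). - (x $ i)\<^sup>2 / 2) = - (norm x)\<^sup>2 / 2"
    by (simp add: norm_vec_square sum_negf sum_divide_distrib)
  finally show ?thesis by (simp add: gauss_density_def)
qed

lemma
  fixes f :: "'n::finite \<Rightarrow> real \<Rightarrow> real"
  assumes int: "\<And>i. integrable std_gauss (f i)"
  shows integrable_gauss_prod: "integrable gauss (\<lambda>x :: real ^ 'n. \<Prod>i\<in>UNIV. f i (x $ i))"
    and integral_gauss_prod: "(\<integral>x. (\<Prod>i\<in>UNIV. f i (x $ i)) \<partial>(gauss :: (real ^ 'n) measure)) = (\<Prod>i\<in>UNIV. \<integral>x. f i x \<partial>std_gauss)"
proof -
  have [measurable]: "f i \<in> borel_measurable borel" for i using int[of i] by auto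
  have int': "integrable lborel (\<lambda>x. std_normal_density x * f i x)" for i
    using int[of i] by (subst (asm) integrable_density) auto
  have [measurable]: "(\<lambda>x :: real ^ 'n. \<Prod>i\<in>UNIV. f i (x $ i)) \<in> borel_measurable borel"
    by measurable
  have eq: "gauss_density x * (\<Prod>i\<in>UNIV. f i (x $ i)) = (\<Prod>i\<in>UNIV. std_normal_density (x $ i) * f i (x $ i))"
    for x :: "real ^ 'n"
    by (simp add: gauss_density_prod prod.distrib)
  show "integrable gauss (\<lambda>x :: real ^ 'n. \<Prod>i\<in>UNIV. f i (x $ i))"
    unfolding gauss_eq
    by (subst integrable_density) (auto simp: eq intro!: integrable_lborel_vec_prod int')
  have "(\<integral>x. (\<Prod>i\<in>UNIV. f i (x $ i)) \<partial>(gauss :: (real ^ 'n) measure)) = (\<integral>x. (\<Prod>i\<in>UNIV. std_normal_density (x $ i) * f i (x $ i)) \<partial>(lborel :: (real ^ 'n) measure))"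
    unfolding gauss_eq
    by (subst integral_density) (auto simp: eq)
  also have "\<dots> = (\<Prod>i\<in>UNIV. \<integral>x. std_normal_density x * f i x \<partial>lborel)"
    by (rule integral_lborel_vec_prod[OF int'])
  also have "\<dots> = (\<Prod>i\<in>UNIV. \<integral>x. f i x \<partial>std_gauss)"
    by (intro prod.cong refl, subst integral_density) auto
  finally show "(\<integral>x. (\<Prod>i\<in>UNIV. f i (x $ i)) \<partial>(gauss :: (real ^ 'n) measure)) = (\<Prod>i\<in>UNIV. \<integral>x. f i x \<partial>std_gauss)" .
qed

lemma prob_space_gauss: "prob_space (gauss :: (real ^ 'n) measure)"
proof -
  interpret s: prob_space std_gauss by (rule prob_space_std_gauss)
  have i: "integrable (gauss :: (real ^ 'n) measure) (\<lambda>x. 1 :: real)"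
    using integrable_gauss_prod[where 'n='n and f="\<lambda>_ _. 1"] by simp
  have "(\<integral>x. 1 \<partial>(gauss :: (real ^ 'n) measure)) = (1 :: real)"
    using integral_gauss_prod[where 'n='n and f="\<lambda>_ _. 1"] by (simp add: s.prob_space[simplified])
  then have "emeasure (gauss :: (real ^ 'n) measure) UNIV = 1"
    using nn_integral_eq_integral[OF i] by simp
  then show ?thesis by (intro prob_spaceI) simp
qed

lemma hermite_multi_eq: "hermite_multi m x = complex_of_real (\<Prod>i\<in>UNIV. poly (he (m $ i)) (x $ i))"
  by (simp add: hermite_multi_def hermite_eq_he)

lemma borel_measurable_hermite_multi [measurable]: "hermite_multi m \<in> borel_measurable borel"
  unfolding hermite_multi_eq[abs_def] by measurable

lemma hermite_multi_minus: "hermite_multi m (- x) = (- 1) ^ multi_abs m * hermite_multi m x"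
  by (simp add: hermite_multi_eq poly_he_minus prod.distrib multi_abs_def power_sum)

lemma hermite_multi_product_integral:
  fixes m n :: "nat ^ 'n"
  shows "integrable gauss (\<lambda>x. (\<Prod>i\<in>UNIV. poly (he (m $ i)) (x $ i)) * (\<Prod>i\<in>UNIV. poly (he (n $ i)) (x $ i)))"
    "(\<integral>x. (\<Prod>i\<in>UNIV. poly (he (m $ i)) (x $ i)) * (\<Prod>i\<in>UNIV. poly (he (n $ i)) (x $ i)) \<partial>gauss)
      = (if m = n then \<Prod>i\<in>UNIV. fact (m $ i) else 0)"
proof -
  have int: "integrable std_gauss (poly (he (m $ i) * he (n $ i)))" for i
    by (rule integrable_poly_std_gauss)
  show "integrable gauss (\<lambda>x. (\<Prod>i\<in>UNIV. poly (he (m $ i)) (x $ i)) * (\<Prod>i\<in>UNIV. poly (he (n $ i)) (x $ i)))"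
    using integrable_gauss_prod[OF int] by (simp add: prod.distrib)
  have "(\<integral>x. (\<Prod>i\<in>UNIV. poly (he (m $ i)) (x $ i)) * (\<Prod>i\<in>UNIV. poly (he (n $ i)) (x $ i)) \<partial>gauss)
    = (\<Prod>i\<in>UNIV. gauss_mean (he (m $ i) * he (n $ i)))"
    using integral_gauss_prod[OF int] by (simp add: prod.distrib gauss_mean_def)
  also have "\<dots> = (if m = n then \<Prod>i\<in>UNIV. fact (m $ i) else 0)"
    by (auto simp: gauss_mean_he vec_eq_iff)
  finally show "(\<integral>x. (\<Prod>i\<in>UNIV. poly (he (m $ i)) (x $ i)) * (\<Prod>i\<in>UNIV. poly (he (n $ i)) (x $ i)) \<partial>gauss)
      = (if m = n then \<Prod>i\<in>UNIV. fact (m $ i) else 0)" .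
qed

lemma hermite_multi_L2: "hermite_multi m \<in> L2 gauss"
proof -
  have "integrable gauss (\<lambda>x. (cmod (hermite_multi m x))\<^sup>2)"
    using hermite_multi_product_integral(1)[of m m]
    by (simp add: hermite_multi_eq power2_eq_square del: of_real_prod)
  then show ?thesis by (simp add: L2_def)
qed

lemma orthogonal_hermite_multi: "orthogonal_family gauss (hermite_multi :: nat ^ 'n \<Rightarrow> _)"
  unfolding orthogonal_family_def
proof (intro conjI allI impI hermite_multi_L2)
  fix m n :: "nat ^ 'n" assume "m \<noteq> n"
  have "(\<integral>x. hermite_multi m x * cnj (hermite_multi n x) \<partial>gauss)
     = (\<integral>x. complex_of_real ((\<Prod>i\<in>UNIV. poly (he (m $ i)) (x $ i)) * (\<Prod>i\<in>UNIV. poly (he (n $ i)) (x $ i))) \<partial>gauss)"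
    by (simp add: hermite_multi_eq)
  also have "\<dots> = 0"
    using hermite_multi_product_integral(2)[of m n] \<open>m \<noteq> n\<close> by (simp only: integral_complex_of_real) simp
  finally show "(\<integral>x. hermite_multi m x * cnj (hermite_multi n x) \<partial>gauss) = 0" .
qed

lemma hermite_multi_norm_pos: "0 < (\<integral>x. (cmod (hermite_multi m x))\<^sup>2 \<partial>gauss)"
  using hermite_multi_product_integral(2)[of m m]
  by (simp add: hermite_multi_eq power2_eq_square prod_pos del: of_real_prod)

section \<open>Scaling of Gaussian integrals\<close>

lemma nn_integral_lborel_affine:
  fixes f :: "'a::euclidean_space \<Rightarrow> ennreal"
  assumes [measurable]: "f \<in> borel_measurable borel" and "c \<noteq> 0"
  shows "(\<integral>\<^sup>+x. f x \<partial>lborel) = ennreal (\<bar>c\<bar> ^ DIM('a)) * (\<integral>\<^sup>+x. f (t + c *\<^sub>R x) \<partial>lborel)"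
  by (subst lborel_affine[OF \<open>c \<noteq> 0\<close>, of t])
    (simp add: nn_integral_density nn_integral_distr nn_integral_cmult)

lemma nn_integral_gauss:
  assumes [measurable]: "f \<in> borel_measurable borel"
  shows "(\<integral>\<^sup>+x. f x \<partial>gauss) = (\<integral>\<^sup>+x. ennreal (gauss_density x) * f x \<partial>lborel)"
  unfolding gauss_eq by (subst nn_integral_density) auto

text \<open>The substitution \<open>y = c x\<close>. It is used with different values of \<open>c\<close> for the \<open>L\<^sup>2\<close> norm and for
  the \<open>L\<^sup>p\<close> norm of the same function.\<close>

lemma nn_integral_gauss_scaled:
  fixes f :: "real ^ 'n \<Rightarrow> ennreal"
  assumes [measurable]: "f \<in> borel_measurable borel" and c: "0 < c"
  shows "(\<integral>\<^sup>+x. ennreal (exp (- (c * norm x)\<^sup>2 / 2)) * f (c *\<^sub>R x) \<partial>lborel)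
    = ennreal ((2 * pi) powr (real CARD('n) / 2) / c ^ CARD('n)) * (\<integral>\<^sup>+x. f x \<partial>gauss)"
proof -
  let ?A = "(2 * pi) powr (real CARD('n) / 2)"
  have A: "?A * gauss_density (x :: real ^ 'n) = exp (- (norm x)\<^sup>2 / 2)" for x
    by (simp add: gauss_density_def powr_minus field_simps)
  have "ennreal ?A * (\<integral>\<^sup>+x. f x \<partial>gauss) = (\<integral>\<^sup>+x. ennreal (exp (- (norm x)\<^sup>2 / 2)) * f x \<partial>lborel)"
    by (subst nn_integral_gauss, simp, subst nn_integral_cmult[symmetric], simp)
      (simp only: mult.assoc[symmetric] ennreal_mult'[symmetric] powr_ge_zero A)
  also have "\<dots> = ennreal (c ^ CARD('n)) * (\<integral>\<^sup>+x. ennreal (exp (- (c * norm x)\<^sup>2 / 2)) * f (c *\<^sub>R x) \<partial>lborel)"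
    using c by (subst nn_integral_lborel_affine[where c=c and t=0]) auto
  finally have "ennreal (1 / c ^ CARD('n)) * (ennreal ?A * (\<integral>\<^sup>+x. f x \<partial>gauss))
     = ennreal (1 / c ^ CARD('n)) * (ennreal (c ^ CARD('n)) * (\<integral>\<^sup>+x. ennreal (exp (- (c * norm x)\<^sup>2 / 2)) * f (c *\<^sub>R x) \<partial>lborel))"
    by simp
  then show ?thesis
    using c by (simp add: mult.assoc[symmetric] ennreal_mult''[symmetric])
qed

text \<open>For \<open>c \<le> 1\<close> the density at \<open>x\<close> is at most the density at \<open>c x\<close>. This is what makes the
  dilation by \<open>\<surd>(2/p)\<close> bounded on \<open>L\<^sup>2\<close> of the Gaussian measure.\<close>

lemma nn_integral_gauss_dilation_le:
  fixes f :: "real ^ 'n \<Rightarrow> ennreal"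
  assumes [measurable]: "f \<in> borel_measurable borel" and c: "0 < c" "c \<le> 1"
  shows "(\<integral>\<^sup>+x. f (c *\<^sub>R x) \<partial>gauss) \<le> ennreal (1 / c ^ CARD('n)) * (\<integral>\<^sup>+x. f x \<partial>gauss)"
proof -
  have le: "gauss_density (x :: real ^ 'n) \<le> gauss_density (c *\<^sub>R x)" for x
  proof -
    have "c\<^sup>2 * (norm x)\<^sup>2 \<le> 1 * (norm x)\<^sup>2"
      using c by (intro mult_right_mono) (auto simp: power_le_one)
    then show ?thesis
      unfolding gauss_density_def by (intro mult_left_mono) (auto simp: power_mult_distrib)
  qed
  have "(\<integral>\<^sup>+x. f (c *\<^sub>R x) \<partial>gauss) = (\<integral>\<^sup>+x. ennreal (gauss_density x) * f (c *\<^sub>R x) \<partial>lborel)"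
    by (subst nn_integral_gauss) auto
  also have "\<dots> \<le> (\<integral>\<^sup>+x. ennreal (gauss_density (c *\<^sub>R x)) * f (c *\<^sub>R x) \<partial>lborel)"
    by (intro nn_integral_mono mult_right_mono ennreal_leI le) auto
  also have "\<dots> = ennreal (1 / c ^ CARD('n)) * (\<integral>\<^sup>+x. f x \<partial>gauss)"
  proof -
    have "(\<integral>\<^sup>+x. f x \<partial>gauss) = ennreal (c ^ CARD('n)) * (\<integral>\<^sup>+x. ennreal (gauss_density (c *\<^sub>R x)) * f (c *\<^sub>R x) \<partial>lborel)"
      using c by (subst nn_integral_gauss, simp, subst nn_integral_lborel_affine[where c=c and t=0]) auto
    then show ?thesis using c by (simp add: mult.assoc[symmetric] ennreal_mult''[symmetric])
  qed
  finally show ?thesis .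
qed

lemma nn_integral_gauss_minus:
  fixes f :: "real ^ 'n \<Rightarrow> ennreal"
  assumes [measurable]: "f \<in> borel_measurable borel"
  shows "(\<integral>\<^sup>+x. f (- x) \<partial>gauss) = (\<integral>\<^sup>+x. f x \<partial>gauss)"
  by (subst (2) nn_integral_gauss, simp, subst nn_integral_lborel_affine[where c="-1" and t=0])
    (auto simp: nn_integral_gauss gauss_density_def)

lemma nn_integral_lborel_gaussian_finite:
  fixes c :: "real ^ 'n"
  assumes "0 < k"
  shows "(\<integral>\<^sup>+x. ennreal (exp (- k * (norm (x - c))\<^sup>2)) \<partial>lborel) < \<infinity>"
proof -
  interpret prob_space "gauss :: (real ^ 'n) measure" by (rule prob_space_gauss)
  have "(\<integral>\<^sup>+x. ennreal (exp (- k * (norm (x - c))\<^sup>2)) \<partial>lborel) = (\<integral>\<^sup>+x. ennreal (exp (- k * (norm x)\<^sup>2)) \<partial>(lborel :: (real ^ 'n) measure))"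
    by (subst nn_integral_lborel_affine[where c=1 and t=c]) auto
  also have "\<dots> = (\<integral>\<^sup>+x. ennreal (exp (- (sqrt (2 * k) * norm x)\<^sup>2 / 2)) * 1 \<partial>(lborel :: (real ^ 'n) measure))"
    using assms by (simp add: power_mult_distrib)
  also have "\<dots> < \<infinity>"
    using assms emeasure_space_1 
    by (subst nn_integral_gauss_scaled) (auto simp: ennreal_mult_less_top)
  finally show ?thesis .
qed

section \<open>Polynomials times complex Gaussians\<close>

text \<open>Functions \<open>P(z, x) exp (- \<parallel>x - c\<parallel>\<^sup>2 / (4z))\<close>, where \<open>P\<close> is polynomial in \<open>x\<close> with coefficients
  holomorphic on the right half plane. The class contains all functions that are evolved explicitly below.
  It is closed under \<open>\<partial>\<^sub>z\<close> and under all partial derivatives, and its members satisfy Gaussian bounds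
  locally uniformly in \<open>z\<close>. Hence they are Schwartz functions, and differentiation under integrals
  reduces to Taylor's formula in \<open>z\<close>.\<close>

inductive gauss_class :: "real ^ 'n \<Rightarrow> (complex \<Rightarrow> real ^ 'n \<Rightarrow> complex) \<Rightarrow> bool" for c where
  base: "gauss_class c (\<lambda>z x. exp (- complex_of_real ((norm (x - c))\<^sup>2) / (4 * z)))"
| coeff: "h holomorphic_on {z. 0 < Re z} \<Longrightarrow> gauss_class c v \<Longrightarrow> gauss_class c (\<lambda>z x. h z * v z x)"
| coord: "gauss_class c v \<Longrightarrow> gauss_class c (\<lambda>z x. complex_of_real (x $ j - c $ j) * v z x)"
| add: "gauss_class c v \<Longrightarrow> gauss_class c w \<Longrightarrow> gauss_class c (\<lambda>z x. v z x + w z x)"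

lemma open_right_halfplane: "open {z. 0 < Re z}"
  by (rule open_halfspace_Re_gt)

lemma gauss_class_zero: "gauss_class c (\<lambda>z x. 0)"
  using gauss_class.coeff[OF _ gauss_class.base, of "\<lambda>_. 0"] by simp

lemma gauss_class_sum:
  "finite A \<Longrightarrow> (\<And>i. i \<in> A \<Longrightarrow> gauss_class c (v i)) \<Longrightarrow> gauss_class c (\<lambda>z x. \<Sum>i\<in>A. v i z x)"
  by (induction A rule: finite_induct) (auto intro: gauss_class_zero gauss_class.add)

lemma gauss_class_cmult: "gauss_class c v \<Longrightarrow> gauss_class c (\<lambda>z x. a * v z x)"
  by (rule gauss_class.coeff) auto

lemma gauss_class_z_derivative:
  assumes "gauss_class c v"
  shows "\<exists>v'. gauss_class c v' \<and>
    (\<forall>z x. 0 < Re z \<longrightarrow> ((\<lambda>z. v z x) has_field_derivative v' z x) (at z))"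
  using assms
proof induction
  case base
  let ?E = "\<lambda>z x. exp (- complex_of_real ((norm (x - c))\<^sup>2) / (4 * z))"
  let ?v = "\<lambda>z x. \<Sum>j\<in>UNIV. complex_of_real (x $ j - c $ j) * (complex_of_real (x $ j - c $ j) * (1 / (4 * z\<^sup>2) * ?E z x))"
  have "gauss_class c ?v"
    by (intro gauss_class_sum gauss_class.coord gauss_class.coeff[of "\<lambda>z. 1 / (4 * z\<^sup>2)"] gauss_class.base)
      (auto intro!: holomorphic_intros)
  moreover have "((\<lambda>z. ?E z x) has_field_derivative ?v z x) (at z)" if "0 < Re z" for z x
  proof -
    have z: "z \<noteq> 0" using that by auto
    have "((\<lambda>z. ?E z x) has_field_derivative ?E z x * (complex_of_real ((norm (x - c))\<^sup>2) / (4 * z\<^sup>2))) (at z)"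
      using z by (auto intro!: derivative_eq_intros simp: field_simps power2_eq_square)
    moreover have "complex_of_real ((norm (x - c))\<^sup>2) = (\<Sum>j\<in>UNIV. (complex_of_real (x $ j - c $ j))\<^sup>2)"
      by (simp add: norm_vec_square)
    moreover have "?E z x * ((\<Sum>j\<in>UNIV. (complex_of_real (x $ j - c $ j))\<^sup>2) / (4 * z\<^sup>2)) = ?v z x"
      by (simp add: sum_divide_distrib sum_distrib_left power2_eq_square mult_ac)
    ultimately show ?thesis by metis
  qed
  ultimately show ?case by blast
next
  case (coeff h v)
  then obtain v' where v': "gauss_class c v'"
    "\<And>z x. 0 < Re z \<Longrightarrow> ((\<lambda>z. v z x) has_field_derivative v' z x) (at z)" by blast
  have h': "(h has_field_derivative deriv h z) (at z)" if "0 < Re z" for z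
    using coeff(1) that by (intro holomorphic_derivI[OF _ open_right_halfplane]) auto
  have "gauss_class c (\<lambda>z x. deriv h z * v z x + h z * v' z x)"
    using coeff v' by (intro gauss_class.add gauss_class.coeff holomorphic_deriv open_right_halfplane)
  moreover have "((\<lambda>z. h z * v z x) has_field_derivative deriv h z * v z x + h z * v' z x) (at z)" if "0 < Re z" for z x
    using DERIV_mult[OF h'[OF that] v'(2)[OF that, of x]] by (simp add: add.commute mult.commute)
  ultimately show ?case by (intro exI[of _ "\<lambda>z x. deriv h z * v z x + h z * v' z x"]) blast
next
  case (coord v j)
  then obtain v' where v': "gauss_class c v'"
    "\<And>z x. 0 < Re z \<Longrightarrow> ((\<lambda>z. v z x) has_field_derivative v' z x) (at z)" by blast
  show ?case
    using v' by (intro exI[of _ "\<lambda>z x. complex_of_real (x $ j - c $ j) * v' z x"] conjI allI impI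
        gauss_class.coord DERIV_cmult) auto
next
  case (add v w)
  then obtain v' w' where v': "gauss_class c v'" "gauss_class c w'"
    "\<And>z x. 0 < Re z \<Longrightarrow> ((\<lambda>z. v z x) has_field_derivative v' z x) (at z)"
    "\<And>z x. 0 < Re z \<Longrightarrow> ((\<lambda>z. w z x) has_field_derivative w' z x) (at z)" by blast
  show ?case
    using v' by (intro exI[of _ "\<lambda>z x. v' z x + w' z x"] conjI allI impI
        gauss_class.add DERIV_add) auto
qed

lemma gauss_class_x_derivative:
  assumes "gauss_class c v"
  shows "\<exists>v'. gauss_class c v' \<and>
    (\<forall>z x. 0 < Re z \<longrightarrow> (\<exists>D. (v z has_derivative D) (at x) \<and> D (axis j 1) = v' z x))"
  using assms
proof induction
  case base
  let ?E = "\<lambda>z x. exp (- complex_of_real ((norm (x - c))\<^sup>2) / (4 * z))"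
  let ?v = "\<lambda>z x. complex_of_real (x $ j - c $ j) * (- 1 / (2 * z) * ?E z x)"
  have "gauss_class c ?v"
    by (intro gauss_class.coord gauss_class.coeff[of "\<lambda>z. - 1 / (2 * z)"] gauss_class.base)
      (auto intro!: holomorphic_intros)
  moreover have "\<exists>D. (?E z has_derivative D) (at x) \<and> D (axis j 1) = ?v z x" if "0 < Re z" for z x
  proof -
    have z: "z \<noteq> 0" using that by auto
    have eq: "?E z = (\<lambda>x. exp (- complex_of_real ((x - c) \<bullet> (x - c)) / (4 * z)))"
      by (simp add: power2_norm_eq_inner)
    have "((\<lambda>x. exp (- complex_of_real ((x - c) \<bullet> (x - c)) / (4 * z))) has_derivative
      (\<lambda>h. (- complex_of_real (2 * ((x - c) \<bullet> h)) / (4 * z)) * exp (- complex_of_real ((x - c) \<bullet> (x - c)) / (4 * z)))) (at x)"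
    proof -
      have "((\<lambda>x. (x - c) \<bullet> (x - c)) has_derivative (\<lambda>h. 2 * ((x - c) \<bullet> h))) (at x)"
        by (auto intro!: derivative_eq_intros simp: inner_commute)
      from has_derivative_of_real[OF this, where ?'a = complex]
      have "((\<lambda>x. (- 1 / (4 * z)) * complex_of_real ((x - c) \<bullet> (x - c))) has_derivative
          (\<lambda>h. (- 1 / (4 * z)) * complex_of_real (2 * ((x - c) \<bullet> h)))) (at x)"
        by (rule has_derivative_mult_right)
      then have "((\<lambda>x. - complex_of_real ((x - c) \<bullet> (x - c)) / (4 * z)) has_derivative
          (\<lambda>h. - complex_of_real (2 * ((x - c) \<bullet> h)) / (4 * z))) (at x)"
        by simp
      from has_derivative_compose[OF this DERIV_exp[unfolded has_field_derivative_def]]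
      show ?thesis by (simp only: mult.commute)
    qed
    then show ?thesis
      unfolding eq using z
      by - (rule exI, rule conjI, assumption, auto simp: inner_axis power2_norm_eq_inner field_simps)
  qed
  ultimately show ?case by blast
next
  case (coeff h v)
  then obtain v' where v': "gauss_class c v'"
    "\<And>z x. 0 < Re z \<Longrightarrow> \<exists>D. (v z has_derivative D) (at x) \<and> D (axis j 1) = v' z x" by blast
  have "\<exists>D. ((\<lambda>x. h z * v z x) has_derivative D) (at x) \<and> D (axis j 1) = h z * v' z x" if "0 < Re z" for z x
  proof -
    obtain D where "(v z has_derivative D) (at x)" "D (axis j 1) = v' z x" using v'(2) \<open>0 < Re z\<close> by blast
    then show ?thesis by (intro exI[of _ "\<lambda>k. h z * D k"]) (auto intro!: derivative_intros)
  qed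
  then show ?case using gauss_class.coeff[OF coeff(1) v'(1)] by blast
next
  case (coord v i)
  then obtain v' where v': "gauss_class c v'"
    "\<And>z x. 0 < Re z \<Longrightarrow> \<exists>D. (v z has_derivative D) (at x) \<and> D (axis j 1) = v' z x" by blast
  let ?v = "\<lambda>z x. complex_of_real (x $ i - c $ i) * v' z x + (if i = j then 1 else 0) * v z x"
  have "gauss_class c ?v"
    using coord v' by (intro gauss_class.add gauss_class.coord gauss_class_cmult)
  moreover have "\<exists>D. ((\<lambda>x. complex_of_real (x $ i - c $ i) * v z x) has_derivative D) (at x) \<and> D (axis j 1) = ?v z x"
    if "0 < Re z" for z x
  proof -
    obtain D where D: "(v z has_derivative D) (at x)" "D (axis j 1) = v' z x" using v'(2) \<open>0 < Re z\<close> by blast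
    have ax: "axis j (1::real) $ i = (if i = j then 1 else 0)" by (simp add: axis_def)
    have "((\<lambda>x. complex_of_real (x $ i - c $ i)) has_derivative (\<lambda>h. complex_of_real (h $ i))) (at x)"
      by (auto intro!: derivative_eq_intros bounded_linear.has_derivative[OF bounded_linear_vec_nth])
    from has_derivative_mult[OF this D(1)] show ?thesis
      by - (rule exI, rule conjI, assumption, simp add: D(2) ax)
  qed
  ultimately show ?case by blast
next
  case (add v w)
  then obtain v' w' where v': "gauss_class c v'" "gauss_class c w'"
    "\<And>z x. 0 < Re z \<Longrightarrow> \<exists>D. (v z has_derivative D) (at x) \<and> D (axis j 1) = v' z x"
    "\<And>z x. 0 < Re z \<Longrightarrow> \<exists>D. (w z has_derivative D) (at x) \<and> D (axis j 1) = w' z x" by blast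
  have "\<exists>D. ((\<lambda>x. v z x + w z x) has_derivative D) (at x) \<and> D (axis j 1) = v' z x + w' z x" if "0 < Re z" for z x
  proof -
    obtain D E where "(v z has_derivative D) (at x)" "D (axis j 1) = v' z x"
      "(w z has_derivative E) (at x)" "E (axis j 1) = w' z x" using v' \<open>0 < Re z\<close> by blast
    then show ?thesis by (intro exI[of _ "\<lambda>k. D k + E k"]) (auto intro!: derivative_intros)
  qed
  then show ?case using gauss_class.add[OF v'(1,2)] by blast
qed

lemma self_le_exp_square:
  fixes t :: real assumes "0 < k" shows "t \<le> (1 + 1 / k) * exp (k * t\<^sup>2)"
proof -
  have "0 \<le> (t - 1)\<^sup>2" "0 \<le> t\<^sup>2" by simp_all
  then have "t \<le> 1 + t\<^sup>2" by (simp only: power2_diff one_power2 mult_1_right)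
  also have "\<dots> \<le> (1 + 1 / k) * (1 + k * t\<^sup>2)" using assms by (simp add: field_simps)
  also have "\<dots> \<le> (1 + 1 / k) * exp (k * t\<^sup>2)" using assms by (intro mult_left_mono exp_ge_add_one_self) auto
  finally show ?thesis .
qed

text \<open>For the Gaussian itself \<open>Re (1/(4z)) = Re z / (4 \<bar>z\<bar>\<^sup>2)\<close> is bounded below near \<open>z\<^sub>0\<close>. A factor
  \<open>x\<^sub>j - c\<^sub>j\<close> costs half of the exponent, and a coefficient is bounded on a smaller closed ball.\<close>

lemma gauss_class_bound:
  assumes "gauss_class c v" "0 < Re z0"
  shows "\<exists>r k C. 0 < r \<and> 0 < k \<and> 0 \<le> C \<and>
    (\<forall>z\<in>ball z0 r. 0 < Re z \<and> (\<forall>x. cmod (v z x) \<le> C * exp (- k * (norm (x - c))\<^sup>2)))"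
  using assms(1)
proof induction
  case base
  let ?r = "Re z0 / 2"
  let ?k = "?r / (4 * (cmod z0 + ?r)\<^sup>2)"
  have r: "0 < ?r" using assms by simp
  have "0 < Re z \<and> (\<forall>x. cmod (exp (- complex_of_real ((norm (x - c))\<^sup>2) / (4 * z))) \<le> 1 * exp (- ?k * (norm (x - c))\<^sup>2))"
    if "z \<in> ball z0 ?r" for z
  proof -
    have d: "cmod (z0 - z) < ?r" using that by (simp add: dist_norm)
    have Re: "?r \<le> Re z" using d abs_Re_le_cmod[of "z0 - z"] by simp
    have "cmod z \<le> cmod z0 + ?r" using d norm_triangle_ineq2[of z z0] by (simp add: norm_minus_commute)
    then have le: "(cmod z)\<^sup>2 \<le> (cmod z0 + ?r)\<^sup>2" by (intro power_mono) auto
    have z: "z \<noteq> 0" using Re r by auto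
    have "?k \<le> Re z / (4 * (cmod z)\<^sup>2)"
      using Re le r z by (intro frac_le) auto
    moreover have "Re (- complex_of_real t / (4 * z)) = - (Re z / (4 * (cmod z)\<^sup>2)) * t" for t
    proof -
      have "- complex_of_real t / (4 * z) = complex_of_real (- t / (4 * (cmod z)\<^sup>2)) * cnj z"
        using z by (simp add: complex_div_cnj[of _ z] field_simps)
      then show ?thesis by simp
    qed
    ultimately have "Re (- complex_of_real ((norm (x - c))\<^sup>2) / (4 * z)) \<le> - ?k * (norm (x - c))\<^sup>2" for x
      by (metis mult_right_mono neg_le_iff_le zero_le_power2)
    then show ?thesis using Re r by (auto simp: norm_exp_eq_Re)
  qed
  moreover have "0 < ?k" using r by (intro divide_pos_pos mult_pos_pos zero_less_power add_nonneg_pos) auto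
  ultimately show ?case using r zero_le_one[where 'a = real]
    by - (rule exI[of _ ?r], rule exI[of _ ?k], rule exI[of _ 1], blast)
next
  case (coeff h v)
  then obtain r k C where rk: "0 < r" "0 < k" "0 \<le> C"
    and b: "\<And>z. z \<in> ball z0 r \<Longrightarrow> 0 < Re z" "\<And>z x. z \<in> ball z0 r \<Longrightarrow> cmod (v z x) \<le> C * exp (- k * (norm (x - c))\<^sup>2)"
    by blast
  have sub: "cball z0 (r / 2) \<subseteq> {z. 0 < Re z}" using b(1) rk by auto
  have "compact (h ` cball z0 (r / 2))"
    using coeff(1) sub by (intro compact_continuous_image holomorphic_on_imp_continuous_on) (auto intro: holomorphic_on_subset)
  from compact_imp_bounded[OF this] obtain B where B: "\<And>z. z \<in> cball z0 (r / 2) \<Longrightarrow> cmod (h z) \<le> B"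
    unfolding bounded_iff by blast
  have B0: "0 \<le> B" using B[of z0] rk by (auto intro: order_trans[OF norm_ge_zero])
  have "cmod (h z * v z x) \<le> (B * C) * exp (- k * (norm (x - c))\<^sup>2)" if "z \<in> ball z0 (r / 2)" for z x
    unfolding norm_mult mult.assoc using that rk B0 by (intro mult_mono B b) auto
  then show ?case using rk B0 b(1)
    by - (rule exI[of _ "r / 2"], rule exI[of _ k], rule exI[of _ "B * C"], auto)
next
  case (coord v j)
  then obtain r k C where rk: "0 < r" "0 < k" "0 \<le> C"
    and b: "\<And>z. z \<in> ball z0 r \<Longrightarrow> 0 < Re z" "\<And>z x. z \<in> ball z0 r \<Longrightarrow> cmod (v z x) \<le> C * exp (- k * (norm (x - c))\<^sup>2)"
    by blast
  let ?A = "1 + 1 / (k / 2)"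
  have "cmod (complex_of_real (x $ j - c $ j) * v z x) \<le> (?A * C) * exp (- (k / 2) * (norm (x - c))\<^sup>2)" if "z \<in> ball z0 r" for z x
  proof -
    have "\<bar>x $ j - c $ j\<bar> \<le> norm (x - c)" using component_le_norm_cart[of "x - c" j] by simp
    also have "\<dots> \<le> ?A * exp (k / 2 * (norm (x - c))\<^sup>2)" using rk by (intro self_le_exp_square) auto
    finally have "cmod (complex_of_real (x $ j - c $ j) * v z x)
       \<le> (?A * exp (k / 2 * (norm (x - c))\<^sup>2)) * (C * exp (- k * (norm (x - c))\<^sup>2))"
      unfolding norm_mult norm_of_real using b(2)[OF that] rk by (intro mult_mono) auto
    also have "\<dots> = (?A * C) * exp (- (k / 2) * (norm (x - c))\<^sup>2)"
      by (simp add: exp_add[symmetric] mult_ac)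
    finally show ?thesis .
  qed
  then show ?case using rk b(1)
    by - (rule exI[of _ r], rule exI[of _ "k / 2"], rule exI[of _ "?A * C"], auto)
next
  case (add v w)
  from add.IH(1) obtain r k C where rk1: "0 < r" "0 < k" "0 \<le> C"
    and b1: "\<And>z. z \<in> ball z0 r \<Longrightarrow> 0 < Re z" "\<And>z x. z \<in> ball z0 r \<Longrightarrow> cmod (v z x) \<le> C * exp (- k * (norm (x - c))\<^sup>2)"
    by blast
  from add.IH(2) obtain s l D where rk2: "0 < s" "0 < l" "0 \<le> D"
    and b2: "\<And>z x. z \<in> ball z0 s \<Longrightarrow> cmod (w z x) \<le> D * exp (- l * (norm (x - c))\<^sup>2)"
    by blast
  note rk = rk1 rk2 and b = b1 b2
  let ?m = "min k l"
  have "cmod (v z x + w z x) \<le> (C + D) * exp (- ?m * (norm (x - c))\<^sup>2)" if "z \<in> ball z0 (min r s)" for z x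
  proof -
    have "cmod (v z x + w z x) \<le> C * exp (- k * (norm (x - c))\<^sup>2) + D * exp (- l * (norm (x - c))\<^sup>2)"
      using b(2)[of z x] b(3)[of z x] that by (intro order_trans[OF norm_triangle_ineq] add_mono) auto
    also have "\<dots> \<le> C * exp (- ?m * (norm (x - c))\<^sup>2) + D * exp (- ?m * (norm (x - c))\<^sup>2)"
      using rk by (intro add_mono mult_left_mono) (auto intro!: mult_right_mono)
    finally show ?thesis by (simp add: distrib_right)
  qed
  then show ?case using rk b(1)
    by - (rule exI[of _ "min r s"], rule exI[of _ ?m], rule exI[of _ "C + D"], auto)
qed

lemma partial_eqI: "(f has_derivative D) (at x) \<Longrightarrow> D (axis i 1) = y \<Longrightarrow> partial i f x = y"
  unfolding partial_def by (metis frechet_derivative_at)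

lemma gauss_class_partial:
  assumes "gauss_class c v"
  obtains v' where "gauss_class c v'" "\<And>z. 0 < Re z \<Longrightarrow> partial j (v z) = v' z"
    "\<And>z x. 0 < Re z \<Longrightarrow> v z differentiable at x"
proof -
  obtain v' where v': "gauss_class c v'"
    "\<And>z x. 0 < Re z \<Longrightarrow> \<exists>D. (v z has_derivative D) (at x) \<and> D (axis j 1) = v' z x"
    using gauss_class_x_derivative[OF assms, of j] by blast
  show ?thesis
  proof (rule that[OF v'(1)])
    fix z x assume z: "0 < Re z"
    show "partial j (v z) = v' z"
    proof
      fix x show "partial j (v z) x = v' z x"
        using v'(2)[OF z, of x] by (auto intro: partial_eqI)
    qed
    show "v z differentiable at x" using v'(2)[OF z, of x] by (auto simp: differentiable_def)
  qed
qed

lemma gauss_class_partials: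
  assumes "gauss_class c v"
  shows "\<exists>w. gauss_class c w \<and> (\<forall>z. 0 < Re z \<longrightarrow> foldr partial is (v z) = w z)"
proof (induction "is")
  case Nil
  then show ?case using assms by auto
next
  case (Cons i "is")
  then obtain w where w: "gauss_class c w" "\<And>z. 0 < Re z \<Longrightarrow> foldr partial is (v z) = w z" by blast
  obtain w' where "gauss_class c w'" "\<And>z. 0 < Re z \<Longrightarrow> partial i (w z) = w' z"
    using gauss_class_partial[OF w(1)] by metis
  then show ?case using w(2) by (intro exI[of _ w']) simp
qed

lemma gauss_class_differentiable: "gauss_class c v \<Longrightarrow> 0 < Re z \<Longrightarrow> v z differentiable at x"
  using gauss_class_partial by metis

lemma gauss_class_continuous: "gauss_class c v \<Longrightarrow> 0 < Re z \<Longrightarrow> continuous_on UNIV (v z)"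
  by (auto intro!: continuous_at_imp_continuous_on differentiable_imp_continuous_within gauss_class_differentiable)

lemma gauss_class_measurable: "gauss_class c v \<Longrightarrow> 0 < Re z \<Longrightarrow> v z \<in> borel_measurable borel"
  by (intro borel_measurable_continuous_onI gauss_class_continuous)

lemma gauss_class_bound_at:
  assumes "gauss_class c v" "0 < Re z"
  obtains k C where "0 < k" "0 \<le> C" "\<And>x. cmod (v z x) \<le> C * exp (- k * (norm (x - c))\<^sup>2)"
proof -
  obtain r k C where *: "0 < r" "0 < k" "0 \<le> C"
    "\<forall>z\<in>ball z r. 0 < Re z \<and> (\<forall>x. cmod (v z x) \<le> C * exp (- k * (norm (x - c))\<^sup>2))"
    using gauss_class_bound[OF assms] by blast
  moreover have "z \<in> ball z r" using * by simp
  ultimately show ?thesis using that[of k C] by blast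
qed

text \<open>Each of the \<open>m\<close> factors \<open>\<parallel>x\<parallel>\<close> is absorbed by a fraction \<open>k/(m+1)\<close> of the exponent.\<close>

lemma power_times_gaussian_bounded:
  fixes c :: "'a::real_normed_vector"
  assumes "0 < k"
  shows "\<exists>B. \<forall>x. norm x ^ m * exp (- k * (norm (x - c))\<^sup>2) \<le> B"
proof -
  define e where "e = k / (real m + 1)"
  have e: "0 < e" using assms by (simp add: e_def)
  define A where "A = norm c + (1 + 1 / e)"
  have "norm x ^ m * exp (- k * (norm (x - c))\<^sup>2) \<le> A ^ m" for x
  proof -
    let ?t = "norm (x - c)"
    have "norm x \<le> norm c + ?t" by (metis add.commute diff_add_cancel norm_triangle_ineq)
    also have "\<dots> \<le> norm c * exp (e * ?t\<^sup>2) + (1 + 1 / e) * exp (e * ?t\<^sup>2)"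
      using e by (intro add_mono self_le_exp_square mult_right_le_one_le[of _ "norm c" , THEN order_trans]) 
        (auto simp: mult_le_cancel_left1)
    also have "\<dots> = A * exp (e * ?t\<^sup>2)" by (simp add: A_def distrib_right)
    finally have "norm x ^ m \<le> (A * exp (e * ?t\<^sup>2)) ^ m" by (intro power_mono) auto
    also have "\<dots> = A ^ m * exp (real m * (e * ?t\<^sup>2))"
      by (simp add: power_mult_distrib exp_of_nat_mult)
    also have "\<dots> \<le> A ^ m * exp (k * ?t\<^sup>2)"
    proof -
      have "real m * e \<le> k" using assms by (simp add: e_def field_simps)
      then have "real m * e * ?t\<^sup>2 \<le> k * ?t\<^sup>2" by (rule mult_right_mono) simp
      then show ?thesis using e by (intro mult_left_mono) (auto simp: A_def mult.assoc)
    qed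
    finally have "norm x ^ m * exp (- k * ?t\<^sup>2) \<le> (A ^ m * exp (k * ?t\<^sup>2)) * exp (- k * ?t\<^sup>2)"
      by (intro mult_right_mono) auto
    then show ?thesis by (simp add: mult.assoc exp_add[symmetric])
  qed
  then show ?thesis by blast
qed

lemma gauss_class_schwartz:
  assumes "gauss_class c v" "0 < Re z"
  shows "schwartz (v z)"
  unfolding schwartz_def
proof (intro allI conjI)
  fix "is"
  obtain w where w: "gauss_class c w" "foldr partial is (v z) = w z"
    using gauss_class_partials[OF assms(1)] assms(2) by blast
  show "foldr partial is (v z) differentiable_on UNIV"
    unfolding w(2) using gauss_class_differentiable[OF w(1) assms(2)]
    by (auto simp: differentiable_on_def intro: differentiable_at_withinI)
  fix m :: nat
  obtain k C where k: "0 < k" "0 \<le> C" "\<And>x. cmod (w z x) \<le> C * exp (- k * (norm (x - c))\<^sup>2)"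
    using gauss_class_bound_at[OF w(1) assms(2)] by blast
  obtain B where B: "\<And>x. norm x ^ m * exp (- k * (norm (x - c))\<^sup>2) \<le> B"
    using power_times_gaussian_bounded[OF k(1)] by blast
  have "norm ((norm x ^ m) *\<^sub>R w z x) \<le> C * B" for x
  proof -
    have "norm ((norm x ^ m) *\<^sub>R w z x) \<le> norm x ^ m * (C * exp (- k * (norm (x - c))\<^sup>2))"
      using k(3)[of x] by (auto intro!: mult_left_mono)
    also have "\<dots> = C * (norm x ^ m * exp (- k * (norm (x - c))\<^sup>2))" by simp
    also have "\<dots> \<le> C * B" using B k by (intro mult_left_mono) auto
    finally show ?thesis .
  qed
  then show "bounded (range (\<lambda>x. (norm x ^ m) *\<^sub>R foldr partial is (v z) x))"
    unfolding w(2) bounded_iff by blast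
qed

lemma gaussian_bounded_integrable:
  fixes f :: "real ^ 'n \<Rightarrow> complex"
  assumes [measurable]: "f \<in> borel_measurable borel" and "0 < k"
    and b: "\<And>x. cmod (f x) \<le> C * exp (- k * (norm (x - c))\<^sup>2)"
  shows "integrable lborel f" "cmod (\<integral>x. f x \<partial>lborel) \<le> C * (\<integral>x. exp (- k * (norm (x - c))\<^sup>2) \<partial>lborel)"
    "integrable lborel (\<lambda>x. exp (- k * (norm (x - c))\<^sup>2))"
proof -
  show g: "integrable lborel (\<lambda>x. exp (- k * (norm (x - c))\<^sup>2))"
    using nn_integral_lborel_gaussian_finite[OF \<open>0 < k\<close>, of c] by (intro integrableI_nonneg) auto
  show f: "integrable lborel f"
    by (rule Bochner_Integration.integrable_bound[OF integrable_mult_right[OF g, of C]])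
      (use b in \<open>auto intro!: AE_I2 intro: order_trans[OF _ abs_ge_self] simp del: abs_mult\<close>)
  have "cmod (\<integral>x. f x \<partial>lborel) \<le> (\<integral>x. C * exp (- k * (norm (x - c))\<^sup>2) \<partial>lborel)"
    by (rule Bochner_Integration.integral_norm_bound_integral[OF f integrable_mult_right[OF g] b])
  then show "cmod (\<integral>x. f x \<partial>lborel) \<le> C * (\<integral>x. exp (- k * (norm (x - c))\<^sup>2) \<partial>lborel)"
    by simp
qed

lemma sqnorm_gaussian_bounded:
  fixes f :: "real ^ 'n \<Rightarrow> complex"
  assumes [measurable]: "f \<in> borel_measurable borel" and "0 < k" "0 \<le> C"
    and b: "\<And>x. cmod (f x) \<le> C * exp (- k * (norm (x - c))\<^sup>2)"
  shows "sqnorm lborel f \<le> ennreal (C\<^sup>2) * (\<integral>\<^sup>+x. ennreal (exp (- (2 * k) * (norm (x - c))\<^sup>2)) \<partial>lborel)"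
proof -
  have "sqnorm lborel f \<le> (\<integral>\<^sup>+x. ennreal (C\<^sup>2) * ennreal (exp (- (2 * k) * (norm (x - c))\<^sup>2)) \<partial>lborel)"
    unfolding sqnorm_def
  proof (rule nn_integral_mono)
    fix x
    have "(cmod (f x))\<^sup>2 \<le> (C * exp (- k * (norm (x - c))\<^sup>2))\<^sup>2" by (intro power_mono b) auto
    also have "\<dots> = C\<^sup>2 * exp (- (2 * k) * (norm (x - c))\<^sup>2)"
      by (simp add: power_mult_distrib exp_double[symmetric] mult.assoc)
    finally show "ennreal ((cmod (f x))\<^sup>2) \<le> ennreal (C\<^sup>2) * ennreal (exp (- (2 * k) * (norm (x - c))\<^sup>2))"
      by (simp add: ennreal_mult[symmetric] ennreal_leI)
  qed
  then show ?thesis by (simp add: nn_integral_cmult)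
qed

lemma gauss_class_L2:
  assumes "gauss_class c v" "0 < Re z"
  shows "v z \<in> L2 lborel"
proof -
  obtain k C where k: "0 < k" "0 \<le> C" "\<And>x. cmod (v z x) \<le> C * exp (- k * (norm (x - c))\<^sup>2)"
    using gauss_class_bound_at[OF assms] by blast
  have m: "v z \<in> borel_measurable borel" by (rule gauss_class_measurable[OF assms])
  have "sqnorm lborel (v z) < \<infinity>"
    using nn_integral_lborel_gaussian_finite[of "2 * k" c] k(1)
    by (intro le_less_trans[OF sqnorm_gaussian_bounded[OF m k]]) (auto simp: ennreal_mult_less_top)
  then show ?thesis using m by (simp add: L2_iff)
qed

text \<open>The second \<open>z\<close>-derivative lies in the same class, so it has a Gaussian bound that is uniform near
  \<open>z\<^sub>0\<close>; Taylor's formula in \<open>z\<close> is then uniform in \<open>x\<close> up to that Gaussian.\<close>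

lemma gauss_class_Taylor:
  assumes v: "gauss_class c v" and v': "gauss_class c v'"
    and d: "\<And>z x. 0 < Re z \<Longrightarrow> ((\<lambda>z. v z x) has_field_derivative v' z x) (at z)"
    and z0: "0 < Re z0"
  obtains r k C where "0 < r" "0 < k" "0 \<le> C" "\<And>z. z \<in> ball z0 r \<Longrightarrow> 0 < Re z"
    "\<And>z x. z \<in> ball z0 r \<Longrightarrow>
      cmod (v z x - v z0 x - (z - z0) * v' z0 x) \<le> C * (cmod (z - z0))\<^sup>2 * exp (- k * (norm (x - c))\<^sup>2)"
proof -
  obtain v'' where v'': "gauss_class c v''"
    "\<And>z x. 0 < Re z \<Longrightarrow> ((\<lambda>z. v' z x) has_field_derivative v'' z x) (at z)"
    using gauss_class_z_derivative[OF v'] by blast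
  obtain r k C where b: "0 < r" "0 < k" "0 \<le> C"
    "\<And>z. z \<in> ball z0 r \<Longrightarrow> 0 < Re z"
    "\<And>z x. z \<in> ball z0 r \<Longrightarrow> cmod (v'' z x) \<le> C * exp (- k * (norm (x - c))\<^sup>2)"
    using gauss_class_bound[OF v''(1) z0] by blast
  show ?thesis
  proof (rule that[OF b(1-4)])
    fix z x assume z: "z \<in> ball z0 r"
    \<comment> \<open>The successive derivatives in the form in which \<open>complex_Taylor\<close> expects them.\<close>
    define F where "F = (\<lambda>i z. if i = (0::nat) then v z x else if i = 1 then v' z x else v'' z x)"
    have "cmod (F 0 z - (\<Sum>i\<le>1. F i z0 * (z - z0) ^ i / fact i)) \<le> (C * exp (- k * (norm (x - c))\<^sup>2)) * cmod (z - z0) ^ Suc 1 / fact 1"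
    proof (rule complex_Taylor[where S = "ball z0 r"])
      show "(F i has_field_derivative F (Suc i) w) (at w within ball z0 r)" if "w \<in> ball z0 r" "i \<le> 1" for i w
      proof -
        have "i = 0 \<or> i = 1" using that(2) by auto
        then show ?thesis
          using d[OF b(4)[OF that(1)], of x] v''(2)[OF b(4)[OF that(1)], of x]
          by (auto simp: F_def[abs_def] intro: has_field_derivative_at_within)
      qed
      show "cmod (F (Suc 1) w) \<le> C * exp (- k * (norm (x - c))\<^sup>2)" if "w \<in> ball z0 r" for w
        using b(5)[OF that] by (simp add: F_def)
    qed (use z b in auto)
    then show "cmod (v z x - v z0 x - (z - z0) * v' z0 x) \<le> C * (cmod (z - z0))\<^sup>2 * exp (- k * (norm (x - c))\<^sup>2)"
      by (simp add: F_def power2_eq_square mult_ac algebra_simps)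
  qed
qed

section \<open>Derivatives of curves\<close>

lemma has_vector_derivative_quotient_iff:
  fixes F :: "real \<Rightarrow> complex"
  shows "(F has_vector_derivative D) (at t) \<longleftrightarrow> ((\<lambda>\<delta>. (F (t + \<delta>) - F t) / complex_of_real \<delta>) \<longlongrightarrow> D) (at 0)"
proof -
  have "(F has_vector_derivative D) (at t) \<longleftrightarrow> ((\<lambda>\<delta>. cmod (F (t + \<delta>) - F t - \<delta> *\<^sub>R D) / norm \<delta>) \<longlongrightarrow> 0) (at 0)"
    unfolding has_vector_derivative_def has_derivative_at by (simp add: bounded_linear_scaleR_left)
  also have "\<dots> \<longleftrightarrow> ((\<lambda>\<delta>. cmod ((F (t + \<delta>) - F t) / complex_of_real \<delta> - D)) \<longlongrightarrow> 0) (at 0)"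
  proof (rule filterlim_cong[OF refl refl], unfold eventually_at, intro exI[of _ 1] conjI ballI impI)
    fix \<delta> :: real assume "\<delta> \<noteq> 0 \<and> dist \<delta> 0 < 1"
    then have "(F (t + \<delta>) - F t) / complex_of_real \<delta> - D = (F (t + \<delta>) - F t - \<delta> *\<^sub>R D) / complex_of_real \<delta>"
      by (simp add: field_simps scaleR_conv_of_real)
    then show "cmod (F (t + \<delta>) - F t - \<delta> *\<^sub>R D) / norm \<delta> = cmod ((F (t + \<delta>) - F t) / complex_of_real \<delta> - D)"
      by (simp add: norm_divide)
  qed simp
  also have "\<dots> \<longleftrightarrow> ((\<lambda>\<delta>. (F (t + \<delta>) - F t) / complex_of_real \<delta>) \<longlongrightarrow> D) (at 0)"
    by (simp only: tendsto_norm_zero_iff Lim_null[of _ D])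
  finally show ?thesis .
qed

lemma has_vector_derivative_quadratic_remainder:
  fixes F :: "real \<Rightarrow> complex"
  assumes "0 < r" and b: "\<And>\<delta>. \<bar>\<delta>\<bar> < r \<Longrightarrow> cmod (F (t + \<delta>) - F t - complex_of_real \<delta> * D) \<le> K * \<delta>\<^sup>2"
  shows "(F has_vector_derivative D) (at t)"
proof -
  have "((\<lambda>\<delta>. (F (t + \<delta>) - F t) / complex_of_real \<delta> - D) \<longlongrightarrow> 0) (at 0)"
  proof (rule Lim_null_comparison[where g = "\<lambda>\<delta>. K * \<bar>\<delta>\<bar>"])
    show "eventually (\<lambda>\<delta>. cmod ((F (t + \<delta>) - F t) / complex_of_real \<delta> - D) \<le> K * \<bar>\<delta>\<bar>) (at 0)"
      unfolding eventually_at
    proof (intro exI[of _ r] conjI ballI impI \<open>0 < r\<close>)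
      fix \<delta> :: real assume d: "\<delta> \<noteq> 0 \<and> dist \<delta> 0 < r"
      then have "(F (t + \<delta>) - F t) / complex_of_real \<delta> - D = (F (t + \<delta>) - F t - complex_of_real \<delta> * D) / complex_of_real \<delta>"
        by (simp add: field_simps)
      then have "cmod ((F (t + \<delta>) - F t) / complex_of_real \<delta> - D) = cmod (F (t + \<delta>) - F t - complex_of_real \<delta> * D) / \<bar>\<delta>\<bar>"
        by (simp add: norm_divide)
      also have "\<dots> \<le> (K * \<delta>\<^sup>2) / \<bar>\<delta>\<bar>" using d by (intro divide_right_mono b) auto
      also have "\<dots> = K * \<bar>\<delta>\<bar>" using d by (simp add: power2_eq_square field_simps abs_if)
      finally show "cmod ((F (t + \<delta>) - F t) / complex_of_real \<delta> - D) \<le> K * \<bar>\<delta>\<bar>" .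
    qed
    show "((\<lambda>\<delta>. K * \<bar>\<delta>\<bar>) \<longlongrightarrow> 0) (at 0)" by (auto intro!: tendsto_eq_intros)
  qed
  then show ?thesis
    unfolding has_vector_derivative_quotient_iff by (simp only: Lim_null[of _ D])
qed

section \<open>Integration by parts\<close>

lemma integral_lborel_shift:
  fixes F :: "'a::euclidean_space \<Rightarrow> complex"
  assumes [measurable]: "F \<in> borel_measurable borel"
  shows "(\<integral>x. F (x + a) \<partial>lborel) = (\<integral>x. F x \<partial>lborel)"
proof -
  have "(\<integral>x. F x \<partial>lborel) = (\<integral>x. F x \<partial>(distr lborel borel ((+) a)))"
    by (simp add: lborel_distr_plus)
  also have "\<dots> = (\<integral>x. F (a + x) \<partial>lborel)" by (subst integral_distr) auto
  finally show ?thesis by (simp add: add.commute)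
qed

lemma partial_works:
  assumes "F differentiable at (x + h *\<^sub>R axis j 1)"
  shows "((\<lambda>h. F (x + h *\<^sub>R axis j 1)) has_vector_derivative partial j F (x + h *\<^sub>R axis j 1)) (at h)"
proof -
  let ?e = "axis j 1"
  have 1: "((\<lambda>h. x + h *\<^sub>R ?e) has_derivative (\<lambda>h. h *\<^sub>R ?e)) (at h)"
    by (auto intro!: derivative_eq_intros)
  have 2: "(F has_derivative frechet_derivative F (at (x + h *\<^sub>R ?e))) (at (x + h *\<^sub>R ?e))"
    using assms by (simp add: frechet_derivative_works)
  have "((\<lambda>h. F (x + h *\<^sub>R ?e)) has_derivative (\<lambda>k. frechet_derivative F (at (x + h *\<^sub>R ?e)) (k *\<^sub>R ?e))) (at h)"
    by (rule has_derivative_compose[OF 1 2])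
  moreover have "frechet_derivative F (at (x + h *\<^sub>R ?e)) (k *\<^sub>R ?e) = k *\<^sub>R partial j F (x + h *\<^sub>R ?e)" for k
    using has_derivative_bounded_linear[OF 2]
    by (simp add: partial_def linear_simps bounded_linear.linear linear_scale)
  ultimately show ?thesis by (simp add: has_vector_derivative_def)
qed

text \<open>From \<open>\<parallel>y\<parallel>\<^sup>2 \<le> (\<parallel>y + e\<parallel> + 1)\<^sup>2 \<le> 2 \<parallel>y + e\<parallel>\<^sup>2 + 2\<close>.\<close>

lemma gaussian_shift_le:
  fixes y e :: "'a::real_normed_vector"
  assumes "0 < k" "norm e \<le> 1"
  shows "exp (- k * (norm (y + e))\<^sup>2) \<le> exp k * exp (- (k / 2) * (norm y)\<^sup>2)"
proof -
  have "norm y \<le> norm (y + e) + norm e" by (metis add_diff_cancel_right' norm_triangle_ineq4)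
  then have "norm y \<le> norm (y + e) + 1" using assms by simp
  then have "(norm y)\<^sup>2 \<le> (norm (y + e) + 1)\<^sup>2" by (intro power_mono) auto
  also have "\<dots> \<le> 2 * (norm (y + e))\<^sup>2 + 2"
    using zero_le_power2[of "norm (y + e) - 1"] by (simp add: power2_eq_square algebra_simps)
  finally have "k * ((norm y)\<^sup>2 / 2) \<le> k * ((norm (y + e))\<^sup>2 + 1)" using assms by (intro mult_left_mono) auto
  then show ?thesis by (simp add: exp_add[symmetric] algebra_simps)
qed

text \<open>The difference quotients in direction \<open>j\<close> have integral \<open>0\<close> because the Lebesgue measure is
  translation invariant. The mean value theorem bounds them by a Gaussian, so they may be integrated to
  the limit.\<close>

lemma integral_partial_eq_0:
  fixes F :: "real ^ 'n \<Rightarrow> complex"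
  assumes d: "\<And>x. F differentiable at x" and k: "0 < k"
    and b: "\<And>x. cmod (F x) \<le> C * exp (- k * (norm (x - c))\<^sup>2)"
    and b': "\<And>x. cmod (partial j F x) \<le> C' * exp (- k * (norm (x - c))\<^sup>2)"
  shows "(\<integral>x. partial j F x \<partial>lborel) = 0"
proof -
  let ?e = "axis j 1 :: real ^ 'n"
  \<comment> \<open>Difference quotients with increment \<open>1/(n+1)\<close>.\<close>
  define D where "D = (\<lambda>n x. complex_of_real (real (Suc n)) * (F (x + (1 / real (Suc n)) *\<^sub>R ?e) - F x))"
  have "continuous_on UNIV F"
    using d by (auto intro!: continuous_at_imp_continuous_on differentiable_imp_continuous_within)
  then have [measurable]: "F \<in> borel_measurable borel" by (rule borel_measurable_continuous_onI)
  have [measurable]: "D n \<in> borel_measurable borel" for n unfolding D_def by measurable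
  have C': "0 \<le> C'" using b'[of c] by (auto intro: order_trans[OF norm_ge_zero])
  have hvd: "((\<lambda>h. F (x + h *\<^sub>R ?e)) has_vector_derivative partial j F (x + h *\<^sub>R ?e)) (at h)" for x h
    by (rule partial_works[OF d])
  have lim: "(\<lambda>n. D n x) \<longlonglongrightarrow> partial j F x" for x
  proof -
    have "((\<lambda>\<delta>. (F (x + \<delta> *\<^sub>R ?e) - F x) / complex_of_real \<delta>) \<longlongrightarrow> partial j F x) (at 0)"
      using hvd[of x 0] unfolding has_vector_derivative_quotient_iff by simp
    moreover have "filterlim (\<lambda>n. 1 / real (Suc n)) (at 0) sequentially"
      unfolding filterlim_at using LIMSEQ_inverse_real_of_nat by (auto simp: inverse_eq_divide)
    ultimately have "(\<lambda>n. (F (x + (1 / real (Suc n)) *\<^sub>R ?e) - F x) / complex_of_real (1 / real (Suc n))) \<longlonglongrightarrow> partial j F x"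
      by (rule filterlim_compose)
    then show ?thesis by (simp add: D_def mult.commute)
  qed
  have [measurable]: "partial j F \<in> borel_measurable borel"
    by (rule borel_measurable_LIMSEQ_metric[where f = D]) (use lim in auto)
  let ?G = "\<lambda>x. (C' * exp k) * exp (- (k / 2) * (norm (x - c))\<^sup>2)"
  have bound: "cmod (D n x) \<le> ?G x" for n x
  proof -
    let ?h = "1 / real (Suc n)"
    have "cmod (F (x + ?h *\<^sub>R ?e) - F (x + 0 *\<^sub>R ?e)) \<le> ?G x * norm (?h - 0)"
    proof (rule differentiable_bound[of "{0..1}" "\<lambda>h. F (x + h *\<^sub>R ?e)" "\<lambda>h k. k *\<^sub>R partial j F (x + h *\<^sub>R ?e)"])
      show "((\<lambda>h. F (x + h *\<^sub>R ?e)) has_derivative (\<lambda>k. k *\<^sub>R partial j F (x + h *\<^sub>R ?e))) (at h within {0..1})" for h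
        using hvd[of x h] by (auto simp: has_vector_derivative_def intro: has_derivative_at_withinI)
      show "onorm (\<lambda>k. k *\<^sub>R partial j F (x + h *\<^sub>R ?e)) \<le> ?G x" if "h \<in> {0..1}" for h
      proof (rule onorm_bound)
        show "0 \<le> ?G x" using C' by simp
        fix l :: real
        have "cmod (partial j F (x + h *\<^sub>R ?e)) \<le> C' * exp (- k * (norm ((x - c) + h *\<^sub>R ?e))\<^sup>2)"
          using b'[of "x + h *\<^sub>R ?e"] by (simp add: algebra_simps)
        also have "\<dots> \<le> C' * (exp k * exp (- (k / 2) * (norm (x - c))\<^sup>2))"
          using that by (intro mult_left_mono gaussian_shift_le k C') auto
        finally have *: "cmod (partial j F (x + h *\<^sub>R ?e)) \<le> ?G x" by (simp only: mult.assoc)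
        have "norm (l *\<^sub>R partial j F (x + h *\<^sub>R ?e)) = cmod (partial j F (x + h *\<^sub>R ?e)) * norm l"
          by simp
        also have "\<dots> \<le> ?G x * norm l" by (rule mult_right_mono[OF * norm_ge_zero])
        finally show "norm (l *\<^sub>R partial j F (x + h *\<^sub>R ?e)) \<le> ?G x * norm l" .
      qed
    qed auto
    moreover have "cmod (complex_of_real (real (Suc n))) = real (Suc n)"
      by (simp only: norm_of_real abs_of_nat)
    ultimately show ?thesis unfolding D_def norm_mult by (simp add: field_simps)
  qed
  have G: "integrable lborel ?G"
    using gaussian_bounded_integrable(3)[of "\<lambda>_. 0" "k / 2" 0 c] k by (intro integrable_mult_right) auto
  have "(\<lambda>n. \<integral>x. D n x \<partial>lborel) \<longlonglongrightarrow> (\<integral>x. partial j F x \<partial>lborel)"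
    by (rule integral_dominated_convergence[where w = ?G]) (use lim bound G in auto)
  moreover have "(\<integral>x. D n x \<partial>lborel) = 0" for n
  proof -
    have i: "integrable lborel F" by (rule gaussian_bounded_integrable[OF _ k b]) simp
    have i2: "integrable lborel (\<lambda>x. F (x + (1 / real (Suc n)) *\<^sub>R ?e))"
    proof -
      have "integrable (distr lborel borel ((+) ((1 / real (Suc n)) *\<^sub>R ?e))) F" using i by (simp add: lborel_distr_plus)
      then show ?thesis by (subst (asm) integrable_distr_eq) (auto simp: add.commute)
    qed
    show ?thesis unfolding D_def using i i2 integral_lborel_shift[of F]
      by (simp add: Bochner_Integration.integral_diff)
  qed
  ultimately show ?thesis by (simp add: LIMSEQ_const_iff)
qed

lemma schwartz_partial: "schwartz f \<Longrightarrow> schwartz (partial j f)"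
  unfolding schwartz_def
proof (intro allI)
  fix "is"
  assume *: "\<forall>is. foldr partial is f differentiable_on UNIV \<and>
           (\<forall>k::nat. bounded (range (\<lambda>x. (norm x ^ k) *\<^sub>R foldr partial is f x)))"
  show "foldr partial is (partial j f) differentiable_on UNIV \<and>
           (\<forall>k::nat. bounded (range (\<lambda>x. (norm x ^ k) *\<^sub>R foldr partial is (partial j f) x)))"
    using *[rule_format, of "is @ [j]"] by simp
qed

lemma schwartz_differentiable: "schwartz f \<Longrightarrow> f differentiable at x"
  unfolding schwartz_def by (drule spec[of _ "[]"]) (auto simp: differentiable_on_def)

lemma schwartz_bounded:
  assumes "schwartz f" obtains B where "0 \<le> B" "\<And>x. cmod (f x) \<le> B"
proof -
  have "bounded (range (\<lambda>x. (norm x ^ 0) *\<^sub>R foldr partial [] f x))"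
    using assms unfolding schwartz_def by blast
  then have "bounded (range f)" by simp
  then obtain B where "\<And>x. cmod (f x) \<le> B" by (auto simp: bounded_iff)
  then show ?thesis by (intro that[of B]) (auto intro: order_trans[OF norm_ge_zero])
qed

lemma schwartz_measurable: "schwartz f \<Longrightarrow> f \<in> borel_measurable borel"
  by (auto intro!: borel_measurable_continuous_onI continuous_at_imp_continuous_on
      differentiable_imp_continuous_within schwartz_differentiable)

lemma gauss_class_mult_integrable:
  assumes "gauss_class c v" "0 < Re z" "schwartz \<phi>"
  shows "integrable lborel (\<lambda>x. v z x * \<phi> x)"
proof -
  obtain k C where k: "0 < k" "0 \<le> C" "\<And>x. cmod (v z x) \<le> C * exp (- k * (norm (x - c))\<^sup>2)"
    using gauss_class_bound_at[OF assms(1,2)] by blast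
  obtain B where B: "0 \<le> B" "\<And>x. cmod (\<phi> x) \<le> B" using schwartz_bounded[OF assms(3)] by blast
  have "cmod (v z x * \<phi> x) \<le> (C * B) * exp (- k * (norm (x - c))\<^sup>2)" for x
  proof -
    have "cmod (v z x * \<phi> x) \<le> (C * exp (- k * (norm (x - c))\<^sup>2)) * B"
      unfolding norm_mult using k B by (intro mult_mono) auto
    then show ?thesis by (simp add: mult_ac)
  qed
  then show ?thesis
    using gauss_class_measurable[OF assms(1,2)] schwartz_measurable[OF assms(3)]
    by (intro gaussian_bounded_integrable[OF _ k(1)]) auto
qed

lemma integral_by_parts:
  assumes v: "gauss_class c v" and z: "0 < Re z" and \<phi>: "schwartz \<phi>"
  shows "(\<integral>x. partial j (v z) x * \<phi> x \<partial>lborel) = - (\<integral>x. v z x * partial j \<phi> x \<partial>lborel)"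
proof -
  obtain v' where v': "gauss_class c v'" "partial j (v z) = v' z"
    using gauss_class_partial[OF v] z by metis
  note \<phi>' = schwartz_partial[OF \<phi>, of j]
  have dv: "v z differentiable at x" and d\<phi>: "\<phi> differentiable at x" for x
    by (auto intro: gauss_class_differentiable[OF v z] schwartz_differentiable[OF \<phi>])
  have p: "partial j (\<lambda>x. v z x * \<phi> x) x = v' z x * \<phi> x + v z x * partial j \<phi> x" for x
  proof (rule partial_eqI)
    show "((\<lambda>x. v z x * \<phi> x) has_derivative
        (\<lambda>h. v z x * frechet_derivative \<phi> (at x) h + frechet_derivative (v z) (at x) h * \<phi> x)) (at x)"
      using dv[of x] d\<phi>[of x] by (intro has_derivative_mult) (simp_all add: frechet_derivative_works)
    show "v z x * frechet_derivative \<phi> (at x) (axis j 1) + frechet_derivative (v z) (at x) (axis j 1) * \<phi> x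
        = v' z x * \<phi> x + v z x * partial j \<phi> x"
      unfolding v'(2)[symmetric] by (simp add: partial_def)
  qed
  obtain k C where k: "0 < k" "0 \<le> C" "\<And>x. cmod (v z x) \<le> C * exp (- k * (norm (x - c))\<^sup>2)"
    using gauss_class_bound_at[OF v z] by blast
  obtain k' C' where k': "0 < k'" "0 \<le> C'" "\<And>x. cmod (v' z x) \<le> C' * exp (- k' * (norm (x - c))\<^sup>2)"
    using gauss_class_bound_at[OF v'(1) z] by blast
  obtain B where B: "0 \<le> B" "\<And>x. cmod (\<phi> x) \<le> B" using schwartz_bounded[OF \<phi>] by blast
  obtain B' where B': "0 \<le> B'" "\<And>x. cmod (partial j \<phi> x) \<le> B'" using schwartz_bounded[OF \<phi>'] by blast
  let ?m = "min k k'"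
  have g: "exp (- k * (norm (x - c))\<^sup>2) \<le> exp (- ?m * (norm (x - c))\<^sup>2)"
    "exp (- k' * (norm (x - c))\<^sup>2) \<le> exp (- ?m * (norm (x - c))\<^sup>2)" for x
    by (auto intro!: mult_right_mono)
  have bv: "cmod (v z x) \<le> C * exp (- ?m * (norm (x - c))\<^sup>2)" for x
    using k by (intro order_trans[OF k(3)] mult_left_mono g)
  have bv': "cmod (v' z x) \<le> C' * exp (- ?m * (norm (x - c))\<^sup>2)" for x
    using k' by (intro order_trans[OF k'(3)] mult_left_mono g)
  have "(\<integral>x. partial j (\<lambda>x. v z x * \<phi> x) x \<partial>lborel) = 0"
  proof (rule integral_partial_eq_0)
    show "(\<lambda>x. v z x * \<phi> x) differentiable at x" for x
      by (intro differentiable_mult dv d\<phi>)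
    show "0 < ?m" using k k' by simp
    fix x
    have "cmod (v z x * \<phi> x) \<le> (C * exp (- ?m * (norm (x - c))\<^sup>2)) * B"
      unfolding norm_mult using k B by (intro mult_mono bv) auto
    then show "cmod (v z x * \<phi> x) \<le> (C * B) * exp (- ?m * (norm (x - c))\<^sup>2)" by (simp add: mult_ac)
    have "cmod (v' z x * \<phi> x + v z x * partial j \<phi> x) \<le> (C' * exp (- ?m * (norm (x - c))\<^sup>2)) * B + (C * exp (- ?m * (norm (x - c))\<^sup>2)) * B'"
    proof (rule order_trans[OF norm_triangle_ineq add_mono])
      show "cmod (v' z x * \<phi> x) \<le> (C' * exp (- ?m * (norm (x - c))\<^sup>2)) * B"
        unfolding norm_mult using k' B by (intro mult_mono bv') auto
      show "cmod (v z x * partial j \<phi> x) \<le> (C * exp (- ?m * (norm (x - c))\<^sup>2)) * B'"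
        unfolding norm_mult using k B' by (intro mult_mono bv) auto
    qed
    then show "cmod (partial j (\<lambda>x. v z x * \<phi> x) x) \<le> (C' * B + C * B') * exp (- ?m * (norm (x - c))\<^sup>2)"
      unfolding p by (simp add: algebra_simps)
  qed
  moreover have "(\<integral>x. partial j (\<lambda>x. v z x * \<phi> x) x \<partial>lborel)
      = (\<integral>x. v' z x * \<phi> x \<partial>lborel) + (\<integral>x. v z x * partial j \<phi> x \<partial>lborel)"
    unfolding p by (intro Bochner_Integration.integral_add gauss_class_mult_integrable[OF v'(1) z \<phi>] gauss_class_mult_integrable[OF v z \<phi>'])
  ultimately show ?thesis unfolding v'(2) by (simp add: add_eq_0_iff2)
qed

lemma integral_laplacian_by_parts:
  assumes v: "gauss_class c v" and z: "0 < Re z" and \<phi>: "schwartz \<phi>"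
  shows "(\<integral>x. laplacian (v z) x * \<phi> x \<partial>lborel) = (\<integral>x. v z x * laplacian \<phi> x \<partial>lborel)"
proof -
  have "\<exists>v'. gauss_class c v' \<and> partial i (v z) = v' z" for i
    using gauss_class_partial[OF v] z by metis
  then obtain w where w: "\<And>i. gauss_class c (w i)" "\<And>i. partial i (v z) = w i z" by metis
  have "\<exists>v'. gauss_class c v' \<and> partial i (w i z) = v' z" for i
    using gauss_class_partial[OF w(1)] z by metis
  then obtain y where y: "\<And>i. gauss_class c (y i)" "\<And>i. partial i (w i z) = y i z" by metis
  have 1: "(\<integral>x. y i z x * \<phi> x \<partial>lborel) = (\<integral>x. v z x * partial i (partial i \<phi>) x \<partial>lborel)" for i
    using integral_by_parts[OF w(1) z \<phi>, of i i] integral_by_parts[OF v z schwartz_partial[OF \<phi>], of i i]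
    by (simp add: w(2) y(2))
  have "(\<integral>x. laplacian (v z) x * \<phi> x \<partial>lborel) = (\<integral>x. (\<Sum>i\<in>UNIV. y i z x * \<phi> x) \<partial>lborel)"
    by (simp add: laplacian_def w(2) y(2) sum_distrib_right)
  also have "\<dots> = (\<Sum>i\<in>UNIV. \<integral>x. y i z x * \<phi> x \<partial>lborel)"
    by (intro Bochner_Integration.integral_sum gauss_class_mult_integrable[OF y(1) z \<phi>])
  also have "\<dots> = (\<Sum>i\<in>UNIV. \<integral>x. v z x * partial i (partial i \<phi>) x \<partial>lborel)" by (simp add: 1)
  also have "\<dots> = (\<integral>x. (\<Sum>i\<in>UNIV. v z x * partial i (partial i \<phi>) x) \<partial>lborel)"
    by (intro Bochner_Integration.integral_sum[symmetric] gauss_class_mult_integrable[OF v z] schwartz_partial \<phi>)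
  also have "\<dots> = (\<integral>x. v z x * laplacian \<phi> x \<partial>lborel)"
    by (simp add: laplacian_def sum_distrib_left)
  finally show ?thesis .
qed

section \<open>Complex-time heat solutions\<close>

text \<open>The equation \<open>\<partial>\<^sub>z v = \<Delta> v\<close> on the right half plane. Its restriction to a vertical line
  \<open>z = b + i t\<close> solves the Schroedinger equation, and running down the line solves it backwards in time.\<close>

definition heat_solution :: "real ^ 'n \<Rightarrow> (complex \<Rightarrow> real ^ 'n \<Rightarrow> complex) \<Rightarrow> bool"
  where "heat_solution c v \<longleftrightarrow> gauss_class c v \<and>
    (\<forall>z x. 0 < Re z \<longrightarrow> ((\<lambda>z. v z x) has_field_derivative laplacian (v z) x) (at z))"

lemma heat_solution_laplacian:
  assumes "heat_solution c v"
  obtains v' where "gauss_class c v'" "\<And>z. 0 < Re z \<Longrightarrow> laplacian (v z) = v' z"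
    "\<And>z x. 0 < Re z \<Longrightarrow> ((\<lambda>z. v z x) has_field_derivative v' z x) (at z)"
proof -
  obtain v' where v': "gauss_class c v'"
    "\<And>z x. 0 < Re z \<Longrightarrow> ((\<lambda>z. v z x) has_field_derivative v' z x) (at z)"
    using gauss_class_z_derivative assms unfolding heat_solution_def by blast
  have "laplacian (v z) = v' z" if "0 < Re z" for z
    using assms v'(2) that unfolding heat_solution_def by (auto intro!: ext DERIV_unique)
  then show ?thesis using that v' by blast
qed

text \<open>Taylor's formula in the two directions \<open>w = \<i>\<close> and \<open>w = - \<i>\<close> of real time, forwards and
  backwards.\<close>

lemma heat_solution_remainder:
  assumes v: "heat_solution c v" and z0: "0 < Re z0" and w: "cmod w = 1"
  obtains r k C where "0 < r" "0 < k" "0 \<le> C"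
    "\<And>\<delta>. \<bar>\<delta>\<bar> < r \<Longrightarrow> 0 < Re (z0 + w * complex_of_real \<delta>)"
    "\<And>\<delta> x. \<bar>\<delta>\<bar> < r \<Longrightarrow>
      cmod (v (z0 + w * complex_of_real \<delta>) x - v z0 x - complex_of_real \<delta> * (w * laplacian (v z0) x)) \<le> C * \<delta>\<^sup>2 * exp (- k * (norm (x - c))\<^sup>2)"
proof -
  obtain v' where v': "gauss_class c v'" "\<And>z. 0 < Re z \<Longrightarrow> laplacian (v z) = v' z"
    "\<And>z x. 0 < Re z \<Longrightarrow> ((\<lambda>z. v z x) has_field_derivative v' z x) (at z)"
    using heat_solution_laplacian[OF v] by blast
  have g: "gauss_class c v" using v by (simp add: heat_solution_def)
  obtain r k C where b: "0 < r" "0 < k" "0 \<le> C" "\<And>z. z \<in> ball z0 r \<Longrightarrow> 0 < Re z"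
    "\<And>z x. z \<in> ball z0 r \<Longrightarrow>
      cmod (v z x - v z0 x - (z - z0) * v' z0 x) \<le> C * (cmod (z - z0))\<^sup>2 * exp (- k * (norm (x - c))\<^sup>2)"
    using gauss_class_Taylor[OF g v'(1,3) z0] by blast
  have in_ball: "z0 + w * complex_of_real \<delta> \<in> ball z0 r" if "\<bar>\<delta>\<bar> < r" for \<delta>
    using that w by (simp add: dist_norm norm_mult)
  show ?thesis
  proof (rule that[OF b(1-3)])
    show "0 < Re (z0 + w * complex_of_real \<delta>)" if "\<bar>\<delta>\<bar> < r" for \<delta> using b(4)[OF in_ball[OF that]] .
    show "cmod (v (z0 + w * complex_of_real \<delta>) x - v z0 x - complex_of_real \<delta> * (w * laplacian (v z0) x)) \<le> C * \<delta>\<^sup>2 * exp (- k * (norm (x - c))\<^sup>2)"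
      if "\<bar>\<delta>\<bar> < r" for \<delta> x
      using b(5)[OF in_ball[OF that], of x] w by (simp add: v'(2)[OF z0] norm_mult mult_ac)
  qed
qed

text \<open>The integrated remainder is \<open>O(\<delta>\<^sup>2)\<close>, which gives \<open>\<i> \<integral> \<Delta> v \<phi>\<close> as derivative; the
  Laplacian is then moved to the test function.\<close>

lemma heat_solution_weak_derivative:
  assumes v: "heat_solution c v" and b: "0 < b" and \<phi>: "schwartz \<phi>"
  shows "((\<lambda>s. \<integral>x. v (Complex b s) x * \<phi> x \<partial>lborel) has_vector_derivative
    \<i> * (\<integral>x. v (Complex b t) x * laplacian \<phi> x \<partial>lborel)) (at t)"
proof -
  let ?z = "Complex b t"
  have z: "0 < Re ?z" using b by simp
  have g: "gauss_class c v" using v by (simp add: heat_solution_def)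
  obtain v' where v': "gauss_class c v'" "laplacian (v ?z) = v' ?z"
    using heat_solution_laplacian[OF v] z by metis
  have shift: "?z + \<i> * complex_of_real \<delta> = Complex b (t + \<delta>)" for \<delta>
    by (simp add: complex_eq_iff)
  obtain r k C where rk': "0 < r" "0 < k" "0 \<le> C"
    "\<And>\<delta>. \<bar>\<delta>\<bar> < r \<Longrightarrow> 0 < Re (?z + \<i> * complex_of_real \<delta>)"
    "\<And>\<delta> x. \<bar>\<delta>\<bar> < r \<Longrightarrow>
      cmod (v (?z + \<i> * complex_of_real \<delta>) x - v ?z x - complex_of_real \<delta> * (\<i> * laplacian (v ?z) x)) \<le> C * \<delta>\<^sup>2 * exp (- k * (norm (x - c))\<^sup>2)"
    using heat_solution_remainder[OF v z norm_ii] by blast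
  note rk = rk'(1-3) rk'(5)[unfolded shift v'(2)]
  obtain B where B: "0 \<le> B" "\<And>x. cmod (\<phi> x) \<le> B" using schwartz_bounded[OF \<phi>] by blast
  have int: "integrable lborel (\<lambda>x. v (Complex b s) x * \<phi> x)" for s
    by (rule gauss_class_mult_integrable[OF g _ \<phi>]) (use b in simp)
  have int': "integrable lborel (\<lambda>x. v' ?z x * \<phi> x)"
    by (rule gauss_class_mult_integrable[OF v'(1) _ \<phi>]) (use b in simp)
  let ?I = "\<integral>x. exp (- k * (norm (x - c))\<^sup>2) \<partial>lborel"
  have "((\<lambda>s. \<integral>x. v (Complex b s) x * \<phi> x \<partial>lborel) has_vector_derivative
      \<i> * (\<integral>x. v' ?z x * \<phi> x \<partial>lborel)) (at t)"
  proof (rule has_vector_derivative_quadratic_remainder[OF \<open>0 < r\<close>, where K = "C * B * ?I"])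
    fix \<delta> :: real assume d: "\<bar>\<delta>\<bar> < r"
    let ?R = "\<lambda>x. (v (Complex b (t + \<delta>)) x - v ?z x - complex_of_real \<delta> * (\<i> * v' ?z x)) * \<phi> x"
    have "(\<integral>x. v (Complex b (t + \<delta>)) x * \<phi> x \<partial>lborel) - (\<integral>x. v ?z x * \<phi> x \<partial>lborel)
      - complex_of_real \<delta> * (\<i> * (\<integral>x. v' ?z x * \<phi> x \<partial>lborel))
      = (\<integral>x. v (Complex b (t + \<delta>)) x * \<phi> x - v ?z x * \<phi> x - complex_of_real \<delta> * (\<i> * (v' ?z x * \<phi> x)) \<partial>lborel)"
      using int int' by simp
    also have "\<dots> = (\<integral>x. ?R x \<partial>lborel)"
      by (rule Bochner_Integration.integral_cong[OF refl]) (simp add: algebra_simps)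
    finally have eq: "(\<integral>x. v (Complex b (t + \<delta>)) x * \<phi> x \<partial>lborel) - (\<integral>x. v ?z x * \<phi> x \<partial>lborel)
      - complex_of_real \<delta> * (\<i> * (\<integral>x. v' ?z x * \<phi> x \<partial>lborel)) = (\<integral>x. ?R x \<partial>lborel)" .
    have "cmod (\<integral>x. ?R x \<partial>lborel) \<le> (C * \<delta>\<^sup>2 * B) * ?I"
    proof (rule gaussian_bounded_integrable(2)[OF _ \<open>0 < k\<close>])
      show "?R \<in> borel_measurable borel"
        using gauss_class_measurable[OF g, of "Complex b (t + \<delta>)"] gauss_class_measurable[OF g z]
          gauss_class_measurable[OF v'(1) z] schwartz_measurable[OF \<phi>] b by simp
      fix x
      have "cmod (?R x) \<le> (C * \<delta>\<^sup>2 * exp (- k * (norm (x - c))\<^sup>2)) * B"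
        unfolding norm_mult[of _ "\<phi> x"] using rk(3) B by (intro mult_mono rk(4) d) auto
      then show "cmod (?R x) \<le> (C * \<delta>\<^sup>2 * B) * exp (- k * (norm (x - c))\<^sup>2)" by (simp only: mult_ac)
    qed
    then show "cmod ((\<integral>x. v (Complex b (t + \<delta>)) x * \<phi> x \<partial>lborel) - (\<integral>x. v ?z x * \<phi> x \<partial>lborel)
      - complex_of_real \<delta> * (\<i> * (\<integral>x. v' ?z x * \<phi> x \<partial>lborel))) \<le> C * B * ?I * \<delta>\<^sup>2"
      unfolding eq by (simp add: mult_ac)
  qed
  moreover have "(\<integral>x. v' ?z x * \<phi> x \<partial>lborel) = (\<integral>x. v ?z x * laplacian \<phi> x \<partial>lborel)"
    using integral_laplacian_by_parts[OF g z \<phi>] by (simp add: v'(2))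
  ultimately show ?thesis by simp
qed

lemma tendsto_ennreal_const_mult:
  assumes "(f \<longlongrightarrow> 0) F" "A < (\<infinity> :: ennreal)"
  shows "((\<lambda>i. ennreal (f i) * A) \<longlongrightarrow> 0) F"
proof -
  have "((\<lambda>i. A * ennreal (f i)) \<longlongrightarrow> A * ennreal 0) F"
    using assms by (intro ennreal_tendsto_cmult tendsto_ennrealI) auto
  then show ?thesis by (simp add: mult.commute)
qed

text \<open>Differentiability in \<open>L\<^sup>2\<close> and not just weakly: in the uniqueness argument the solution is paired
  with a moving test function, and its difference quotients must converge in norm.\<close>

lemma heat_solution_L2_derivative:
  assumes v: "heat_solution c v" and z0: "0 < Re z0" and w: "w = \<i> \<or> w = - \<i>"
  shows "((\<lambda>\<delta>. sqnorm lborel (\<lambda>x. (v (z0 + w * complex_of_real \<delta>) x - v z0 x) / complex_of_real \<delta> - w * laplacian (v z0) x)) \<longlongrightarrow> 0) (at 0)"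
proof -
  have g: "gauss_class c v" using v by (simp add: heat_solution_def)
  have w1: "cmod w = 1" using w by auto
  obtain v' where v': "gauss_class c v'" "laplacian (v z0) = v' z0"
    using heat_solution_laplacian[OF v] z0 by metis
  obtain r k C where rk: "0 < r" "0 < k" "0 \<le> C"
    "\<And>\<delta>. \<bar>\<delta>\<bar> < r \<Longrightarrow> 0 < Re (z0 + w * complex_of_real \<delta>)"
    "\<And>\<delta> x. \<bar>\<delta>\<bar> < r \<Longrightarrow>
      cmod (v (z0 + w * complex_of_real \<delta>) x - v z0 x - complex_of_real \<delta> * (w * v' z0 x)) \<le> C * \<delta>\<^sup>2 * exp (- k * (norm (x - c))\<^sup>2)"
    using heat_solution_remainder[OF v z0 w1] unfolding v'(2) by blast
  let ?J = "\<integral>\<^sup>+x. ennreal (exp (- (2 * k) * (norm (x - c))\<^sup>2)) \<partial>lborel"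
  have J: "?J < \<infinity>" using rk by (intro nn_integral_lborel_gaussian_finite) auto
  let ?Q = "\<lambda>\<delta> x. (v (z0 + w * complex_of_real \<delta>) x - v z0 x) / complex_of_real \<delta> - w * v' z0 x"
  have upper: "((\<lambda>\<delta>. ennreal ((C * \<bar>\<delta>\<bar>)\<^sup>2) * ?J) \<longlongrightarrow> 0) (at 0)"
    by (intro tendsto_ennreal_const_mult J) (auto intro!: tendsto_eq_intros)
  have le: "eventually (\<lambda>\<delta>. sqnorm lborel (?Q \<delta>) \<le> ennreal ((C * \<bar>\<delta>\<bar>)\<^sup>2) * ?J) (at 0)"
    unfolding eventually_at
  proof (intro exI[of _ r] conjI ballI impI \<open>0 < r\<close>)
    fix \<delta> :: real assume d: "\<delta> \<noteq> 0 \<and> dist \<delta> 0 < r"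
    show "sqnorm lborel (?Q \<delta>) \<le> ennreal ((C * \<bar>\<delta>\<bar>)\<^sup>2) * ?J"
    proof (rule sqnorm_gaussian_bounded[OF _ rk(2)])
      show "?Q \<delta> \<in> borel_measurable borel"
        using gauss_class_measurable[OF g rk(4), of \<delta>] gauss_class_measurable[OF g z0]
          gauss_class_measurable[OF v'(1) z0] d by auto
      show "0 \<le> C * \<bar>\<delta>\<bar>" using rk by simp
      fix x
      have "?Q \<delta> x = (v (z0 + w * complex_of_real \<delta>) x - v z0 x - complex_of_real \<delta> * (w * v' z0 x)) / complex_of_real \<delta>"
        using d by (simp add: field_simps)
      then have "cmod (?Q \<delta> x) = cmod (v (z0 + w * complex_of_real \<delta>) x - v z0 x - complex_of_real \<delta> * (w * v' z0 x)) / \<bar>\<delta>\<bar>"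
        by (simp add: norm_divide)
      also have "\<dots> \<le> (C * \<delta>\<^sup>2 * exp (- k * (norm (x - c))\<^sup>2)) / \<bar>\<delta>\<bar>"
        using d by (intro divide_right_mono rk(5)) auto
      also have "\<dots> = C * \<bar>\<delta>\<bar> * exp (- k * (norm (x - c))\<^sup>2)"
        using d by (simp add: power2_eq_square field_simps abs_if)
      finally show "cmod (?Q \<delta> x) \<le> C * \<bar>\<delta>\<bar> * exp (- k * (norm (x - c))\<^sup>2)" .
    qed
  qed
  show ?thesis
    unfolding v'(2) by (rule tendsto_sandwich[OF _ le tendsto_const upper]) simp
qed

lemma heat_solution_L2_continuous:
  assumes v: "heat_solution c v" and b: "0 < b"
  shows "((\<lambda>s. sqnorm lborel (\<lambda>x. v (Complex b s) x - v (Complex b t) x)) \<longlongrightarrow> 0) (at t)"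
proof -
  let ?z = "Complex b t"
  have z: "0 < Re ?z" using b by simp
  have g: "gauss_class c v" using v by (simp add: heat_solution_def)
  obtain v' where v': "gauss_class c v'" "laplacian (v ?z) = v' ?z"
    using heat_solution_laplacian[OF v] z by metis
  have shift: "?z + \<i> * complex_of_real \<delta> = Complex b (t + \<delta>)" for \<delta>
    by (simp add: complex_eq_iff)
  have m [measurable]: "v (Complex b s) \<in> borel_measurable borel" "v' ?z \<in> borel_measurable borel" for s
    using gauss_class_measurable[OF g] gauss_class_measurable[OF v'(1)] b by auto
  let ?Q = "\<lambda>\<delta> x. (v (Complex b (t + \<delta>)) x - v ?z x) / complex_of_real \<delta> - \<i> * v' ?z x"
  have Q: "((\<lambda>\<delta>. sqnorm lborel (?Q \<delta>)) \<longlongrightarrow> 0) (at 0)"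
    using heat_solution_L2_derivative[OF v z, of \<i>] by (simp add: shift v'(2))
  have fin: "sqnorm lborel (\<lambda>x. \<i> * v' ?z x) < \<infinity>"
    by (intro L2_finite L2_cmult gauss_class_L2[OF v'(1) z])
  have upper: "((\<lambda>\<delta>. 2 * sqnorm lborel (?Q \<delta>) + 2 * (ennreal (\<delta>\<^sup>2) * sqnorm lborel (\<lambda>x. \<i> * v' ?z x))) \<longlongrightarrow> 0) (at 0)"
    by (rule tendsto_eq_rhs[where x = "0 + 0"], intro tendsto_add tendsto_2_mult_ennreal Q tendsto_ennreal_const_mult fin) (auto intro!: tendsto_eq_intros)
  have le: "eventually (\<lambda>\<delta>. sqnorm lborel (\<lambda>x. v (Complex b (t + \<delta>)) x - v ?z x)
      \<le> 2 * sqnorm lborel (?Q \<delta>) + 2 * (ennreal (\<delta>\<^sup>2) * sqnorm lborel (\<lambda>x. \<i> * v' ?z x))) (at 0)"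
    unfolding eventually_at
  proof (intro exI[of _ 1] conjI ballI impI)
    fix \<delta> :: real assume d: "\<delta> \<noteq> 0 \<and> dist \<delta> 0 < 1"
    then have d1: "\<delta>\<^sup>2 \<le> 1" by (simp add: abs_square_le_1)
    have "(\<lambda>x. v (Complex b (t + \<delta>)) x - v ?z x) = (\<lambda>x. complex_of_real \<delta> * ?Q \<delta> x + complex_of_real \<delta> * (\<i> * v' ?z x))"
      using d by (auto simp: field_simps)
    then have "sqnorm lborel (\<lambda>x. v (Complex b (t + \<delta>)) x - v ?z x)
      \<le> 2 * sqnorm lborel (\<lambda>x. complex_of_real \<delta> * ?Q \<delta> x) + 2 * sqnorm lborel (\<lambda>x. complex_of_real \<delta> * (\<i> * v' ?z x))"
      using sqnorm_add_le[of "\<lambda>x. complex_of_real \<delta> * ?Q \<delta> x" lborel "\<lambda>x. complex_of_real \<delta> * (\<i> * v' ?z x)"] by simp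
    also have "\<dots> = 2 * (ennreal (\<delta>\<^sup>2) * sqnorm lborel (?Q \<delta>)) + 2 * (ennreal (\<delta>\<^sup>2) * sqnorm lborel (\<lambda>x. \<i> * v' ?z x))"
      by (subst (1 2) sqnorm_cmult) auto
    also have "\<dots> \<le> 2 * (1 * sqnorm lborel (?Q \<delta>)) + 2 * (ennreal (\<delta>\<^sup>2) * sqnorm lborel (\<lambda>x. \<i> * v' ?z x))"
      using d1 by (intro add_mono mult_left_mono mult_right_mono) auto
    finally show "sqnorm lborel (\<lambda>x. v (Complex b (t + \<delta>)) x - v ?z x)
      \<le> 2 * sqnorm lborel (?Q \<delta>) + 2 * (ennreal (\<delta>\<^sup>2) * sqnorm lborel (\<lambda>x. \<i> * v' ?z x))" by simp
  qed simp
  have "((\<lambda>\<delta>. sqnorm lborel (\<lambda>x. v (Complex b (t + \<delta>)) x - v ?z x)) \<longlongrightarrow> 0) (at 0)"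
    by (rule tendsto_sandwich[OF _ le tendsto_const upper]) simp
  then show ?thesis
    unfolding at_to_0[of t] filterlim_filtermap by (simp only: add.commute[of _ t])
qed

section \<open>Heat polynomials\<close>

text \<open>The heat polynomial \<open>a\<^bsup>n/2\<^esup> H\<^sub>n(x / \<surd>a)\<close>, made polynomial in \<open>a\<close> so that \<open>a\<close> may depend
  holomorphically on \<open>z\<close>.\<close>

fun heat_poly :: "nat \<Rightarrow> complex \<Rightarrow> complex \<Rightarrow> complex" where
  "heat_poly 0 x a = 1"
| "heat_poly (Suc 0) x a = x"
| "heat_poly (Suc (Suc n)) x a = x * heat_poly (Suc n) x a - of_nat (Suc n) * a * heat_poly n x a"

text \<open>The factor \<open>n\<close> makes the recurrence hold for \<open>n = 0\<close> and \<open>n = 1\<close> too, where the predecessors are truncated.\<close>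

lemma heat_poly_recurrence:
  "of_nat n * heat_poly n x a =
    of_nat n * (x * heat_poly (n - 1) x a - of_nat (n - 1) * a * heat_poly (n - 2) x a)"
  by (induction n rule: induct_nat_012) auto

lemma heat_poly_deriv_x: "((\<lambda>x. heat_poly n x a) has_field_derivative of_nat n * heat_poly (n - 1) x a) (at x)"
proof (induction n rule: induct_nat_012)
  case (ge2 n)
  have "((\<lambda>x. heat_poly (Suc (Suc n)) x a) has_field_derivative
      heat_poly (Suc n) x a + x * (of_nat (Suc n) * heat_poly n x a)
        - of_nat (Suc n) * a * (of_nat n * heat_poly (n - 1) x a)) (at x)"
    unfolding heat_poly.simps
    by (auto intro!: derivative_eq_intros ge2.IH[simplified])
  moreover have "x * (of_nat (Suc n) * heat_poly n x a) - of_nat (Suc n) * a * (of_nat n * heat_poly (n - 1) x a)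
      = of_nat (Suc n) * heat_poly (Suc n) x a"
    by (cases n) (auto simp: algebra_simps)
  ultimately show ?case by (simp add: algebra_simps)
qed auto

text \<open>Backward heat equation: the right-hand side is \<open>- 1/2\<close> times the second derivative in \<open>x\<close>.\<close>

lemma heat_poly_deriv_a:
  "((\<lambda>a. heat_poly n x a) has_field_derivative - (of_nat n * of_nat (n - 1) / 2) * heat_poly (n - 2) x a) (at a)"
proof (induction n rule: induct_nat_012)
  case (ge2 n)
  have "((\<lambda>a. heat_poly (Suc (Suc n)) x a) has_field_derivative
      x * (- (of_nat (Suc n) * of_nat n / 2) * heat_poly (n - 1) x a)
        - (of_nat (Suc n) * heat_poly n x a + of_nat (Suc n) * a * (- (of_nat n * of_nat (n - 1) / 2) * heat_poly (n - 2) x a))) (at a)"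
    unfolding heat_poly.simps
    by (rule DERIV_cong[OF DERIV_diff[OF DERIV_cmult[OF ge2.IH(2)] DERIV_mult[OF DERIV_cmult[OF DERIV_ident] ge2.IH(1)]]])
      (simp add: numeral_2_eq_2 algebra_simps)
  moreover have "x * (- (of_nat (Suc n) * of_nat n / 2) * heat_poly (n - 1) x a)
        - (of_nat (Suc n) * heat_poly n x a + of_nat (Suc n) * a * (- (of_nat n * of_nat (n - 1) / 2) * heat_poly (n - 2) x a))
      = - (of_nat (Suc n) / 2) * (of_nat n * (x * heat_poly (n - 1) x a - of_nat (n - 1) * a * heat_poly (n - 2) x a) + 2 * heat_poly n x a)"
    by (simp add: algebra_simps diff_divide_distrib add_divide_distrib)
  moreover have "\<dots> = - (of_nat (Suc (Suc n)) * of_nat (Suc n) / 2) * heat_poly n x a"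
    by (simp only: heat_poly_recurrence[symmetric]) (simp add: algebra_simps)
  ultimately show ?case
    by (simp only: One_nat_def numeral_2_eq_2 diff_Suc_Suc minus_nat.diff_0)
qed auto

lemma heat_poly_hermite:
  assumes "0 < s"
  shows "heat_poly n (complex_of_real x) (complex_of_real (s\<^sup>2)) = complex_of_real (s ^ n * poly (he n) (x / s))"
proof (induction n rule: induct_nat_012)
  case (ge2 n)
  have "s ^ Suc (Suc n) * poly (he (Suc (Suc n))) (x / s)
     = x * (s ^ Suc n * poly (he (Suc n)) (x / s)) - real (Suc n) * s\<^sup>2 * (s ^ n * poly (he n) (x / s))"
    using assms by (simp only: poly_he_recurrence) (simp add: field_simps power2_eq_square del: he.simps)
  from arg_cong[OF this, of complex_of_real] show ?case
    unfolding heat_poly.simps ge2.IH by (simp only: of_real_mult of_real_diff of_real_of_nat_eq)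
qed (use assms in \<open>auto simp: pderiv_pCons\<close>)

section \<open>One-dimensional Hermite solutions\<close>

text \<open>Normalised so that at \<open>z = b\<close> the factor \<open>\<surd>b / \<surd>z\<close> is \<open>1\<close> and the solution below is the
  Hermite function \<open>H\<^sub>n(t / \<surd>b) exp (- t\<^sup>2 / (4b))\<close>.\<close>

definition hermite_prefactor :: "nat \<Rightarrow> real \<Rightarrow> complex \<Rightarrow> complex"
  where "hermite_prefactor n b z = complex_of_real (sqrt b) ^ Suc n * inverse (csqrt z) * inverse z ^ n"

text \<open>On the line \<open>Re z = b\<close> this is a rescaled Hermite polynomial times a complex Gaussian, up to a
  factor depending on \<open>z\<close>. There the second argument \<open>2 z - z\<^sup>2 / b\<close> equals \<open>\<bar>z\<bar>\<^sup>2 / b\<close>; unlike the latter it is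
  holomorphic in \<open>z\<close>. The next two functions are its first and second derivatives in \<open>t\<close>.\<close>

definition hermite_heat1 :: "nat \<Rightarrow> real \<Rightarrow> complex \<Rightarrow> real \<Rightarrow> complex"
  where "hermite_heat1 n b z t = hermite_prefactor n b z *
    heat_poly n (complex_of_real t) (2 * z - z\<^sup>2 / complex_of_real b) * exp (- complex_of_real (t\<^sup>2) / (4 * z))"

definition hermite_heat1_t :: "nat \<Rightarrow> real \<Rightarrow> complex \<Rightarrow> real \<Rightarrow> complex"
  where "hermite_heat1_t n b z t = hermite_prefactor n b z *
    (of_nat n * heat_poly (n - 1) (complex_of_real t) (2 * z - z\<^sup>2 / complex_of_real b)
      - complex_of_real t / (2 * z) * heat_poly n (complex_of_real t) (2 * z - z\<^sup>2 / complex_of_real b))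
    * exp (- complex_of_real (t\<^sup>2) / (4 * z))"

definition hermite_heat1_tt :: "nat \<Rightarrow> real \<Rightarrow> complex \<Rightarrow> real \<Rightarrow> complex"
  where "hermite_heat1_tt n b z t = hermite_prefactor n b z *
    (of_nat n * of_nat (n - 1) * heat_poly (n - 2) (complex_of_real t) (2 * z - z\<^sup>2 / complex_of_real b)
      - of_nat n * complex_of_real t / z * heat_poly (n - 1) (complex_of_real t) (2 * z - z\<^sup>2 / complex_of_real b)
      - heat_poly n (complex_of_real t) (2 * z - z\<^sup>2 / complex_of_real b) / (2 * z)
      + (complex_of_real t)\<^sup>2 / (4 * z\<^sup>2) * heat_poly n (complex_of_real t) (2 * z - z\<^sup>2 / complex_of_real b))
    * exp (- complex_of_real (t\<^sup>2) / (4 * z))"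

lemma hermite_heat1_deriv_t:
  assumes z: "z \<noteq> 0"
  shows "((\<lambda>t. hermite_heat1 n b z t) has_vector_derivative hermite_heat1_t n b z t) (at t)"
proof -
  let ?a = "2 * z - z\<^sup>2 / complex_of_real b"
  have "((\<lambda>x. hermite_prefactor n b z * heat_poly n x ?a * exp (- (x\<^sup>2) / (4 * z))) has_field_derivative
      hermite_prefactor n b z * (of_nat n * heat_poly (n - 1) x ?a - x / (2 * z) * heat_poly n x ?a) * exp (- (x\<^sup>2) / (4 * z))) (at x)" for x
    using z by (auto intro!: derivative_eq_intros heat_poly_deriv_x simp: field_simps)
  from has_vector_derivative_real_field[OF this[of "complex_of_real t"]]
  show ?thesis by (simp add: hermite_heat1_def hermite_heat1_t_def)
qed

lemma hermite_heat1_t_deriv_t: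
  assumes z: "z \<noteq> 0"
  shows "((\<lambda>t. hermite_heat1_t n b z t) has_vector_derivative hermite_heat1_tt n b z t) (at t)"
proof -
  let ?a = "2 * z - z\<^sup>2 / complex_of_real b"
  let ?E = "\<lambda>x. exp (- (x\<^sup>2) / (4 * z))"
  have E: "(?E has_field_derivative - (x / (2 * z)) * ?E x) (at x)" for x
    using z by (auto intro!: derivative_eq_intros simp: field_simps)
  have h: "((\<lambda>x. of_nat n * heat_poly (n - 1) x ?a - x / (2 * z) * heat_poly n x ?a) has_field_derivative
      of_nat n * (of_nat (n - 1) * heat_poly (n - 2) x ?a)
      - (heat_poly n x ?a / (2 * z) + x / (2 * z) * (of_nat n * heat_poly (n - 1) x ?a))) (at x)" for x
    by (rule DERIV_cong[OF DERIV_diff[OF DERIV_cmult[OF heat_poly_deriv_x] DERIV_mult[OF DERIV_cdivide[OF DERIV_ident] heat_poly_deriv_x]]])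
      (simp add: numeral_2_eq_2 algebra_simps)
  have "((\<lambda>x. hermite_prefactor n b z * ((of_nat n * heat_poly (n - 1) x ?a - x / (2 * z) * heat_poly n x ?a) * ?E x)) has_field_derivative
      hermite_prefactor n b z * ((of_nat n * (of_nat (n - 1) * heat_poly (n - 2) x ?a)
      - (heat_poly n x ?a / (2 * z) + x / (2 * z) * (of_nat n * heat_poly (n - 1) x ?a))) * ?E x
      + - (x / (2 * z)) * ?E x * (of_nat n * heat_poly (n - 1) x ?a - x / (2 * z) * heat_poly n x ?a))) (at x)" for x
    by (intro DERIV_cmult DERIV_mult h E)
  from has_vector_derivative_real_field[OF this[of "complex_of_real t"]]
  have "((\<lambda>t. hermite_heat1_t n b z t) has_vector_derivative
    hermite_prefactor n b z * ((of_nat n * (of_nat (n - 1) * heat_poly (n - 2) (complex_of_real t) ?a)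
      - (heat_poly n (complex_of_real t) ?a / (2 * z) + complex_of_real t / (2 * z) * (of_nat n * heat_poly (n - 1) (complex_of_real t) ?a))) * ?E (complex_of_real t)
      + - (complex_of_real t / (2 * z)) * ?E (complex_of_real t) * (of_nat n * heat_poly (n - 1) (complex_of_real t) ?a - complex_of_real t / (2 * z) * heat_poly n (complex_of_real t) ?a))) (at t)"
    by (simp add: hermite_heat1_t_def mult.assoc)
  also have "hermite_prefactor n b z * ((of_nat n * (of_nat (n - 1) * heat_poly (n - 2) (complex_of_real t) ?a)
      - (heat_poly n (complex_of_real t) ?a / (2 * z) + complex_of_real t / (2 * z) * (of_nat n * heat_poly (n - 1) (complex_of_real t) ?a))) * ?E (complex_of_real t)
      + - (complex_of_real t / (2 * z)) * ?E (complex_of_real t) * (of_nat n * heat_poly (n - 1) (complex_of_real t) ?a - complex_of_real t / (2 * z) * heat_poly n (complex_of_real t) ?a))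
    = hermite_heat1_tt n b z t"
  proof -
    have "(N * (M * h2) - (h / (2 * z) + x / (2 * z) * (N * h1))) * E + - (x / (2 * z)) * E * (N * h1 - x / (2 * z) * h)
      = (N * M * h2 - N * x / z * h1 - h / (2 * z) + x\<^sup>2 / (4 * z\<^sup>2) * h) * E" for N M h h1 h2 x E :: complex
      using z by (simp add: divide_simps power2_eq_square) (simp add: algebra_simps)
    then show ?thesis by (simp only: hermite_heat1_tt_def of_real_power mult.assoc[of "hermite_prefactor n b z"])
  qed
  finally show ?thesis .
qed

text \<open>The one-dimensional heat equation. After the common factor is removed, the two sides differ by
  \<open>n/z\<close> times the three-term recurrence of the heat polynomials at \<open>a = 2 z - z\<^sup>2 / b\<close>; this fixes
  the choice of \<open>a\<close>.\<close>

lemma hermite_heat1_deriv_z: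
  assumes z: "0 < Re z" and b: "0 < b"
  shows "((\<lambda>z. hermite_heat1 n b z t) has_field_derivative hermite_heat1_tt n b z t) (at z)"
proof -
  let ?x = "complex_of_real t"
  let ?a = "\<lambda>z. 2 * z - z\<^sup>2 / complex_of_real b"
  let ?P = "hermite_prefactor n b"
  let ?E = "\<lambda>z. exp (- complex_of_real (t\<^sup>2) / (4 * z))"
  have z0: "z \<noteq> 0" and zr: "z \<notin> \<real>\<^sub>\<le>\<^sub>0" using z by (auto simp: complex_nonpos_Reals_iff)
  have cs: "csqrt z \<noteq> 0" "(csqrt z)\<^sup>2 = z" using z0 by auto
  have i: "((\<lambda>z. inverse (csqrt z)) has_field_derivative - (1 / (2 * z)) * inverse (csqrt z)) (at z)"
  proof -
    have "((\<lambda>z. inverse (csqrt z)) has_field_derivative - (inverse (csqrt z) * (inverse (2 * csqrt z)) * inverse (csqrt z))) (at z)"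
      by (rule DERIV_inverse'[OF has_field_derivative_csqrt[OF zr] cs(1)])
    also have "- (inverse (csqrt z) * (inverse (2 * csqrt z)) * inverse (csqrt z)) = - (1 / (2 * (csqrt z)\<^sup>2)) * inverse (csqrt z)"
      using cs(1) by (simp add: field_simps power2_eq_square)
    finally show ?thesis by (simp only: cs(2))
  qed
  have j: "((\<lambda>z. inverse z ^ n) has_field_derivative - (of_nat n / z) * inverse z ^ n) (at z)"
    by (rule DERIV_cong[OF DERIV_power[OF DERIV_inverse[OF z0]]])
      (cases n; simp add: divide_inverse power_Suc)
  have P: "(?P has_field_derivative - ((1 / 2 + of_nat n) / z) * ?P z) (at z)"
  proof -
    have "((\<lambda>z. complex_of_real (sqrt b) ^ Suc n * (inverse (csqrt z) * inverse z ^ n)) has_field_derivative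
      complex_of_real (sqrt b) ^ Suc n * ((- (1 / (2 * z)) * inverse (csqrt z)) * inverse z ^ n + (- (of_nat n / z) * inverse z ^ n) * inverse (csqrt z))) (at z)"
      by (intro DERIV_cmult DERIV_mult i j)
    moreover have "complex_of_real (sqrt b) ^ Suc n * ((- (1 / (2 * z)) * inverse (csqrt z)) * inverse z ^ n + (- (of_nat n / z) * inverse z ^ n) * inverse (csqrt z))
      = - ((1 / 2 + of_nat n) / z) * ?P z"
      unfolding hermite_prefactor_def by (simp add: algebra_simps add_divide_distrib)
    ultimately show ?thesis unfolding hermite_prefactor_def[abs_def] by (simp only: mult.assoc)
  qed
  have h: "((\<lambda>z. heat_poly n ?x (?a z)) has_field_derivative
      (- (of_nat n * of_nat (n - 1) / 2) * heat_poly (n - 2) ?x (?a z)) * (2 - 2 * z / complex_of_real b)) (at z)"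
    by (rule DERIV_chain2[OF heat_poly_deriv_a]) (use b in \<open>auto intro!: derivative_eq_intros\<close>)
  have E: "(?E has_field_derivative (?x\<^sup>2 / (4 * z\<^sup>2)) * ?E z) (at z)"
    using z0 by (auto intro!: derivative_eq_intros simp: field_simps power2_eq_square)
  have "((\<lambda>z. hermite_heat1 n b z t) has_field_derivative
     ((- ((1 / 2 + of_nat n) / z) * ?P z) * heat_poly n ?x (?a z)
       + ((- (of_nat n * of_nat (n - 1) / 2) * heat_poly (n - 2) ?x (?a z)) * (2 - 2 * z / complex_of_real b)) * ?P z) * ?E z
     + (?x\<^sup>2 / (4 * z\<^sup>2) * ?E z) * (?P z * heat_poly n ?x (?a z))) (at z)"
    unfolding hermite_heat1_def by (intro DERIV_mult P h E)
  moreover have "((- ((1 / 2 + of_nat n) / z) * ?P z) * heat_poly n ?x (?a z)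
       + ((- (of_nat n * of_nat (n - 1) / 2) * heat_poly (n - 2) ?x (?a z)) * (2 - 2 * z / complex_of_real b)) * ?P z) * ?E z
     + (?x\<^sup>2 / (4 * z\<^sup>2) * ?E z) * (?P z * heat_poly n ?x (?a z)) = hermite_heat1_tt n b z t"
  proof -
    have gen: "(- ((1 / 2 + N) / z) * P * h + (- (N * M / 2) * h2) * (2 - 2 * z / B) * P) * E + (x\<^sup>2 / (4 * z\<^sup>2) * E) * (P * h)
      = P * (N * M * h2 - N * x / z * h1 - h / (2 * z) + x\<^sup>2 / (4 * z\<^sup>2) * h) * E"
      if rec: "N * h = N * (x * h1 - M * (2 * z - z\<^sup>2 / B) * h2)" and B: "B \<noteq> 0" for N M h h1 h2 x E P B :: complex
    proof -
      have "N * h / z = N * x * h1 / z - N * M * h2 * (2 - z / B)"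
        unfolding rec using z0 B by (simp add: divide_simps power2_eq_square) (simp add: algebra_simps)
      then have "- ((1 / 2 + N) / z) * h + (- (N * M / 2) * h2) * (2 - 2 * z / B) = N * M * h2 - N * x / z * h1 - h / (2 * z)"
        by (simp add: algebra_simps add_divide_distrib)
      then have "P * E * (- ((1 / 2 + N) / z) * h + (- (N * M / 2) * h2) * (2 - 2 * z / B) + x\<^sup>2 / (4 * z\<^sup>2) * h)
        = P * E * (N * M * h2 - N * x / z * h1 - h / (2 * z) + x\<^sup>2 / (4 * z\<^sup>2) * h)" by simp
      then show ?thesis by (simp only: algebra_simps)
    qed
    show ?thesis unfolding hermite_heat1_tt_def
      by (rule gen[OF heat_poly_recurrence]) (use b in auto)
  qed
  ultimately show ?thesis by (simp only:)
qed

section \<open>Multi-dimensional Hermite solutions\<close>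

lemma partial_prod:
  fixes f :: "'n::finite \<Rightarrow> real \<Rightarrow> complex" and f' :: "real \<Rightarrow> complex" and c :: "real ^ 'n"
  assumes d: "\<And>t. (f i has_vector_derivative f' t) (at t)"
    and d0: "\<And>j t. f j differentiable (at t)"
  shows "partial i (\<lambda>x. \<Prod>j\<in>UNIV. f j (x $ j - c $ j)) = (\<lambda>x. \<Prod>j\<in>UNIV. (if j = i then f' else f j) (x $ j - c $ j))"
proof
  fix x :: "real ^ 'n"
  let ?g = "\<lambda>j. if j = i then f' (x $ i - c $ i) else vector_derivative (f j) (at (x $ j - c $ j))"
  have dj: "(f j has_vector_derivative ?g j) (at (x $ j - c $ j))" for j
    using d d0 by (cases "j = i") (auto simp: vector_derivative_works[symmetric])
  have "((\<lambda>x. f j (x $ j - c $ j)) has_derivative (\<lambda>h. h $ j *\<^sub>R ?g j)) (at x)" for j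
  proof -
    have "((\<lambda>x. x $ j - c $ j) has_derivative (\<lambda>h. h $ j)) (at x)"
      by (auto intro!: derivative_eq_intros bounded_linear.has_derivative[OF bounded_linear_vec_nth])
    from has_derivative_compose[OF this dj[unfolded has_vector_derivative_def]] show ?thesis .
  qed
  then have "((\<lambda>x. \<Prod>j\<in>UNIV. f j (x $ j - c $ j)) has_derivative
      (\<lambda>h. \<Sum>j\<in>UNIV. (h $ j *\<^sub>R ?g j) * (\<Prod>k\<in>UNIV - {j}. f k (x $ k - c $ k)))) (at x)"
    by (intro has_derivative_prod)
  then show "partial i (\<lambda>x. \<Prod>j\<in>UNIV. f j (x $ j - c $ j)) x = (\<Prod>j\<in>UNIV. (if j = i then f' else f j) (x $ j - c $ j))"
  proof (rule partial_eqI)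
    have ax: "axis i (1::real) $ j = (if j = i then 1 else 0)" for j by (simp add: axis_def)
    have "(\<Sum>j\<in>UNIV. (axis i 1 $ j *\<^sub>R ?g j) * (\<Prod>k\<in>UNIV - {j}. f k (x $ k - c $ k)))
      = (\<Sum>j\<in>UNIV. if j = i then f' (x $ i - c $ i) * (\<Prod>k\<in>UNIV - {i}. f k (x $ k - c $ k)) else 0)"
      by (rule sum.cong) (auto simp: ax)
    also have "\<dots> = f' (x $ i - c $ i) * (\<Prod>k\<in>UNIV - {i}. f k (x $ k - c $ k))" by simp
    also have "\<dots> = (if i = i then f' else f i) (x $ i - c $ i) * (\<Prod>j\<in>UNIV - {i}. (if j = i then f' else f j) (x $ j - c $ j))"
      by (intro arg_cong2[where f = "(*)"] prod.cong) auto
    also have "\<dots> = (\<Prod>j\<in>UNIV. (if j = i then f' else f j) (x $ j - c $ j))"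
      by (rule prod.remove[symmetric]) auto
    finally show "(\<Sum>j\<in>UNIV. (axis i 1 $ j *\<^sub>R ?g j) * (\<Prod>k\<in>UNIV - {j}. f k (x $ k - c $ k)))
      = (\<Prod>j\<in>UNIV. (if j = i then f' else f j) (x $ j - c $ j))" .
  qed
qed

lemma laplacian_prod:
  fixes f f' f'' :: "'n::finite \<Rightarrow> real \<Rightarrow> complex" and c :: "real ^ 'n"
  assumes d: "\<And>j t. (f j has_vector_derivative f' j t) (at t)" "\<And>j t. (f' j has_vector_derivative f'' j t) (at t)"
  shows "laplacian (\<lambda>x. \<Prod>j\<in>UNIV. f j (x $ j - c $ j)) x
    = (\<Sum>i\<in>UNIV. f'' i (x $ i - c $ i) * (\<Prod>j\<in>UNIV - {i}. f j (x $ j - c $ j)))"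
proof -
  have dd: "f j differentiable (at t)" "f' j differentiable (at t)" for j t
    by (rule differentiableI_vector[OF d(1)], rule differentiableI_vector[OF d(2)])
  have "partial i (partial i (\<lambda>x. \<Prod>j\<in>UNIV. f j (x $ j - c $ j))) x
      = f'' i (x $ i - c $ i) * (\<Prod>j\<in>UNIV - {i}. f j (x $ j - c $ j))" for i
  proof -
    have "partial i (\<lambda>x. \<Prod>j\<in>UNIV. f j (x $ j - c $ j)) = (\<lambda>x. \<Prod>j\<in>UNIV. (if j = i then f' i else f j) (x $ j - c $ j))"
      by (rule partial_prod) (use d dd in auto)
    moreover have "partial i (\<lambda>x. \<Prod>j\<in>UNIV. (if j = i then f' i else f j) (x $ j - c $ j))
      = (\<lambda>x. \<Prod>j\<in>UNIV. (if j = i then f'' i else (if j = i then f' i else f j)) (x $ j - c $ j))"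
      by (rule partial_prod) (use d dd in auto)
    moreover have "(\<Prod>j\<in>UNIV. (if j = i then f'' i else (if j = i then f' i else f j)) (x $ j - c $ j))
      = f'' i (x $ i - c $ i) * (\<Prod>j\<in>UNIV - {i}. f j (x $ j - c $ j))"
      by (subst prod.remove[of UNIV i]) (auto intro!: prod.cong)
    ultimately show ?thesis by simp
  qed
  then show ?thesis by (simp add: laplacian_def)
qed

definition hermite_heat :: "nat ^ 'n \<Rightarrow> real \<Rightarrow> real ^ 'n \<Rightarrow> complex \<Rightarrow> real ^ 'n \<Rightarrow> complex"
  where "hermite_heat m b c z x = (\<Prod>j\<in>UNIV. hermite_heat1 (m $ j) b z (x $ j - c $ j))"

lemma gauss_class_heat_poly:
  assumes a: "a holomorphic_on {z. 0 < Re z}" and v: "gauss_class c v"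
  shows "gauss_class c (\<lambda>z x. heat_poly n (complex_of_real (x $ j - c $ j)) (a z) * v z x)"
proof (induction n rule: induct_nat_012)
  case 0
  show ?case using v by simp
next
  case 1
  show ?case using gauss_class.coord[OF v, of j] by simp
next
  case (ge2 n)
  have "gauss_class c (\<lambda>z x. complex_of_real (x $ j - c $ j) * (heat_poly (Suc n) (complex_of_real (x $ j - c $ j)) (a z) * v z x)
      + (- of_nat (Suc n) * a z) * (heat_poly n (complex_of_real (x $ j - c $ j)) (a z) * v z x))"
    using a by (intro gauss_class.add gauss_class.coord ge2 gauss_class.coeff[of "\<lambda>z. - of_nat (Suc n) * a z"] holomorphic_intros)
  then show ?case by (simp only: heat_poly.simps) (simp add: algebra_simps)
qed

lemma hermite_heat_eq:
  "hermite_heat m b c z x = (\<Prod>j\<in>UNIV. hermite_prefactor (m $ j) b z) *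
    ((\<Prod>j\<in>UNIV. heat_poly (m $ j) (complex_of_real (x $ j - c $ j)) (2 * z - z\<^sup>2 / complex_of_real b)) *
      exp (- complex_of_real ((norm (x - c))\<^sup>2) / (4 * z)))"
proof -
  have "(\<Prod>j\<in>UNIV. exp (- complex_of_real ((x $ j - c $ j)\<^sup>2) / (4 * z)))
      = exp (\<Sum>j\<in>UNIV. - complex_of_real ((x $ j - c $ j)\<^sup>2) / (4 * z))"
    by (simp add: exp_sum)
  also have "(\<Sum>j\<in>UNIV. - complex_of_real ((x $ j - c $ j)\<^sup>2) / (4 * z)) = - complex_of_real ((norm (x - c))\<^sup>2) / (4 * z)"
    by (simp add: norm_vec_square sum_divide_distrib sum_negf)
  finally show ?thesis
    by (simp only: hermite_heat_def hermite_heat1_def prod.distrib mult.assoc)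
qed

lemma gauss_class_hermite_heat:
  assumes "0 < b"
  shows "gauss_class c (hermite_heat m b c)"
proof -
  let ?a = "\<lambda>z. 2 * z - z\<^sup>2 / complex_of_real b"
  let ?E = "\<lambda>z x. exp (- complex_of_real ((norm (x - c))\<^sup>2) / (4 * z))"
  have "gauss_class c (\<lambda>z x. (\<Prod>j\<in>S. heat_poly (m $ j) (complex_of_real (x $ j - c $ j)) (?a z)) * ?E z x)" for S
  proof (induction S rule: infinite_finite_induct)
    case (insert j S)
    have "gauss_class c (\<lambda>z x. heat_poly (m $ j) (complex_of_real (x $ j - c $ j)) (?a z) *
      ((\<Prod>j\<in>S. heat_poly (m $ j) (complex_of_real (x $ j - c $ j)) (?a z)) * ?E z x))"
      using assms by (intro gauss_class_heat_poly insert holomorphic_intros) auto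
    then show ?case using insert by (simp add: mult.assoc)
  qed (use gauss_class.base in auto)
  moreover have "(\<lambda>z. \<Prod>j\<in>UNIV. hermite_prefactor (m $ j) b z) holomorphic_on {z. 0 < Re z}"
    unfolding hermite_prefactor_def
    by (intro holomorphic_intros) (auto simp: complex_nonpos_Reals_iff)
  ultimately show ?thesis
    unfolding hermite_heat_eq[abs_def] by (intro gauss_class.coeff)
qed

text \<open>A product of one-dimensional solutions in separate variables solves the equation in all variables.\<close>

lemma heat_solution_hermite_heat:
  assumes b: "0 < b"
  shows "heat_solution c (hermite_heat m b c)"
  unfolding heat_solution_def
proof (intro conjI allI impI gauss_class_hermite_heat b)
  fix z x assume z: "0 < Re z"
  then have z0: "z \<noteq> 0" by auto
  let ?f = "\<lambda>j. hermite_heat1 (m $ j) b z" and ?f2 = "\<lambda>j. hermite_heat1_tt (m $ j) b z"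
  have d: "((\<lambda>z. \<Prod>j\<in>UNIV. hermite_heat1 (m $ j) b z (x $ j - c $ j)) has_derivative
     (\<lambda>h. \<Sum>i\<in>UNIV. (?f2 i (x $ i - c $ i) * h) * (\<Prod>j\<in>UNIV - {i}. ?f j (x $ j - c $ j)))) (at z)"
    by (intro has_derivative_prod) (use hermite_heat1_deriv_z[OF z b] in \<open>simp add: has_field_derivative_def\<close>)
  have l: "laplacian (hermite_heat m b c z) x
      = (\<Sum>i\<in>UNIV. ?f2 i (x $ i - c $ i) * (\<Prod>j\<in>UNIV - {i}. ?f j (x $ j - c $ j)))"
    unfolding hermite_heat_def[abs_def]
    by (rule laplacian_prod[where f' = "\<lambda>j. hermite_heat1_t (m $ j) b z"]) (intro hermite_heat1_deriv_t hermite_heat1_t_deriv_t z0)+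
  have eq: "(\<lambda>h. \<Sum>i\<in>UNIV. (?f2 i (x $ i - c $ i) * h) * (\<Prod>j\<in>UNIV - {i}. ?f j (x $ j - c $ j)))
      = (*) (\<Sum>i\<in>UNIV. ?f2 i (x $ i - c $ i) * (\<Prod>j\<in>UNIV - {i}. ?f j (x $ j - c $ j)))"
    by (rule ext) (simp add: sum_distrib_left mult_ac)
  show "((\<lambda>z. hermite_heat m b c z x) has_field_derivative laplacian (hermite_heat m b c z) x) (at z)"
    unfolding has_field_derivative_def l eq[symmetric] using d by (simp only: hermite_heat_def)
qed

text \<open>On the line \<open>Re z = b\<close> one has \<open>2 z - z\<^sup>2 / b = z (2 b - z) / b = z \<cdot> cnj z / b\<close>, a positive number,
  and the heat polynomial is a scaled Hermite polynomial.\<close>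

lemma hermite_heat1_hermite:
  assumes b: "0 < b" and z: "Re z = b"
  shows "hermite_heat1 n b z x = complex_of_real (sqrt b) / csqrt z * (complex_of_real (cmod z) / z) ^ n
    * complex_of_real (poly (he n) (sqrt b / cmod z * x)) * exp (- complex_of_real (x\<^sup>2) / (4 * z))"
proof -
  have z0: "z \<noteq> 0" using assms by auto
  let ?s = "cmod z / sqrt b"
  have s: "0 < ?s" using b z0 by simp
  have "2 * z - z\<^sup>2 / complex_of_real b = z * (2 * complex_of_real b - z) / complex_of_real b"
    using b by (simp add: field_simps power2_eq_square)
  also have "2 * complex_of_real b - z = cnj z" using z by (simp add: complex_eq_iff)
  also have "z * cnj z / complex_of_real b = complex_of_real (?s\<^sup>2)"
    using b by (simp add: complex_norm_square[symmetric] power_divide)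
  finally have "heat_poly n (complex_of_real x) (2 * z - z\<^sup>2 / complex_of_real b) = complex_of_real (?s ^ n * poly (he n) (x / ?s))"
    by (simp only: heat_poly_hermite[OF s])
  moreover have "x / ?s = sqrt b / cmod z * x" by simp
  moreover have "hermite_prefactor n b z * complex_of_real (?s ^ n)
     = complex_of_real (sqrt b) / csqrt z * (complex_of_real (cmod z) / z) ^ n"
    using b by (simp add: hermite_prefactor_def power_divide divide_inverse power_inverse power_mult_distrib)
  ultimately show ?thesis
    unfolding hermite_heat1_def by (simp only: of_real_mult mult.assoc[symmetric])
qed

lemma hermite_heat_hermite:
  fixes x :: "real ^ 'n"
  assumes b: "0 < b" and z: "Re z = b"
  shows "hermite_heat m b 0 z x = (complex_of_real (sqrt b) / csqrt z) ^ CARD('n) * (complex_of_real (cmod z) / z) ^ multi_abs m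
    * hermite_multi m ((sqrt b / cmod z) *\<^sub>R x) * exp (- complex_of_real ((norm x)\<^sup>2) / (4 * z))"
proof -
  have "(\<Prod>j\<in>UNIV. exp (- complex_of_real ((x $ j)\<^sup>2) / (4 * z)))
      = exp (\<Sum>j\<in>UNIV. - complex_of_real ((x $ j)\<^sup>2) / (4 * z))"
    by (simp add: exp_sum)
  also have "(\<Sum>j\<in>UNIV. - complex_of_real ((x $ j)\<^sup>2) / (4 * z)) = - complex_of_real ((norm x)\<^sup>2) / (4 * z)"
    by (simp add: norm_vec_square sum_divide_distrib sum_negf)
  finally have e: "(\<Prod>j\<in>UNIV. exp (- complex_of_real ((x $ j)\<^sup>2) / (4 * z))) = exp (- complex_of_real ((norm x)\<^sup>2) / (4 * z))" .
  show ?thesis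
    unfolding hermite_heat_def hermite_heat1_hermite[OF b z]
    by (simp only: prod.distrib prod_constant hermite_multi_eq multi_abs_def power_sum of_real_prod
        vector_scaleR_component real_scaleR_def zero_index diff_zero e)
qed

section \<open>Uniqueness of the Schroedinger evolution\<close>

text \<open>Duality. Along \<open>b + i (T - s)\<close> the second factor runs backwards in time, so the two contributions
  to the derivative of \<open>\<integral> u(s) v(b + i (T - s))\<close> in \<open>s\<close> cancel and the pairing is the same at
  \<open>s = T\<close> and at \<open>s = 0\<close>. It expresses every solution at time \<open>T\<close> through the initial data.\<close>

lemma solution_pairing:
  assumes u: "schroedinger_solution f u" and v: "heat_solution c v" and b: "0 < b"
    and f: "f \<in> borel_measurable borel"
  shows "(\<integral>x. u T x * v (complex_of_real b) x \<partial>lborel) = (\<integral>x. f x * v (Complex b T) x \<partial>lborel)"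
proof -
  have uL: "u t \<in> L2 lborel" and uc: "((\<lambda>s. sqnorm lborel (\<lambda>x. u s x - u t x)) \<longlongrightarrow> 0) (at t)"
    and u0: "AE x in lborel. u 0 x = f x" for t
    using u unfolding schroedinger_solution_def by (auto simp: Lp_norm_2_tendsto_0_iff)
  have g: "gauss_class c v" using v by (simp add: heat_solution_def)
  \<comment> \<open>Time reversal: the test function evolves along the line downwards.\<close>
  let ?z = "\<lambda>s. Complex b (T - s)"
  have z: "0 < Re (?z s)" for s using b by simp
  have vL: "v (?z s) \<in> L2 lborel" for s by (rule gauss_class_L2[OF g z])
  define h where "h = (\<lambda>s. \<integral>x. u s x * v (?z s) x \<partial>lborel)"
  have "(h has_vector_derivative 0) (at t)" for t
    unfolding has_vector_derivative_quotient_iff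
  proof -
    obtain v' where v': "gauss_class c v'" "laplacian (v (?z t)) = v' (?z t)"
      using heat_solution_laplacian[OF v] z by metis
    have v'L: "v' (?z t) \<in> L2 lborel" by (rule gauss_class_L2[OF v'(1) z])
    let ?q = "\<lambda>\<delta> x. (v (?z (t + \<delta>)) x - v (?z t) x) / complex_of_real \<delta>"
    have shift: "?z t + - \<i> * complex_of_real \<delta> = ?z (t + \<delta>)" for \<delta>
      by (simp add: complex_eq_iff)
    have qL: "?q \<delta> \<in> L2 lborel" for \<delta>
      using L2_cmult[OF L2_diff[OF vL[of "t + \<delta>"] vL[of t]], of "1 / complex_of_real \<delta>"] by simp
    have q: "((\<lambda>\<delta>. sqnorm lborel (\<lambda>x. ?q \<delta> x - - \<i> * v' (?z t) x)) \<longlongrightarrow> 0) (at 0)"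
      using heat_solution_L2_derivative[OF v z[of t], of "- \<i>"] unfolding shift v'(2) by simp
    have uc': "((\<lambda>\<delta>. sqnorm lborel (\<lambda>x. u (t + \<delta>) x - u t x)) \<longlongrightarrow> 0) (at 0)"
      using uc[of t] unfolding at_to_0[of t] filterlim_filtermap by (simp only: add.commute[of _ t])
    have 1: "((\<lambda>\<delta>. \<integral>x. u (t + \<delta>) x * ?q \<delta> x \<partial>lborel) \<longlongrightarrow> (\<integral>x. u t x * (- \<i> * v' (?z t) x) \<partial>lborel)) (at 0)"
      by (rule L2_pairing_tendsto[OF uL qL uL L2_cmult[OF v'L] uc' q])
    have "((\<lambda>s. \<integral>x. u s x * v (?z t) x \<partial>lborel) has_vector_derivative
        \<i> * (\<integral>x. u t x * laplacian (v (?z t)) x \<partial>lborel)) (at t)"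
      using u gauss_class_schwartz[OF g z] unfolding schroedinger_solution_def by blast
    then have 2: "((\<lambda>\<delta>. ((\<integral>x. u (t + \<delta>) x * v (?z t) x \<partial>lborel) - (\<integral>x. u t x * v (?z t) x \<partial>lborel)) / complex_of_real \<delta>)
        \<longlongrightarrow> \<i> * (\<integral>x. u t x * v' (?z t) x \<partial>lborel)) (at 0)"
      unfolding has_vector_derivative_quotient_iff v'(2) .
    have eq: "(h (t + \<delta>) - h t) / complex_of_real \<delta> = (\<integral>x. u (t + \<delta>) x * ?q \<delta> x \<partial>lborel)
      + ((\<integral>x. u (t + \<delta>) x * v (?z t) x \<partial>lborel) - (\<integral>x. u t x * v (?z t) x \<partial>lborel)) / complex_of_real \<delta>" for \<delta>
    proof -
      have "(\<integral>x. u (t + \<delta>) x * ?q \<delta> x \<partial>lborel)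
        = (\<integral>x. (u (t + \<delta>) x * v (?z (t + \<delta>)) x - u (t + \<delta>) x * v (?z t) x) / complex_of_real \<delta> \<partial>lborel)"
        by (rule Bochner_Integration.integral_cong[OF refl]) (simp add: algebra_simps diff_divide_distrib)
      also have "\<dots> = ((\<integral>x. u (t + \<delta>) x * v (?z (t + \<delta>)) x \<partial>lborel) - (\<integral>x. u (t + \<delta>) x * v (?z t) x \<partial>lborel)) / complex_of_real \<delta>"
        using integrable_L2_mult[OF uL vL] by simp
      finally show ?thesis by (simp add: h_def diff_divide_distrib)
    qed
    have "(\<integral>x. u t x * (- \<i> * v' (?z t) x) \<partial>lborel) + \<i> * (\<integral>x. u t x * v' (?z t) x \<partial>lborel) = 0"
    proof -
      have "(\<integral>x. u t x * (- \<i> * v' (?z t) x) \<partial>lborel) = (\<integral>x. - \<i> * (u t x * v' (?z t) x) \<partial>lborel)"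
        by (rule Bochner_Integration.integral_cong[OF refl]) simp
      then show ?thesis by simp
    qed
    then show "((\<lambda>\<delta>. (h (t + \<delta>) - h t) / complex_of_real \<delta>) \<longlongrightarrow> 0) (at 0)"
      unfolding eq using tendsto_add[OF 1 2] by simp
  qed
  then obtain C where "\<And>s. h s = C"
    using has_vector_derivative_zero_constant[of UNIV h] by auto
  then have "h T = h 0" by simp
  moreover have "h 0 = (\<integral>x. f x * v (Complex b T) x \<partial>lborel)"
  proof -
    have m: "(\<lambda>x. u 0 x * v (Complex b T) x) \<in> borel_measurable lborel"
      using integrable_L2_mult[OF uL[of 0] vL[of 0]] by auto
    have "AE x in lborel. u 0 x * v (Complex b T) x = f x * v (Complex b T) x"
      using u0 by eventually_elim simp
    then have "(\<integral>x. f x * v (Complex b T) x \<partial>lborel) = (\<integral>x. u 0 x * v (Complex b T) x \<partial>lborel)"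
      using m f gauss_class_measurable[OF g, of "Complex b T"] b by (intro integral_cong_AE) auto
    then show ?thesis by (simp add: h_def)
  qed
  moreover have "Complex b 0 = complex_of_real b" by (simp add: complex_eq_iff)
  ultimately show ?thesis by (simp add: h_def)
qed

text \<open>Fubini: integrating the hypothesis against \<open>h\<close> over the centres \<open>y\<close> of the Gaussians gives the
  pairing of \<open>W\<close> with the convolution of \<open>h\<close> with a Gaussian of width \<open>s\<close>.\<close>

lemma gaussian_smoothing_eq_0:
  fixes W :: "real ^ 'n \<Rightarrow> complex" and h :: "real ^ 'n \<Rightarrow> real"
  assumes W: "integrable lborel W" and s: "0 < s"
    and z: "\<And>y. (\<integral>x. W x * complex_of_real (gauss_density ((1 / s) *\<^sub>R (y - x))) \<partial>lborel) = 0"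
    and h: "h \<in> borel_measurable borel" "\<And>x. \<bar>h x\<bar> \<le> B"
  shows "(\<integral>x. W x * complex_of_real (\<integral>y. h (x + s *\<^sub>R y) \<partial>gauss) \<partial>lborel) = 0"
proof -
  interpret gp: prob_space "gauss :: (real ^ 'n) measure" by (rule prob_space_gauss)
  have [measurable]: "W \<in> borel_measurable borel" "h \<in> borel_measurable borel" using W h by auto
  let ?k = "\<lambda>x y. W x * complex_of_real (gauss_density ((1 / s) *\<^sub>R (y - x)) * h y)"
  have m [measurable]: "(\<lambda>(x, y). ?k x y) \<in> borel_measurable (lborel \<Otimes>\<^sub>M lborel)"
    by measurable
  have gd: "integrable lborel (\<lambda>y. gauss_density ((1 / s) *\<^sub>R (y - x)))"
    and gdi: "(\<integral>\<^sup>+y. ennreal (gauss_density ((1 / s) *\<^sub>R (y - x))) \<partial>lborel) = ennreal (s ^ CARD('n))" for x :: "real ^ 'n"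
  proof -
    have "(\<integral>\<^sup>+y. ennreal (gauss_density ((1 / s) *\<^sub>R (y - x))) \<partial>lborel)
      = ennreal (s ^ CARD('n)) * (\<integral>\<^sup>+y. ennreal (gauss_density y) \<partial>(lborel :: (real ^ 'n) measure))"
      using s by (subst nn_integral_lborel_affine[where c = s and t = x]) auto
    also have "(\<integral>\<^sup>+y. ennreal (gauss_density y) \<partial>(lborel :: (real ^ 'n) measure)) = 1"
      using nn_integral_gauss[of "\<lambda>_ :: real ^ 'n. 1"] gp.emeasure_space_1 by simp
    finally show *: "(\<integral>\<^sup>+y. ennreal (gauss_density ((1 / s) *\<^sub>R (y - x))) \<partial>lborel) = ennreal (s ^ CARD('n))" by simp
    show "integrable lborel (\<lambda>y. gauss_density ((1 / s) *\<^sub>R (y - x)))"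
      using * by (intro integrableI_nonneg) auto
  qed
  have inner: "(\<integral>y. ?k x y \<partial>lborel) = complex_of_real (s ^ CARD('n)) * (W x * complex_of_real (\<integral>y. h (x + s *\<^sub>R y) \<partial>gauss))" for x
  proof -
    have "(\<integral>y. gauss_density ((1 / s) *\<^sub>R (y - x)) * h y \<partial>lborel)
      = s ^ CARD('n) * (\<integral>y. gauss_density y * h (x + s *\<^sub>R y) \<partial>lborel)"
      using s by (subst lborel_affine[where c = s and t = x])
        (auto simp: integral_density integral_distr)
    also have "(\<integral>y. gauss_density y * h (x + s *\<^sub>R y) \<partial>lborel) = (\<integral>y. h (x + s *\<^sub>R y) \<partial>gauss)"
      unfolding gauss_eq by (subst integral_density) auto
    finally have "complex_of_real (\<integral>y. gauss_density ((1 / s) *\<^sub>R (y - x)) * h y \<partial>lborel)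
      = complex_of_real (s ^ CARD('n) * (\<integral>y. h (x + s *\<^sub>R y) \<partial>gauss))" by simp
    moreover have "(\<integral>y. ?k x y \<partial>lborel) = W x * complex_of_real (\<integral>y. gauss_density ((1 / s) *\<^sub>R (y - x)) * h y \<partial>lborel)"
      by (simp only: integral_mult_right_zero integral_complex_of_real)
    ultimately show ?thesis by (simp only: of_real_mult mult_ac)
  qed
  have B: "0 \<le> B" using h(2)[of 0] by linarith
  have gint: "integrable lborel (\<lambda>y. gauss_density ((1 / s) *\<^sub>R (y - x)) * h y)" for x
    by (rule Bochner_Integration.integrable_bound[OF integrable_mult_left[OF gd[of x], of B]])
      (use h B in \<open>auto simp: abs_mult intro!: mult_left_mono\<close>)
  have int2: "integrable lborel (\<lambda>y. ?k x y)" for x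
    by (intro integrable_mult_right integrable_of_real gint)
  have "integrable (lborel \<Otimes>\<^sub>M lborel) (\<lambda>(x, y). ?k x y)"
  proof (rule lborel_pair.Fubini_integrable[OF m])
    have "integrable lborel (\<lambda>x. \<integral>y. cmod (?k x y) \<partial>lborel)"
    proof (rule Bochner_Integration.integrable_bound[OF integrable_mult_left[OF integrable_norm[OF W], of "s ^ CARD('n) * B"]])
      show "(\<lambda>x. \<integral>y. cmod (?k x y) \<partial>lborel) \<in> borel_measurable lborel" by measurable
      have "(\<integral>y. cmod (?k x y) \<partial>lborel) \<le> cmod (W x) * (s ^ CARD('n) * B)" for x
      proof -
        have "(\<integral>y. cmod (?k x y) \<partial>lborel) \<le> (\<integral>y. cmod (W x) * (gauss_density ((1 / s) *\<^sub>R (y - x)) * B) \<partial>lborel)"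
          using h B by (intro integral_mono integrable_norm int2 integrable_mult_right integrable_mult_left gd)
            (auto simp: norm_mult abs_mult intro!: mult_left_mono)
        also have "\<dots> = cmod (W x) * (s ^ CARD('n) * B)"
          using gdi[of x] gd[of x] s by (simp add: integral_eq_nn_integral)
        finally show ?thesis .
      qed
      then show "AE x in lborel. norm (\<integral>y. cmod (?k x y) \<partial>lborel) \<le> norm (cmod (W x) * (s ^ CARD('n) * B))"
        using s B by (intro AE_I2) (simp add: abs_mult)
    qed
    then show "integrable lborel (\<lambda>x. \<integral>y. norm (case (x, y) of (x, y) \<Rightarrow> ?k x y) \<partial>lborel)" by simp
    show "AE x in lborel. integrable lborel (\<lambda>y. case (x, y) of (x, y) \<Rightarrow> ?k x y)" using int2 by simp
  qed
  from lborel_pair.Fubini_integral[OF this]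
  have "(\<integral>x. (\<integral>y. ?k x y \<partial>lborel) \<partial>lborel) = (\<integral>y. (\<integral>x. ?k x y \<partial>lborel) \<partial>lborel)" by simp
  also have "\<dots> = 0"
  proof -
    have "(\<integral>x. ?k x y \<partial>lborel) = 0" for y
    proof -
      have "(\<integral>x. ?k x y \<partial>lborel) = (\<integral>x. (W x * complex_of_real (gauss_density ((1 / s) *\<^sub>R (y - x)))) * complex_of_real (h y) \<partial>lborel)"
        by (rule Bochner_Integration.integral_cong[OF refl]) simp
      also have "\<dots> = 0" by (simp only: integral_mult_left_zero z) simp
      finally show ?thesis .
    qed
    then show ?thesis by simp
  qed
  finally have "complex_of_real (s ^ CARD('n)) * (\<integral>x. W x * complex_of_real (\<integral>y. h (x + s *\<^sub>R y) \<partial>gauss) \<partial>lborel) = 0"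
    unfolding inner by (simp only: integral_mult_right_zero)
  then show ?thesis using s by simp
qed

text \<open>As the width tends to \<open>0\<close> the smoothed function tends to \<open>h\<close> pointwise and boundedly.\<close>

lemma integral_bounded_continuous_eq_0:
  fixes W :: "real ^ 'n \<Rightarrow> complex" and h :: "real ^ 'n \<Rightarrow> real"
  assumes W: "integrable lborel W"
    and z: "\<And>s y. 0 < s \<Longrightarrow> (\<integral>x. W x * complex_of_real (gauss_density ((1 / s) *\<^sub>R (y - x))) \<partial>lborel) = 0"
    and h: "continuous_on UNIV h" "\<And>x. \<bar>h x\<bar> \<le> B"
  shows "(\<integral>x. W x * complex_of_real (h x) \<partial>lborel) = 0"
proof -
  interpret gp: prob_space "gauss :: (real ^ 'n) measure" by (rule prob_space_gauss)
  have [measurable]: "W \<in> borel_measurable borel" "h \<in> borel_measurable borel"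
    using W h by (auto intro: borel_measurable_continuous_onI)
  let ?s = "\<lambda>n. 1 / real (Suc n)"
  let ?H = "\<lambda>n x. \<integral>y. h (x + ?s n *\<^sub>R y) \<partial>gauss"
  have B: "0 \<le> B" using h(2)[of 0] by linarith
  have lim: "(\<lambda>n. ?H n x) \<longlonglongrightarrow> h x" for x
  proof -
    have "(\<lambda>n. ?H n x) \<longlonglongrightarrow> (\<integral>y. h x \<partial>(gauss :: (real ^ 'n) measure))"
    proof (rule integral_dominated_convergence[where w = "\<lambda>_. B"])
      show "AE y in gauss. (\<lambda>n. h (x + ?s n *\<^sub>R y)) \<longlonglongrightarrow> h x"
      proof (intro AE_I2)
        fix y :: "real ^ 'n"
        have "(\<lambda>n. x + ?s n *\<^sub>R y) \<longlonglongrightarrow> x + 0 *\<^sub>R y"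
          using LIMSEQ_inverse_real_of_nat by (intro tendsto_intros) (simp add: inverse_eq_divide)
        then show "(\<lambda>n. h (x + ?s n *\<^sub>R y)) \<longlonglongrightarrow> h x"
          using h(1) by (intro isCont_tendsto_compose[of x h]) (auto simp: continuous_on_eq_continuous_at)
      qed
    qed (use h in auto)
    then show ?thesis using gp.prob_space by simp
  qed
  have Hb: "\<bar>?H n x\<bar> \<le> B" for n x
  proof -
    have "\<bar>?H n x\<bar> \<le> (\<integral>y. B \<partial>(gauss :: (real ^ 'n) measure))"
      using h B by (intro order_trans[OF integral_abs_bound] integral_mono gp.integrable_const_bound[where B = B]) (auto intro!: AE_I2)
    then show ?thesis using gp.prob_space by simp
  qed
  have "(\<lambda>n. \<integral>x. W x * complex_of_real (?H n x) \<partial>lborel) \<longlonglongrightarrow> (\<integral>x. W x * complex_of_real (h x) \<partial>lborel)"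
  proof (rule integral_dominated_convergence[where w = "\<lambda>x. cmod (W x) * B"])
    show "AE x in lborel. (\<lambda>n. W x * complex_of_real (?H n x)) \<longlonglongrightarrow> W x * complex_of_real (h x)"
      by (intro AE_I2 tendsto_intros lim)
    show "AE x in lborel. cmod (W x * complex_of_real (?H n x)) \<le> cmod (W x) * B" for n
      using Hb by (intro AE_I2) (auto simp: norm_mult intro!: mult_left_mono)
    show "integrable lborel (\<lambda>x. cmod (W x) * B)" using W by auto
    have [measurable]: "(\<lambda>x. ?H n x) \<in> borel_measurable borel" for n
      by (rule gp.borel_measurable_lebesgue_integral) measurable
    show "(\<lambda>x. W x * complex_of_real (?H n x)) \<in> borel_measurable lborel" for n by measurable
  qed simp
  moreover have "(\<integral>x. W x * complex_of_real (?H n x) \<partial>lborel) = 0" for n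
    by (rule gaussian_smoothing_eq_0[OF W _ z, where B = B]) (use h in auto)
  ultimately show ?thesis by (simp add: LIMSEQ_const_iff)
qed

text \<open>The indicator of an open set is an increasing limit of the continuous functions
  \<open>min 1 (n \<cdot> dist(x, - U))\<close>, and the open sets are an intersection-stable generator of the Borel sets.\<close>

lemma AE_zero_of_bounded_continuous:
  fixes W :: "real ^ 'n \<Rightarrow> complex"
  assumes W: "integrable lborel W"
    and z: "\<And>h B. continuous_on UNIV h \<Longrightarrow> (\<And>x. \<bar>h x\<bar> \<le> B) \<Longrightarrow> (\<integral>x. W x * complex_of_real (h x) \<partial>lborel) = 0"
  shows "AE x in lborel. W x = 0"
proof -
  have [measurable]: "W \<in> borel_measurable borel" using W by auto
  have all: "(\<integral>x. W x * indicator UNIV x \<partial>lborel) = 0" using z[of "\<lambda>_. 1" 1] by simp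
  have op: "(\<integral>x. W x * indicator U x \<partial>lborel) = 0" if "open U" for U
  proof (cases "U = UNIV")
    case False
    let ?h = "\<lambda>n x. min 1 (real n * infdist x (- U))"
    have "(\<lambda>n. \<integral>x. W x * complex_of_real (?h n x) \<partial>lborel) \<longlonglongrightarrow> (\<integral>x. W x * indicator U x \<partial>lborel)"
    proof (rule integral_dominated_convergence[where w = "\<lambda>x. cmod (W x)"])
      have "(\<lambda>n. ?h n x) \<longlonglongrightarrow> indicator U x" for x
      proof (cases "x \<in> U")
        case True
        then have "infdist x (- U) \<noteq> 0"
          using False \<open>open U\<close> in_closed_iff_infdist_zero[of "- U" x] by (auto simp: closed_Compl)
        then have pos: "0 < infdist x (- U)" using infdist_nonneg[of x "- U"] by linarith
        obtain N where N: "1 / infdist x (- U) < real N" using reals_Archimedean2 by blast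
        have "?h n x = 1" if "N \<le> n" for n
        proof -
          have "1 / infdist x (- U) < real n" using N that by (meson le_less_trans less_le_trans of_nat_le_iff not_le)
          then show ?thesis using pos by (simp add: field_simps min_def)
        qed
        then have "eventually (\<lambda>n. ?h n x = 1) sequentially" by (auto simp: eventually_sequentially)
        then show ?thesis using True by (simp add: tendsto_eventually)
      next
        case False
        then show ?thesis by simp
      qed
      then have "(\<lambda>n. W x * complex_of_real (?h n x)) \<longlonglongrightarrow> W x * complex_of_real (indicator U x)" for x
        by (intro tendsto_intros)
      then show "AE x in lborel. (\<lambda>n. W x * complex_of_real (?h n x)) \<longlonglongrightarrow> W x * indicator U x"
        by (intro AE_I2) (simp add: of_real_indicator)
      have "\<bar>?h n x\<bar> \<le> 1" for n x using infdist_nonneg[of x "- U"] by (simp add: min_def abs_mult)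
      then show "AE x in lborel. cmod (W x * complex_of_real (?h n x)) \<le> cmod (W x)" for n
        by (intro AE_I2) (simp only: norm_mult norm_of_real mult_left_le norm_ge_zero)
      show "integrable lborel (\<lambda>x. cmod (W x))" using W by auto
      show "(\<lambda>x. W x * complex_of_real (?h n x)) \<in> borel_measurable lborel" for n
        by (intro borel_measurable_times borel_measurable_of_real) (auto intro!: borel_measurable_continuous_onI continuous_intros)
    qed (use \<open>open U\<close> in auto)
    moreover have "(\<integral>x. W x * complex_of_real (?h n x) \<partial>lborel) = 0" for n
    proof (rule z[where B = 1])
      show "continuous_on UNIV (?h n)" by (intro continuous_intros)
      show "\<bar>?h n x\<bar> \<le> 1" for x using infdist_nonneg[of x "- U"] by (simp add: min_def abs_mult)
    qed
    ultimately show ?thesis by (simp add: LIMSEQ_const_iff)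
  qed (use all in simp)
  have int: "integrable lborel (\<lambda>x. W x * indicator A x)" if "A \<in> sets borel" for A
    using integrable_real_mult_indicator[of A lborel] that W
    by (auto simp: mult.commute[of _ "indicator A _"] indicator_scaleR_eq_if intro!: Bochner_Integration.integrable_bound[OF W] split: split_indicator)
  have sets: "(\<integral>x. W x * indicator A x \<partial>lborel) = 0" if "A \<in> sets borel" for A
  proof -
    have "A \<in> sigma_sets UNIV {U. open U}" using that by (simp add: borel_def)
    have "Int_stable {U :: (real ^ 'n) set. open U}" by (auto simp: Int_stable_def)
    moreover have "{U :: (real ^ 'n) set. open U} \<subseteq> Pow UNIV" by simp
    ultimately show ?thesis
      using \<open>A \<in> sigma_sets UNIV {U. open U}\<close>
    proof (induction rule: sigma_sets_induct_disjoint)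
      case (compl A)
      then have A: "A \<in> sets borel" by (simp add: borel_def)
      have "(\<integral>x. W x * indicator (UNIV - A) x \<partial>lborel) = (\<integral>x. W x * indicator UNIV x - W x * indicator A x \<partial>lborel)"
        by (rule Bochner_Integration.integral_cong[OF refl]) (auto split: split_indicator)
      also have "\<dots> = 0" using int[OF A] int[of UNIV] compl all by (subst Bochner_Integration.integral_diff) auto
      finally show ?case .
    next
      case (union A)
      then have A: "A i \<in> sets borel" for i by (auto simp: borel_def)
      have c: "(\<integral>x. W x * indicator X x \<partial>lborel) = (LINT x:X|lborel. W x)" for X
        unfolding set_lebesgue_integral_def by (rule Bochner_Integration.integral_cong[OF refl]) (auto split: split_indicator)
      have "(LINT x:(\<Union>i. A i)|lborel. W x) = (\<Sum>i. LINT x:A i|lborel. W x)"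
        using A union(1) W unfolding disjoint_family_on_def
        by (intro lebesgue_integral_countable_add) (auto simp: set_integrable_def intro!: integrable_mult_indicator)
      then show ?case using union by (simp add: c)
    qed (use op in auto)
  qed
  have "AE x in lborel. F (W x) = 0" if F: "F = Re \<or> F = Im" for F
  proof (rule density_unique_real)
    show "integrable lborel (\<lambda>x. F (W x))" using F W by auto
    fix A :: "(real ^ 'n) set" assume A: "A \<in> sets lborel"
    have "(LINT x:A|lborel. F (W x)) = (\<integral>x. F (W x * indicator A x) \<partial>lborel)"
      unfolding set_lebesgue_integral_def using F by (intro Bochner_Integration.integral_cong[OF refl]) (auto split: split_indicator)
    also have "\<dots> = F (\<integral>x. W x * indicator A x \<partial>lborel)"
    proof -
      have i: "integrable lborel (\<lambda>x. W x * indicator A x)" using A by (intro int) simp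
      show ?thesis using F by (elim disjE) (simp_all only: integral_Re[OF i] integral_Im[OF i])
    qed
    also have "\<dots> = 0" using sets[of A] A F by auto
    finally show "(LINT x:A|lborel. F (W x)) = (LINT x:A|lborel. 0)" by simp
  qed simp
  from this[of Re] this[of Im] show ?thesis by (auto simp: complex_eq_iff)
qed

text \<open>Completing the square.\<close>

lemma gaussian_product:
  fixes x y :: "'a::real_inner"
  assumes "0 < k"
  shows "exp (- (norm x)\<^sup>2) * exp (- k * (norm (x - y))\<^sup>2)
    = exp (- (k * (norm y)\<^sup>2 - k\<^sup>2 / (1 + k) * (norm y)\<^sup>2)) * exp (- (1 + k) * (norm (x - (k / (1 + k)) *\<^sub>R y))\<^sup>2)"
proof -
  have e: "(norm (x - a *\<^sub>R y))\<^sup>2 = (norm x)\<^sup>2 - 2 * a * (x \<bullet> y) + a\<^sup>2 * (norm y)\<^sup>2" for a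
    unfolding power2_norm_eq_inner
    by (simp add: inner_diff_left inner_diff_right inner_commute power2_eq_square algebra_simps)
  have a: "(1 + k) * (k / (1 + k))\<^sup>2 = k\<^sup>2 / (1 + k)" "(1 + k) * (k / (1 + k)) = k"
    using assms by (simp_all add: power2_eq_square divide_simps)
  have "(1 + k) * (norm (x - (k / (1 + k)) *\<^sub>R y))\<^sup>2
     = (1 + k) * (norm x)\<^sup>2 - 2 * ((1 + k) * (k / (1 + k))) * (x \<bullet> y) + ((1 + k) * (k / (1 + k))\<^sup>2) * (norm y)\<^sup>2"
    unfolding e by (simp only: algebra_simps)
  also have "\<dots> = (1 + k) * (norm x)\<^sup>2 - 2 * k * (x \<bullet> y) + k\<^sup>2 / (1 + k) * (norm y)\<^sup>2"
    by (simp only: a)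
  finally have e2: "(1 + k) * (norm (x - (k / (1 + k)) *\<^sub>R y))\<^sup>2 = (1 + k) * (norm x)\<^sup>2 - 2 * k * (x \<bullet> y) + k\<^sup>2 / (1 + k) * (norm y)\<^sup>2" .
  have e1: "k * (norm (x - y))\<^sup>2 = k * (norm x)\<^sup>2 - 2 * k * (x \<bullet> y) + k * (norm y)\<^sup>2"
  proof -
    have "(norm (x - y))\<^sup>2 = (norm x)\<^sup>2 - 2 * (x \<bullet> y) + (norm y)\<^sup>2" using e[of 1] by simp
    then show ?thesis by (simp only:) (simp add: algebra_simps)
  qed
  have "- (norm x)\<^sup>2 + - k * (norm (x - y))\<^sup>2
    = - (k * (norm y)\<^sup>2 - k\<^sup>2 / (1 + k) * (norm y)\<^sup>2) + - (1 + k) * (norm (x - (k / (1 + k)) *\<^sub>R y))\<^sup>2"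
    unfolding mult_minus_left e1 e2 by (simp add: algebra_simps)
  then show ?thesis by (simp only: exp_add[symmetric])
qed

text \<open>A square integrable function need not be integrable. Multiplying \<open>w\<close> by \<open>exp (- \<parallel>x\<parallel>\<^sup>2)\<close> makes it so,
  and a product of Gaussians is again a Gaussian, so the hypothesis survives.\<close>

lemma AE_zero_of_gaussians:
  fixes w :: "real ^ 'n \<Rightarrow> complex"
  assumes w: "w \<in> L2 lborel"
    and z: "\<And>b c. 0 < b \<Longrightarrow> (\<integral>x. w x * complex_of_real (exp (- b * (norm (x - c))\<^sup>2)) \<partial>lborel) = 0"
  shows "AE x in lborel. w x = 0"
proof -
  have [measurable]: "w \<in> borel_measurable borel" using L2_measurable[OF w] by simp
  let ?W = "\<lambda>x. w x * complex_of_real (exp (- (norm x)\<^sup>2))"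
  have "(\<lambda>x. complex_of_real (exp (- (norm x)\<^sup>2))) \<in> L2 (lborel :: (real ^ 'n) measure)"
  proof -
    have "sqnorm lborel (\<lambda>x :: real ^ 'n. complex_of_real (exp (- (norm x)\<^sup>2)))
        = (\<integral>\<^sup>+x. ennreal (exp (- 2 * (norm (x - 0))\<^sup>2)) \<partial>(lborel :: (real ^ 'n) measure))"
      unfolding sqnorm_def by (intro nn_integral_cong) (simp add: exp_double[symmetric])
    then show ?thesis using nn_integral_lborel_gaussian_finite[of 2 "0 :: real ^ 'n"] by (simp add: L2_iff)
  qed
  then have W: "integrable lborel ?W" by (rule integrable_L2_mult[OF w])
  have "AE x in lborel. ?W x = 0"
  proof (rule AE_zero_of_bounded_continuous[OF W], rule integral_bounded_continuous_eq_0[OF W])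
    fix s :: real and y :: "real ^ 'n" assume s: "0 < s"
    let ?k = "1 / (2 * s\<^sup>2)"
    let ?K = "(2 * pi) powr (- real CARD('n) / 2) * exp (- (?k * (norm y)\<^sup>2 - ?k\<^sup>2 / (1 + ?k) * (norm y)\<^sup>2))"
    have "exp (- (norm x)\<^sup>2) * gauss_density ((1 / s) *\<^sub>R (y - x))
      = ?K * exp (- (1 + ?k) * (norm (x - (?k / (1 + ?k)) *\<^sub>R y))\<^sup>2)" for x
    proof -
      have "gauss_density ((1 / s) *\<^sub>R (y - x)) = (2 * pi) powr (- real CARD('n) / 2) * exp (- ?k * (norm (x - y))\<^sup>2)"
        using s by (simp add: gauss_density_def norm_minus_commute power_divide)
      then show ?thesis using gaussian_product[of ?k x y] s by (simp only: mult_ac) simp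
    qed
    then have "?W x * complex_of_real (gauss_density ((1 / s) *\<^sub>R (y - x)))
      = complex_of_real ?K * (w x * complex_of_real (exp (- (1 + ?k) * (norm (x - (?k / (1 + ?k)) *\<^sub>R y))\<^sup>2)))" for x
      by (simp only: mult.assoc of_real_mult[symmetric] mult.left_commute[of _ "w x"])
    then have "(\<integral>x. ?W x * complex_of_real (gauss_density ((1 / s) *\<^sub>R (y - x))) \<partial>lborel)
      = complex_of_real ?K * (\<integral>x. w x * complex_of_real (exp (- (1 + ?k) * (norm (x - (?k / (1 + ?k)) *\<^sub>R y))\<^sup>2)) \<partial>lborel)"
      by (simp only: integral_mult_right_zero)
    also have "\<dots> = 0" using s by (subst z) (auto intro: add_pos_nonneg)
    finally show "(\<integral>x. ?W x * complex_of_real (gauss_density ((1 / s) *\<^sub>R (y - x))) \<partial>lborel) = 0" .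
  qed auto
  then show ?thesis by eventually_elim simp
qed

text \<open>By duality two solutions with the same initial data have at time \<open>T\<close> the same pairing with every
  Gaussian, since each Gaussian is the value at \<open>z = b\<close> of a heat solution of order \<open>0\<close>.\<close>

lemma schroedinger_solution_unique:
  fixes f :: "real ^ 'n \<Rightarrow> complex"
  assumes u: "schroedinger_solution f u" and v: "schroedinger_solution f v"
    and f: "f \<in> borel_measurable borel"
  shows "AE x in lborel. u T x = v T x"
proof -
  have uL: "u T \<in> L2 lborel" "v T \<in> L2 lborel"
    using u v by (auto simp: schroedinger_solution_def)
  have "AE x in lborel. u T x - v T x = 0"
  proof (rule AE_zero_of_gaussians)
    show "(\<lambda>x. u T x - v T x) \<in> L2 lborel" by (intro L2_diff uL)
    fix k :: real and c :: "real ^ 'n" assume k: "0 < k"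
    \<comment> \<open>At \<open>z = 1 / (4k)\<close> the Gaussian of the heat solution has exponent \<open>- k \<parallel>x - c\<parallel>\<^sup>2\<close>.\<close>
    let ?b = "1 / (4 * k)"
    let ?w = "hermite_heat 0 ?b c"
    have b: "0 < ?b" using k by simp
    have w: "heat_solution c ?w" by (rule heat_solution_hermite_heat[OF b])
    have wL: "?w (complex_of_real ?b) \<in> L2 lborel"
      by (rule gauss_class_L2[of c]) (use w b in \<open>auto simp: heat_solution_def\<close>)
    define K where "K = (\<Prod>j\<in>(UNIV :: 'n set). hermite_prefactor 0 ?b (complex_of_real ?b))"
    have K: "K \<noteq> 0" using k by (auto simp: K_def hermite_prefactor_def)
    have we: "?w (complex_of_real ?b) x = K * complex_of_real (exp (- k * (norm (x - c))\<^sup>2))" for x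
    proof -
      have "exp (- complex_of_real ((norm (x - c))\<^sup>2) / (4 * complex_of_real ?b)) = exp (complex_of_real (- k * (norm (x - c))\<^sup>2))"
        using k by (intro arg_cong[where f = exp]) simp
      then show ?thesis unfolding hermite_heat_eq K_def by (simp only: exp_of_real) simp
    qed
    have "(\<integral>x. (u T x - v T x) * ?w (complex_of_real ?b) x \<partial>lborel)
      = (\<integral>x. u T x * ?w (complex_of_real ?b) x \<partial>lborel) - (\<integral>x. v T x * ?w (complex_of_real ?b) x \<partial>lborel)"
      using integrable_L2_mult[OF uL(1) wL] integrable_L2_mult[OF uL(2) wL]
      by (simp only: left_diff_distrib Bochner_Integration.integral_diff)
    also have "\<dots> = 0" by (simp only: solution_pairing[OF u w b f] solution_pairing[OF v w b f] diff_self)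
    finally have "K * (\<integral>x. (u T x - v T x) * complex_of_real (exp (- k * (norm (x - c))\<^sup>2)) \<partial>lborel) = 0"
      unfolding we by (simp only: mult.left_commute[of _ K] integral_mult_right_zero)
    then show "(\<integral>x. (u T x - v T x) * complex_of_real (exp (- k * (norm (x - c))\<^sup>2)) \<partial>lborel) = 0"
      using K by simp
  qed
  then show ?thesis by eventually_elim simp
qed

section \<open>Superposition of heat solutions\<close>

lemma laplacian_lincomb:
  assumes v: "gauss_class c v" and w: "gauss_class c w" and z: "0 < Re z"
  shows "laplacian (\<lambda>x. a * v z x + w z x) x = a * laplacian (v z) x + laplacian (w z) x"
proof -
  have lin: "partial i (\<lambda>x. a * v z x + w z x) = (\<lambda>x. a * partial i (v z) x + partial i (w z) x)"
    if v: "gauss_class c v" and w: "gauss_class c w" for v w i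
  proof
    fix x
    have "(v z has_derivative frechet_derivative (v z) (at x)) (at x)" "(w z has_derivative frechet_derivative (w z) (at x)) (at x)"
      using gauss_class_differentiable[OF v z] gauss_class_differentiable[OF w z] by (simp_all add: frechet_derivative_works)
    then have "((\<lambda>x. a * v z x + w z x) has_derivative
        (\<lambda>h. a * frechet_derivative (v z) (at x) h + frechet_derivative (w z) (at x) h)) (at x)"
      by (intro has_derivative_add has_derivative_mult_right)
    then show "partial i (\<lambda>x. a * v z x + w z x) x = a * partial i (v z) x + partial i (w z) x"
      by (rule partial_eqI) (simp add: partial_def)
  qed
  have "partial i (partial i (\<lambda>x. a * v z x + w z x)) = (\<lambda>x. a * partial i (partial i (v z)) x + partial i (partial i (w z)) x)" for i
  proof -
    obtain v' w' where "gauss_class c v'" "partial i (v z) = v' z" "gauss_class c w'" "partial i (w z) = w' z"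
      using gauss_class_partial[OF v] gauss_class_partial[OF w] z by metis
    then show ?thesis using lin[of v' w' i] lin[OF v w, of i] by simp
  qed
  then show ?thesis by (simp add: laplacian_def sum.distrib sum_distrib_left)
qed

text \<open>Finite superpositions of the Hermite solutions approximate the solution for general data.\<close>

lemma heat_solution_lincomb:
  assumes v: "heat_solution c v" and w: "heat_solution c w"
  shows "heat_solution c (\<lambda>z x. a * v z x + w z x)"
proof -
  have g: "gauss_class c v" "gauss_class c w" using v w by (auto simp: heat_solution_def)
  show ?thesis
    unfolding heat_solution_def
  proof (intro conjI allI impI gauss_class.add gauss_class_cmult g)
    fix z x assume z: "0 < Re z"
    show "((\<lambda>z. a * v z x + w z x) has_field_derivative laplacian (\<lambda>x. a * v z x + w z x) x) (at z)"
      unfolding laplacian_lincomb[OF g z] using v w z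
      by (intro DERIV_add DERIV_cmult) (auto simp: heat_solution_def)
  qed
qed

lemma heat_solution_zero: "heat_solution (c :: real ^ 'n) (\<lambda>z x. 0)"
proof -
  have "partial i (\<lambda>x :: real ^ 'n. 0) = (\<lambda>x. 0)" for i :: "'n :: finite"
    by (rule ext, rule partial_eqI[OF has_derivative_const]) simp
  then show ?thesis by (simp add: heat_solution_def gauss_class_zero laplacian_def)
qed

lemma heat_solution_sum:
  "finite I \<Longrightarrow> (\<And>i. i \<in> I \<Longrightarrow> heat_solution c (v i)) \<Longrightarrow> heat_solution c (\<lambda>z x. \<Sum>i\<in>I. a i * v i z x)"
  by (induction I rule: finite_induct) (auto intro: heat_solution_zero heat_solution_lincomb)

section \<open>Square integrability of Schwartz functions\<close>

lemma integrable_inverse_1_plus_square_lborel: "integrable lborel (\<lambda>x :: real. inverse (1 + x\<^sup>2))"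
  using integrable_inverse_1_plus_square by (simp add: set_integrable_def einterval_def)

text \<open>The product of the one-dimensional functions \<open>1 / (1 + x\<^sub>i\<^sup>2)\<close> is integrable, and its inverse is at most
  \<open>(1 + \<parallel>x\<parallel>\<^sup>2)\<^sup>n \<le> 2\<^sup>n (1 + \<parallel>x\<parallel>\<^bsup>2n\<^esup>)\<close> in dimension \<open>n\<close>.\<close>

lemma schwartz_L2:
  fixes \<phi> :: "real ^ 'n \<Rightarrow> complex"
  assumes "schwartz \<phi>"
  shows "\<phi> \<in> L2 lborel"
proof -
  have dec: "\<exists>B. \<forall>x. norm x ^ k * cmod (\<phi> x) \<le> B" for k :: nat
  proof -
    have "bounded (range (\<lambda>x. (norm x ^ k) *\<^sub>R foldr partial [] \<phi> x))"
      using assms unfolding schwartz_def by blast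
    then show ?thesis by (auto simp: bounded_iff)
  qed
  let ?d = "CARD('n)"
  obtain B0 where B0: "\<And>x. cmod (\<phi> x) \<le> B0" using dec[of 0] by auto
  obtain B1 where B1: "\<And>x. norm x ^ ?d * cmod (\<phi> x) \<le> B1" using dec[of ?d] by auto
  let ?P = "\<lambda>x :: real ^ 'n. \<Prod>i\<in>UNIV. inverse (1 + (x $ i)\<^sup>2)"
  let ?C = "2 ^ ?d * (B0\<^sup>2 + B1\<^sup>2)"
  have "(cmod (\<phi> x))\<^sup>2 \<le> ?C * ?P x" for x
  proof -
    have Q: "0 < (\<Prod>i\<in>UNIV. 1 + (x $ i)\<^sup>2)" by (intro prod_pos) (auto intro: add_pos_nonneg)
    have "(\<Prod>i\<in>UNIV. 1 + (x $ i)\<^sup>2) \<le> (\<Prod>i\<in>(UNIV :: 'n set). 1 + (norm x)\<^sup>2)"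
      using component_le_norm_cart[of x] by (intro prod_mono) (auto simp: abs_le_square_iff[symmetric])
    also have "\<dots> = (1 + (norm x)\<^sup>2) ^ ?d" by simp
    also have "\<dots> \<le> 2 ^ ?d * (1 + ((norm x)\<^sup>2) ^ ?d)"
    proof -
      have "(1 + a) ^ n \<le> 2 ^ n * (1 + a ^ n)" if "0 \<le> a" for a :: real and n
      proof (cases "a \<le> 1")
        case True
        then have "(1 + a) ^ n \<le> 2 ^ n" using that by (intro power_mono) auto
        also have "\<dots> \<le> 2 ^ n * (1 + a ^ n)" using that by simp
        finally show ?thesis .
      next
        case False
        then have "(1 + a) ^ n \<le> (2 * a) ^ n" using that by (intro power_mono) auto
        also have "\<dots> \<le> 2 ^ n * (1 + a ^ n)" by (simp add: power_mult_distrib)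
        finally show ?thesis .
      qed
      then show ?thesis by simp
    qed
    finally have "(\<Prod>i\<in>UNIV. 1 + (x $ i)\<^sup>2) * (cmod (\<phi> x))\<^sup>2 \<le> 2 ^ ?d * (1 + ((norm x)\<^sup>2) ^ ?d) * (cmod (\<phi> x))\<^sup>2"
      by (rule mult_right_mono) simp
    also have "\<dots> = 2 ^ ?d * ((cmod (\<phi> x))\<^sup>2 + (norm x ^ ?d * cmod (\<phi> x))\<^sup>2)"
      by (simp add: power_mult_distrib algebra_simps power_mult[symmetric] mult.commute)
    also have "\<dots> \<le> ?C"
      using B0[of x] B1[of x] by (intro mult_left_mono add_mono power_mono) auto
    finally have "(\<Prod>i\<in>UNIV. 1 + (x $ i)\<^sup>2) * (cmod (\<phi> x))\<^sup>2 \<le> ?C" .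
    moreover have "?P x = inverse (\<Prod>i\<in>UNIV. 1 + (x $ i)\<^sup>2)" by (simp add: prod_inversef[symmetric] o_def)
    ultimately show ?thesis using Q by (simp add: field_simps)
  qed
  then have le: "norm ((cmod (\<phi> x))\<^sup>2) \<le> norm (?C * ?P x)" for x
    using order_trans[OF _ abs_ge_self] by (metis abs_power2 real_norm_def)
  have "integrable lborel (\<lambda>x. ?C * ?P x)"
    by (intro integrable_mult_right integrable_lborel_vec_prod integrable_inverse_1_plus_square_lborel)
  then have "integrable lborel (\<lambda>x. (cmod (\<phi> x))\<^sup>2)"
    using schwartz_measurable[OF assms] le by (intro Bochner_Integration.integrable_bound[OF _ _ AE_I2[OF le]]) auto
  then show ?thesis using schwartz_measurable[OF assms] by (simp add: L2_def)
qed

lemma schwartz_laplacian_L2: "schwartz \<phi> \<Longrightarrow> laplacian \<phi> \<in> L2 lborel"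
  unfolding laplacian_def[abs_def] by (intro L2_finite_sum schwartz_L2 schwartz_partial)

section \<open>Existence of the Schroedinger evolution\<close>

text \<open>The approximation has to be uniform in time: then the pairings with a test function and their time
  derivatives converge uniformly, and the limit may be differentiated.\<close>

lemma schroedinger_solution_limit:
  fixes u :: "real \<Rightarrow> real ^ 'n \<Rightarrow> complex"
  assumes u: "\<And>t. u t \<in> L2 lborel" and b: "0 < b" and v: "\<And>k :: nat. heat_solution c (v k)"
    and close: "\<And>k t. sqnorm lborel (\<lambda>x. u t x - v k (Complex b t) x) \<le> e k" and e: "e \<longlonglongrightarrow> 0"
    and u0: "AE x in lborel. u 0 x = f x"
  shows "schroedinger_solution f u"
  unfolding schroedinger_solution_def Lp_norm_2_tendsto_0_iff
proof (intro conjI allI impI u u0)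
  have g: "gauss_class c (v k)" for k using v by (simp add: heat_solution_def)
  have vL: "v k (Complex b t) \<in> L2 lborel" for k t by (rule gauss_class_L2[OF g]) (use b in simp)
  have m [measurable]: "u t \<in> borel_measurable borel" "v k (Complex b t) \<in> borel_measurable borel" for k t
    using L2_measurable[OF u] L2_measurable[OF vL] by simp_all
  fix t
  show "((\<lambda>s. sqnorm lborel (\<lambda>x. u s x - u t x)) \<longlongrightarrow> 0) (at t)"
  proof (rule order_tendstoI)
    fix r :: ennreal assume r: "0 < r"
    have "(\<lambda>k. 6 * e k) \<longlonglongrightarrow> 0" using ennreal_tendsto_cmult[of 6 e 0] e by simp
    then obtain k where k: "6 * e k < r"
      using order_tendstoD(2)[of "\<lambda>k. 6 * e k" 0 sequentially r] r by (auto simp: eventually_sequentially)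
    have "((\<lambda>s. 6 * e k + 4 * sqnorm lborel (\<lambda>x. v k (Complex b s) x - v k (Complex b t) x)) \<longlongrightarrow> 6 * e k + 4 * 0) (at t)"
      by (intro tendsto_add tendsto_const ennreal_tendsto_cmult heat_solution_L2_continuous[OF v b]) auto
    then have "eventually (\<lambda>s. 6 * e k + 4 * sqnorm lborel (\<lambda>x. v k (Complex b s) x - v k (Complex b t) x) < r) (at t)"
      using k by (intro order_tendstoD(2)) auto
    then show "eventually (\<lambda>s. sqnorm lborel (\<lambda>x. u s x - u t x) < r) (at t)"
    proof eventually_elim
      case (elim s)
      let ?D = "sqnorm lborel (\<lambda>x. v k (Complex b s) x - v k (Complex b t) x)"
      have "sqnorm lborel (\<lambda>x. u s x - u t x) \<le> 2 * sqnorm lborel (\<lambda>x. u s x - v k (Complex b s) x)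
          + 2 * sqnorm lborel (\<lambda>x. v k (Complex b s) x - u t x)"
        by (rule sqnorm_diff_le) auto
      also have "\<dots> \<le> 2 * e k + 2 * (2 * ?D + 2 * e k)"
      proof (intro add_mono mult_left_mono close)
        have "sqnorm lborel (\<lambda>x. v k (Complex b s) x - u t x) \<le> 2 * ?D + 2 * sqnorm lborel (\<lambda>x. v k (Complex b t) x - u t x)"
          by (rule sqnorm_diff_le) auto
        also have "\<dots> \<le> 2 * ?D + 2 * e k"
          unfolding sqnorm_minus_commute[of lborel "v k (Complex b t)"] by (intro add_mono mult_left_mono close) auto
        finally show "sqnorm lborel (\<lambda>x. v k (Complex b s) x - u t x) \<le> 2 * ?D + 2 * e k" .
      qed auto
      also have "\<dots> = 6 * e k + 4 * ?D"
      proof -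
        have "2 * a + 2 * (2 * d + 2 * a) = 6 * a + 4 * d" for a d :: ennreal
          by (simp add: distrib_left mult.assoc[symmetric] add.commute add.left_commute distrib_right[symmetric])
        then show ?thesis .
      qed
      finally show ?case using elim by simp
    qed
  qed auto
next
  have g: "gauss_class c (v k)" for k using v by (simp add: heat_solution_def)
  have vL: "v k (Complex b t) \<in> L2 lborel" for k t by (rule gauss_class_L2[OF g]) (use b in simp)
  fix \<phi> :: "real ^ 'n \<Rightarrow> complex" and t assume \<phi>: "schwartz \<phi>"
  note \<phi>L = schwartz_L2[OF \<phi>] and lL = schwartz_laplacian_L2[OF \<phi>]
  let ?F = "\<lambda>k s. \<integral>x. v k (Complex b s) x * \<phi> x \<partial>lborel"
  let ?F' = "\<lambda>k s. \<i> * (\<integral>x. v k (Complex b s) x * laplacian \<phi> x \<partial>lborel)"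
  let ?G = "\<lambda>s. \<integral>x. u s x * \<phi> x \<partial>lborel"
  let ?G' = "\<lambda>s. \<i> * (\<integral>x. u s x * laplacian \<phi> x \<partial>lborel)"
  have pair: "ennreal ((cmod ((\<integral>x. v k (Complex b s) x * \<psi> x \<partial>lborel) - (\<integral>x. u s x * \<psi> x \<partial>lborel)))\<^sup>2) \<le> sqnorm lborel \<psi> * e k"
    if "\<psi> \<in> L2 lborel" for \<psi> k s
  proof -
    have "(\<integral>x. v k (Complex b s) x * \<psi> x \<partial>lborel) - (\<integral>x. u s x * \<psi> x \<partial>lborel) = (\<integral>x. (v k (Complex b s) x - u s x) * \<psi> x \<partial>lborel)"
      using integrable_L2_mult[OF vL that] integrable_L2_mult[OF u that]
      by (simp only: left_diff_distrib Bochner_Integration.integral_diff)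
    then have "ennreal ((cmod ((\<integral>x. v k (Complex b s) x * \<psi> x \<partial>lborel) - (\<integral>x. u s x * \<psi> x \<partial>lborel)))\<^sup>2)
      \<le> sqnorm lborel (\<lambda>x. v k (Complex b s) x - u s x) * sqnorm lborel \<psi>"
      using integral_mult_le_sqnorm[OF L2_diff[OF vL u] that] by simp
    also have "\<dots> \<le> e k * sqnorm lborel \<psi>"
      unfolding sqnorm_minus_commute[of lborel "v k (Complex b s)"] by (intro mult_right_mono close) auto
    finally show ?thesis by (simp add: mult.commute)
  qed
  \<comment> \<open>Cauchy-Schwarz bounds the error of a pairing uniformly in \<open>s\<close>.\<close>
  have small: "eventually (\<lambda>k. \<forall>s. cmod ((\<integral>x. v k (Complex b s) x * \<psi> x \<partial>lborel) - (\<integral>x. u s x * \<psi> x \<partial>lborel)) \<le> r) sequentially"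
    if \<psi>: "\<psi> \<in> L2 lborel" and r: "0 < r" for \<psi> r
  proof -
    have "(\<lambda>k. sqnorm lborel \<psi> * e k) \<longlonglongrightarrow> 0"
      using ennreal_tendsto_cmult[of "sqnorm lborel \<psi>" e 0] e L2_finite[OF \<psi>] by simp
    then have "eventually (\<lambda>k. sqnorm lborel \<psi> * e k < ennreal (r\<^sup>2)) sequentially"
      using r by (intro order_tendstoD(2)) auto
    then show ?thesis
    proof eventually_elim
      case (elim k)
      show ?case
      proof
        fix s
        let ?a = "cmod ((\<integral>x. v k (Complex b s) x * \<psi> x \<partial>lborel) - (\<integral>x. u s x * \<psi> x \<partial>lborel))"
        have "ennreal (?a\<^sup>2) < ennreal (r\<^sup>2)" using pair[OF \<psi>, of k s] elim by (rule le_less_trans)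
        then have "?a\<^sup>2 < r\<^sup>2" by (simp add: ennreal_less_iff)
        then show "?a \<le> r" using r by (simp add: power2_less_imp_less less_imp_le)
      qed
    qed
  qed
  have lim: "(\<lambda>k. ?F k s) \<longlonglongrightarrow> ?G s" for s
  proof (rule LIMSEQ_I)
    fix r :: real assume "0 < r"
    then have "eventually (\<lambda>k. \<forall>s. cmod (?F k s - ?G s) \<le> r / 2) sequentially" by (intro small \<phi>L) auto
    then obtain N where N: "\<And>k. N \<le> k \<Longrightarrow> cmod (?F k s - ?G s) \<le> r / 2" by (auto simp: eventually_sequentially)
    show "\<exists>N. \<forall>k\<ge>N. norm (?F k s - ?G s) < r"
    proof (intro exI allI impI)
      fix k assume "N \<le> k" then show "norm (?F k s - ?G s) < r" using N[of k] \<open>0 < r\<close> by linarith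
    qed
  qed
  have "\<exists>g. \<forall>s\<in>UNIV. (\<lambda>k. ?F k s) \<longlonglongrightarrow> g s \<and> (g has_derivative (\<lambda>h. h *\<^sub>R ?G' s)) (at s within UNIV)"
  proof (rule has_derivative_sequence[where f = ?F and g' = "\<lambda>s h. h *\<^sub>R ?G' s" and f' = "\<lambda>k s h. h *\<^sub>R ?F' k s", OF convex_UNIV _ _ UNIV_I lim[of 0]])
    show "(?F k has_derivative (\<lambda>h. h *\<^sub>R ?F' k s)) (at s within UNIV)" for k s
      using heat_solution_weak_derivative[OF v b \<phi>] by (simp add: has_vector_derivative_def)
    fix r :: real assume "0 < r"
    then have "eventually (\<lambda>k. \<forall>s. cmod ((\<integral>x. v k (Complex b s) x * laplacian \<phi> x \<partial>lborel) - (\<integral>x. u s x * laplacian \<phi> x \<partial>lborel)) \<le> r) sequentially"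
      by (intro small lL)
    then show "eventually (\<lambda>k. \<forall>s\<in>UNIV. \<forall>h. norm (h *\<^sub>R ?F' k s - h *\<^sub>R ?G' s) \<le> r * norm h) sequentially"
    proof eventually_elim
      case (elim k)
      show ?case
      proof (intro ballI allI)
        fix s h :: real
        have "h *\<^sub>R ?F' k s - h *\<^sub>R ?G' s = (h *\<^sub>R \<i>) * ((\<integral>x. v k (Complex b s) x * laplacian \<phi> x \<partial>lborel) - (\<integral>x. u s x * laplacian \<phi> x \<partial>lborel))"
          by (simp add: algebra_simps scaleR_conv_of_real)
        then have "norm (h *\<^sub>R ?F' k s - h *\<^sub>R ?G' s)
          = cmod ((\<integral>x. v k (Complex b s) x * laplacian \<phi> x \<partial>lborel) - (\<integral>x. u s x * laplacian \<phi> x \<partial>lborel)) * norm h"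
          by (simp only: norm_mult norm_scaleR norm_ii mult_1_right real_norm_def mult.commute)
        also have "\<dots> \<le> r * norm h" using elim by (intro mult_right_mono) auto
        finally show "norm (h *\<^sub>R ?F' k s - h *\<^sub>R ?G' s) \<le> r * norm h" .
      qed
    qed
  qed
  then obtain G where G: "\<And>s. (\<lambda>k. ?F k s) \<longlonglongrightarrow> G s" "\<And>s. (G has_derivative (\<lambda>h. h *\<^sub>R ?G' s)) (at s)" by auto
  have "G = ?G" using LIMSEQ_unique[OF G(1) lim] by auto
  then show "(?G has_vector_derivative ?G' t) (at t)" using G(2)[of t] by (simp add: has_vector_derivative_def)
qed

section \<open>Multiplier operators\<close>

definition fourier_coeff :: "'a measure \<Rightarrow> ('i \<Rightarrow> 'a \<Rightarrow> complex) \<Rightarrow> ('a \<Rightarrow> complex) \<Rightarrow> 'i \<Rightarrow> complex"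
  where "fourier_coeff M e f i = (\<integral>x. f x * cnj (e i x) \<partial>M) / complex_of_real (\<integral>x. (cmod (e i x))\<^sup>2 \<partial>M)"

text \<open>For the partial sum \<open>P\<close> of the Fourier series, \<open>\<integral> f cnj P = \<parallel>P\<parallel>\<^sup>2\<close>, and the Cauchy-Schwarz
  inequality gives \<open>\<parallel>P\<parallel>\<^sup>4 \<le> \<parallel>f\<parallel>\<^sup>2 \<parallel>P\<parallel>\<^sup>2\<close>.\<close>

lemma Bessel_inequality:
  assumes e: "orthogonal_family M e" and pos: "\<And>i. 0 < (\<integral>x. (cmod (e i x))\<^sup>2 \<partial>M)"
    and f: "f \<in> L2 M" and I: "finite I"
  shows "ennreal (\<Sum>i\<in>I. series_weight M e (fourier_coeff M e f) i) \<le> sqnorm M f"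
proof -
  let ?b = "fourier_coeff M e f"
  let ?P = "\<lambda>x. \<Sum>i\<in>I. ?b i * e i x"
  let ?S = "\<Sum>i\<in>I. series_weight M e ?b i"
  have L: "e i \<in> L2 M" for i using e by (auto simp: orthogonal_family_def)
  have PL: "?P \<in> L2 M" by (rule L2_lincomb[OF L])
  have S0: "0 \<le> ?S" by (intro sum_nonneg series_weight_nonneg)
  have P: "sqnorm M ?P = ennreal ?S" by (rule orthogonal_sqnorm_sum[OF e I])
  have "(\<integral>x. f x * cnj (?P x) \<partial>M) = (\<integral>x. (\<Sum>i\<in>I. cnj (?b i) * (f x * cnj (e i x))) \<partial>M)"
    by (rule Bochner_Integration.integral_cong[OF refl]) (simp add: sum_distrib_left mult_ac)
  also have "\<dots> = (\<Sum>i\<in>I. cnj (?b i) * (\<integral>x. f x * cnj (e i x) \<partial>M))"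
    using integrable_L2_mult[OF f L2_cnj[OF L]] by simp
  also have "\<dots> = (\<Sum>i\<in>I. complex_of_real (series_weight M e ?b i))"
  proof (rule sum.cong[OF refl])
    fix i
    have "(\<integral>x. f x * cnj (e i x) \<partial>M) = ?b i * complex_of_real (\<integral>x. (cmod (e i x))\<^sup>2 \<partial>M)"
      using pos[of i] by (simp add: fourier_coeff_def)
    then have "cnj (?b i) * (\<integral>x. f x * cnj (e i x) \<partial>M) = (?b i * cnj (?b i)) * complex_of_real (\<integral>x. (cmod (e i x))\<^sup>2 \<partial>M)"
      by (simp only: mult_ac)
    then show "cnj (?b i) * (\<integral>x. f x * cnj (e i x) \<partial>M) = complex_of_real (series_weight M e ?b i)"
      unfolding series_weight_def complex_norm_square[symmetric] by (simp only: of_real_mult)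
  qed
  finally have eq: "(\<integral>x. f x * cnj (?P x) \<partial>M) = complex_of_real ?S" by simp
  have "ennreal ((cmod (complex_of_real ?S))\<^sup>2) \<le> sqnorm M f * sqnorm M (\<lambda>x. cnj (?P x))"
    unfolding eq[symmetric] by (rule integral_mult_le_sqnorm[OF f L2_cnj[OF PL]])
  also have "sqnorm M (\<lambda>x. cnj (?P x)) = ennreal ?S" unfolding P[symmetric] by (simp add: sqnorm_def del: cnj_sum)
  finally have "ennreal (?S\<^sup>2) \<le> sqnorm M f * ennreal ?S" by (simp only: norm_of_real power2_abs)
  moreover obtain r where r: "sqnorm M f = ennreal r" "0 \<le> r" using L2_finite[OF f] by (cases "sqnorm M f") auto
  ultimately have "?S\<^sup>2 \<le> r * ?S" using S0 by (simp add: ennreal_mult[symmetric])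
  then have "?S \<le> r" using S0 r(2) by (cases "?S = 0") (auto simp: power2_eq_square)
  then show ?thesis by (simp add: r ennreal_leI)
qed

lemma L2_has_sum_add:
  assumes "L2_has_sum M F f" "L2_has_sum M G g"
  shows "L2_has_sum M (\<lambda>i x. F i x + G i x) (\<lambda>x. f x + g x)"
  unfolding L2_has_sum_iff_sqnorm
proof (intro conjI allI)
  have L: "F i \<in> L2 M" "G i \<in> L2 M" "f \<in> L2 M" "g \<in> L2 M" for i using assms by (auto simp: L2_has_sum_iff_sqnorm)
  then show "(\<lambda>x. F i x + G i x) \<in> L2 M" "(\<lambda>x. f x + g x) \<in> L2 M" for i by (auto intro: L2_add)
  have [measurable]: "F i \<in> borel_measurable M" "G i \<in> borel_measurable M" "f \<in> borel_measurable M" "g \<in> borel_measurable M" for i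
    using L by (auto dest: L2_measurable)
  have upper: "((\<lambda>I. 2 * sqnorm M (\<lambda>x. f x - (\<Sum>i\<in>I. F i x)) + 2 * sqnorm M (\<lambda>x. g x - (\<Sum>i\<in>I. G i x))) \<longlongrightarrow> 0) (finite_subsets_at_top UNIV)"
    using assms by (intro tendsto_eq_rhs[OF tendsto_add[OF tendsto_2_mult_ennreal tendsto_2_mult_ennreal]]) (auto simp: L2_has_sum_iff_sqnorm)
  have "sqnorm M (\<lambda>x. f x + g x - (\<Sum>i\<in>I. F i x + G i x))
      \<le> 2 * sqnorm M (\<lambda>x. f x - (\<Sum>i\<in>I. F i x)) + 2 * sqnorm M (\<lambda>x. g x - (\<Sum>i\<in>I. G i x))" for I
  proof -
    have "(\<lambda>x. f x + g x - (\<Sum>i\<in>I. F i x + G i x)) = (\<lambda>x. (f x - (\<Sum>i\<in>I. F i x)) + (g x - (\<Sum>i\<in>I. G i x)))"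
      by (simp add: sum.distrib algebra_simps)
    then show ?thesis by (simp only:) (rule sqnorm_add_le; measurable)
  qed
  then show "((\<lambda>I. sqnorm M (\<lambda>x. f x + g x - (\<Sum>i\<in>I. F i x + G i x))) \<longlongrightarrow> 0) (finite_subsets_at_top UNIV)"
    by (intro tendsto_sandwich[OF _ _ tendsto_const upper]) auto
qed

lemma L2_has_sum_cmult:
  assumes "L2_has_sum M F f"
  shows "L2_has_sum M (\<lambda>i x. c * F i x) (\<lambda>x. c * f x)"
  unfolding L2_has_sum_iff_sqnorm
proof (intro conjI allI)
  have L: "F i \<in> L2 M" "f \<in> L2 M" for i using assms by (auto simp: L2_has_sum_iff_sqnorm)
  then show "(\<lambda>x. c * F i x) \<in> L2 M" "(\<lambda>x. c * f x) \<in> L2 M" for i by (auto intro: L2_cmult)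
  have m [measurable]: "F i \<in> borel_measurable M" "f \<in> borel_measurable M" for i
    using L by (auto dest: L2_measurable)
  have "sqnorm M (\<lambda>x. c * f x - (\<Sum>i\<in>I. c * F i x)) = ennreal ((cmod c)\<^sup>2) * sqnorm M (\<lambda>x. f x - (\<Sum>i\<in>I. F i x))" for I
    by (subst sqnorm_cmult[symmetric]) (auto simp: sum_distrib_left right_diff_distrib)
  then show "((\<lambda>I. sqnorm M (\<lambda>x. c * f x - (\<Sum>i\<in>I. c * F i x))) \<longlongrightarrow> 0) (finite_subsets_at_top UNIV)"
    using assms ennreal_tendsto_cmult[of "ennreal ((cmod c)\<^sup>2)" "\<lambda>I. sqnorm M (\<lambda>x. f x - (\<Sum>i\<in>I. F i x))" 0]
    by (simp add: L2_has_sum_iff_sqnorm)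
qed

definition multiplier_op :: "'a measure \<Rightarrow> ('i \<Rightarrow> 'a \<Rightarrow> complex) \<Rightarrow> ('i \<Rightarrow> complex) \<Rightarrow> ('a \<Rightarrow> complex) \<Rightarrow> 'a \<Rightarrow> complex"
  where "multiplier_op M e \<mu> f = L2_sum M (\<lambda>i x. (\<mu> i * fourier_coeff M e f i) * e i x)"

text \<open>Multipliers of modulus \<open>1\<close> leave the weights of the series unchanged, so Bessel's inequality makes it
  converge. The constant \<open>2\<close> comes from \<open>\<parallel>a + b\<parallel>\<^sup>2 \<le> 2 \<parallel>a\<parallel>\<^sup>2 + 2 \<parallel>b\<parallel>\<^sup>2\<close>.\<close>

lemma multiplier_op_has_sum:
  assumes e: "orthogonal_family M e" and pos: "\<And>i. 0 < (\<integral>x. (cmod (e i x))\<^sup>2 \<partial>M)"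
    and \<mu>: "\<And>i. cmod (\<mu> i) = 1" and f: "f \<in> L2 M"
  shows "L2_has_sum M (\<lambda>i x. (\<mu> i * fourier_coeff M e f i) * e i x) (multiplier_op M e \<mu> f)"
    "sqnorm M (multiplier_op M e \<mu> f) \<le> 2 * sqnorm M f"
proof -
  let ?c = "\<lambda>i. \<mu> i * fourier_coeff M e f i"
  have w: "series_weight M e ?c = series_weight M e (fourier_coeff M e f)"
    by (auto simp: series_weight_def norm_mult \<mu>)
  obtain r where r: "sqnorm M f = ennreal r" "0 \<le> r" using L2_finite[OF f] by (cases "sqnorm M f") auto
  have bound: "sum (series_weight M e ?c) I \<le> r" if "finite I" for I
    using Bessel_inequality[OF e pos f that] unfolding w r using r(2) by (simp add: ennreal_le_iff)
  obtain I where I: "exhausts (series_weight M e ?c) I"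
    using exhausts_exists[OF series_weight_nonneg bound] by blast
  have s: "L2_has_sum M (\<lambda>i x. ?c i * e i x) (multiplier_op M e \<mu> f)"
    unfolding multiplier_op_def by (rule L2_sum_has_sum[OF L2_has_sum_orthogonal[OF e I]])
  then show "L2_has_sum M (\<lambda>i x. ?c i * e i x) (multiplier_op M e \<mu> f)" .
  let ?T = "multiplier_op M e \<mu> f"
  let ?S = "\<lambda>I x. \<Sum>i\<in>I. ?c i * e i x"
  have m: "?T \<in> borel_measurable M" "?S I \<in> borel_measurable M" for I
    using s e by (auto simp: L2_has_sum_def orthogonal_family_def intro!: L2_measurable L2_lincomb)
  have lim: "((\<lambda>I. 2 * sqnorm M (\<lambda>x. ?T x - ?S I x) + 2 * sqnorm M f) \<longlongrightarrow> 0 + 2 * sqnorm M f) (finite_subsets_at_top UNIV)"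
    using s by (intro tendsto_add tendsto_const tendsto_2_mult_ennreal) (auto simp: L2_has_sum_iff_sqnorm)
  have "eventually (\<lambda>I. sqnorm M ?T \<le> 2 * sqnorm M (\<lambda>x. ?T x - ?S I x) + 2 * sqnorm M f) (finite_subsets_at_top UNIV)"
  proof (rule eventually_finite_subsets_at_top_weakI)
    fix I :: "'b set" assume I: "finite I"
    have "sqnorm M ?T = sqnorm M (\<lambda>x. (?T x - ?S I x) + ?S I x)" by simp
    also have "\<dots> \<le> 2 * sqnorm M (\<lambda>x. ?T x - ?S I x) + 2 * sqnorm M (?S I)"
      using m by (intro sqnorm_add_le) auto
    also have "sqnorm M (?S I) \<le> sqnorm M f"
      using Bessel_inequality[OF e pos f I] by (simp only: orthogonal_sqnorm_sum[OF e I] w)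
    finally show "sqnorm M ?T \<le> 2 * sqnorm M (\<lambda>x. ?T x - ?S I x) + 2 * sqnorm M f"
      by (simp add: add_left_mono mult_left_mono)
  qed
  from tendsto_lowerbound[OF lim this] show "sqnorm M ?T \<le> 2 * sqnorm M f" by simp
qed

text \<open>On the orthogonal complement of the family the operator is \<open>0\<close>; linearity holds almost everywhere
  because sums of series are unique up to null sets.\<close>

lemma multiplier_op_L2_operator:
  assumes e: "orthogonal_family M e" and pos: "\<And>i. 0 < (\<integral>x. (cmod (e i x))\<^sup>2 \<partial>M)"
    and \<mu>: "\<And>i. cmod (\<mu> i) = 1"
  shows "L2_operator M (multiplier_op M e \<mu>)"
    and "AE x in M. multiplier_op M e \<mu> (e j) x = \<mu> j * e j x"
proof -
  note hs = multiplier_op_has_sum[where \<mu> = \<mu>, OF e pos \<mu>]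
  have L: "e i \<in> L2 M" for i using e by (auto simp: orthogonal_family_def)
  show "L2_operator M (multiplier_op M e \<mu>)"
    unfolding L2_operator_def
  proof (intro conjI ballI allI)
    fix f assume f: "f \<in> L2 M"
    then show "multiplier_op M e \<mu> f \<in> L2 M" using hs(1) by (auto simp: L2_has_sum_def)
    { fix g assume g: "g \<in> L2 M"
      have "fourier_coeff M e (\<lambda>y. f y + g y) i = fourier_coeff M e f i + fourier_coeff M e g i" for i
        using integrable_L2_mult[OF f L2_cnj[OF L]] integrable_L2_mult[OF g L2_cnj[OF L]]
        by (simp add: fourier_coeff_def distrib_right add_divide_distrib)
      then have eq: "(\<lambda>i x. (\<mu> i * fourier_coeff M e (\<lambda>y. f y + g y) i) * e i x)
        = (\<lambda>i x. (\<mu> i * fourier_coeff M e f i) * e i x + (\<mu> i * fourier_coeff M e g i) * e i x)"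
        by (simp add: algebra_simps)
      show "AE x in M. multiplier_op M e \<mu> (\<lambda>y. f y + g y) x = multiplier_op M e \<mu> f x + multiplier_op M e \<mu> g x"
        by (rule L2_has_sum_unique[OF hs(1)[OF L2_add[OF f g], unfolded eq] L2_has_sum_add[OF hs(1)[OF f] hs(1)[OF g]]]) }
    { fix c
      have "fourier_coeff M e (\<lambda>y. c * f y) i = c * fourier_coeff M e f i" for i
        by (simp add: fourier_coeff_def mult.assoc)
      then have eq: "(\<lambda>i x. (\<mu> i * fourier_coeff M e (\<lambda>y. c * f y) i) * e i x)
        = (\<lambda>i x. c * ((\<mu> i * fourier_coeff M e f i) * e i x))"
        by (simp add: algebra_simps)
      show "AE x in M. multiplier_op M e \<mu> (\<lambda>y. c * f y) x = c * multiplier_op M e \<mu> f x"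
        by (rule L2_has_sum_unique[OF hs(1)[OF L2_cmult[OF f, of c], unfolded eq] L2_has_sum_cmult[OF hs(1)[OF f], of c]]) }
  next
    show "\<exists>B. \<forall>f\<in>L2 M. Lp_norm M 2 (multiplier_op M e \<mu> f) \<le> ennreal B * Lp_norm M 2 f"
      using hs(2) by (intro exI[of _ "sqrt 2"] ballI Lp_norm_2_bound) auto
  qed
  have "fourier_coeff M e (e j) i = (if i = j then 1 else 0)" for i
    using e pos[of i] by (auto simp: fourier_coeff_def orthogonal_family_def integral_cnj_self)
  then have F: "(\<lambda>i x. (\<mu> i * fourier_coeff M e (e j) i) * e i x) = (\<lambda>i x. if i = j then \<mu> j * e j x else 0)"
    by (auto simp: fun_eq_iff)
  have "L2_has_sum M (\<lambda>i x. if i = j then \<mu> j * e j x else 0) (\<lambda>x. \<mu> j * e j x)"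
    unfolding L2_has_sum_iff_sqnorm
  proof (intro conjI allI)
    show "(\<lambda>x. \<mu> j * e j x) \<in> L2 M" by (rule L2_cmult[OF L])
    then show "(\<lambda>x. if i = j then \<mu> j * e j x else 0) \<in> L2 M" for i by (cases "i = j") auto
    have "eventually (\<lambda>I. sqnorm M (\<lambda>x. \<mu> j * e j x - (\<Sum>i\<in>I. if i = j then \<mu> j * e j x else 0)) = 0) (finite_subsets_at_top UNIV)"
      unfolding eventually_finite_subsets_at_top by (intro exI[of _ "{j}"]) auto
    then show "((\<lambda>I. sqnorm M (\<lambda>x. \<mu> j * e j x - (\<Sum>i\<in>I. if i = j then \<mu> j * e j x else 0))) \<longlongrightarrow> 0) (finite_subsets_at_top UNIV)"
      by (rule tendsto_eventually)
  qed
  then show "AE x in M. multiplier_op M e \<mu> (e j) x = \<mu> j * e j x"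
    by (rule L2_has_sum_unique[OF hs(1)[OF L, of j, unfolded F]])
qed

lemma
  assumes "L2_operator M T"
  shows L2_operator_in: "f \<in> L2 M \<Longrightarrow> T f \<in> L2 M"
    and L2_operator_add: "f \<in> L2 M \<Longrightarrow> g \<in> L2 M \<Longrightarrow> AE x in M. T (\<lambda>y. f y + g y) x = T f x + T g x"
    and L2_operator_cmult: "f \<in> L2 M \<Longrightarrow> AE x in M. T (\<lambda>y. c * f y) x = c * T f x"
  using assms unfolding L2_operator_def by simp_all

lemma L2_operator_finite_sum:
  assumes T: "L2_operator M T" and L: "\<And>i. e i \<in> L2 M" and A: "\<And>i. AE x in M. T (e i) x = A i x"
    and I: "finite I"
  shows "AE x in M. T (\<lambda>y. \<Sum>i\<in>I. c i * e i y) x = (\<Sum>i\<in>I. c i * A i x)"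
  using I
proof (induction I rule: finite_induct)
  case empty
  have "AE x in M. T (\<lambda>y. 0 * (0 :: complex)) x = 0 * T (\<lambda>_. 0) x"
    by (rule L2_operator_cmult[OF T L2_zero])
  then show ?case by simp
next
  case (insert j I)
  have 1: "AE x in M. T (\<lambda>y. c j * e j y + (\<Sum>i\<in>I. c i * e i y)) x = T (\<lambda>y. c j * e j y) x + T (\<lambda>y. \<Sum>i\<in>I. c i * e i y) x"
    by (intro L2_operator_add[OF T] L2_cmult[OF L] L2_lincomb[OF L])
  have 2: "AE x in M. T (\<lambda>y. c j * e j y) x = c j * T (e j) x"
    by (rule L2_operator_cmult[OF T L])
  have "AE x in M. T (\<lambda>y. c j * e j y + (\<Sum>i\<in>I. c i * e i y)) x = c j * A j x + (\<Sum>i\<in>I. c i * A i x)"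
    using 1 2 insert.IH A[of j] by eventually_elim simp
  then show ?case using insert by simp
qed

text \<open>A bounded operator is determined on the sum of a series by its values on the terms. This is how the
  operators, known only through their action on the basis, are evaluated.\<close>

lemma L2_operator_series:
  assumes T: "L2_operator M T" and L: "\<And>i. e i \<in> L2 M" and A: "\<And>i. AE x in M. T (e i) x = A i x"
    and g: "g \<in> L2 M" and I: "\<And>k :: nat. finite (I k)"
    and lim: "(\<lambda>k. sqnorm M (\<lambda>x. g x - (\<Sum>i\<in>I k. c i * e i x))) \<longlonglongrightarrow> 0"
  shows "(\<lambda>k. sqnorm M (\<lambda>x. T g x - (\<Sum>i\<in>I k. c i * A i x))) \<longlonglongrightarrow> 0"
proof -
  obtain B where B: "\<And>f. f \<in> L2 M \<Longrightarrow> Lp_norm M 2 (T f) \<le> ennreal B * Lp_norm M 2 f"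
    using T unfolding L2_operator_def by blast
  let ?S = "\<lambda>k x. \<Sum>i\<in>I k. c i * e i x"
  have S: "?S k \<in> L2 M" for k by (rule L2_lincomb[OF L])
  have bd: "sqnorm M (\<lambda>x. T g x - (\<Sum>i\<in>I k. c i * A i x)) \<le> ennreal ((\<bar>B\<bar> + 1)\<^sup>2) * sqnorm M (\<lambda>x. g x - ?S k x)" for k
  proof -
    have 1: "AE x in M. T (\<lambda>y. g y + (- 1) * ?S k y) x = T g x + T (\<lambda>y. (- 1) * ?S k y) x"
      by (intro L2_operator_add[OF T g] L2_cmult[OF S])
    have 2: "AE x in M. T (\<lambda>y. (- 1) * ?S k y) x = (- 1) * T (?S k) x"
      by (rule L2_operator_cmult[OF T S])
    have 3: "AE x in M. T (?S k) x = (\<Sum>i\<in>I k. c i * A i x)"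
      by (rule L2_operator_finite_sum[OF T L A I])
    have "AE x in M. T (\<lambda>y. g y + (- 1) * ?S k y) x = T g x - (\<Sum>i\<in>I k. c i * A i x)"
      using 1 2 3 by eventually_elim simp
    then have "sqnorm M (\<lambda>x. T g x - (\<Sum>i\<in>I k. c i * A i x)) = sqnorm M (T (\<lambda>y. g y + (- 1) * ?S k y))"
      by (intro sqnorm_cong_AE) (auto elim: eventually_mono)
    also have "\<dots> \<le> ennreal ((\<bar>B\<bar> + 1)\<^sup>2) * sqnorm M (\<lambda>y. g y + (- 1) * ?S k y)"
      by (intro Lp_norm_2_boundD B L2_add g L2_cmult S)
    finally show ?thesis by simp
  qed
  have upper: "(\<lambda>k. ennreal ((\<bar>B\<bar> + 1)\<^sup>2) * sqnorm M (\<lambda>x. g x - ?S k x)) \<longlonglongrightarrow> 0"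
    using ennreal_tendsto_cmult[OF ennreal_less_top lim] by simp
  show ?thesis by (rule tendsto_sandwich[OF _ always_eventually[OF allI[OF bd]] tendsto_const upper]) simp
qed

section \<open>Operators on Gaussian space\<close>

lemma AE_gauss_dilation:
  assumes "AE x in (gauss :: (real ^ 'n) measure). P x" and c: "0 < c" "c \<le> 1"
  shows "AE x in (gauss :: (real ^ 'n) measure). P (c *\<^sub>R x)"
proof -
  from assms(1) obtain N where N: "{x. \<not> P x} \<subseteq> N" "emeasure gauss N = 0" "N \<in> sets (gauss :: (real ^ 'n) measure)"
    by (auto elim!: AE_E)
  have [measurable]: "N \<in> sets borel" using N(3) by simp
  have "(\<integral>\<^sup>+x. indicator N (c *\<^sub>R x) \<partial>(gauss :: (real ^ 'n) measure)) \<le> ennreal (1 / c ^ CARD('n)) * (\<integral>\<^sup>+x. indicator N x \<partial>(gauss :: (real ^ 'n) measure))"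
    by (rule nn_integral_gauss_dilation_le[OF _ c]) simp
  also have "\<dots> = 0" using N by simp
  finally have "AE x in (gauss :: (real ^ 'n) measure). indicator N (c *\<^sub>R x) = (0 :: ennreal)"
    by (subst (asm) le_zero_eq, subst (asm) nn_integral_0_iff_AE) auto
  then show ?thesis using N(1) by (auto elim!: eventually_mono simp: indicator_eq_0_iff)
qed

lemma sqnorm_gauss_dilation:
  fixes f :: "real ^ 'n \<Rightarrow> complex"
  assumes [measurable]: "f \<in> borel_measurable borel" and c: "0 < c" "c \<le> 1"
  shows "sqnorm gauss (\<lambda>x. f (c *\<^sub>R x)) \<le> ennreal (1 / c ^ CARD('n)) * sqnorm gauss f"
  unfolding sqnorm_def by (rule nn_integral_gauss_dilation_le[OF _ c, of "\<lambda>x. ennreal ((cmod (f x))\<^sup>2)"]) simp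

lemma L2_gauss_dilation:
  assumes f: "f \<in> L2 (gauss :: (real ^ 'n) measure)" and c: "0 < c" "c \<le> 1"
  shows "(\<lambda>x. f (c *\<^sub>R x)) \<in> L2 gauss"
proof -
  have [measurable]: "f \<in> borel_measurable borel" using L2_measurable[OF f] by simp
  have "sqnorm gauss (\<lambda>x. f (c *\<^sub>R x)) < \<infinity>"
    using L2_finite[OF f] by (intro le_less_trans[OF sqnorm_gauss_dilation[OF _ c]]) (auto simp: ennreal_mult_less_top)
  then show ?thesis by (simp add: L2_iff)
qed

lemma L2_operator_dilation:
  assumes T: "L2_operator (gauss :: (real ^ 'n) measure) T" and c: "0 < c" "c \<le> 1"
  shows "L2_operator (gauss :: (real ^ 'n) measure) (\<lambda>f x. T f (c *\<^sub>R x))"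
proof -
  let ?M = "gauss :: (real ^ 'n) measure"
  obtain B where B: "\<And>f. f \<in> L2 ?M \<Longrightarrow> Lp_norm ?M 2 (T f) \<le> ennreal B * Lp_norm ?M 2 f"
    using T unfolding L2_operator_def by blast
  have TL: "T f \<in> L2 ?M" if "f \<in> L2 ?M" for f by (rule L2_operator_in[OF T that])
  show ?thesis
    unfolding L2_operator_def
  proof (intro conjI ballI allI)
    fix f assume f: "f \<in> L2 ?M"
    show "(\<lambda>x. T f (c *\<^sub>R x)) \<in> L2 ?M" by (rule L2_gauss_dilation[OF TL[OF f] c])
    { fix g assume g: "g \<in> L2 ?M"
      have "AE x in ?M. T (\<lambda>y. f y + g y) x = T f x + T g x"
        by (rule L2_operator_add[OF T f g])
      from AE_gauss_dilation[OF this c]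
      show "AE x in ?M. T (\<lambda>y. f y + g y) (c *\<^sub>R x) = T f (c *\<^sub>R x) + T g (c *\<^sub>R x)" . }
    { fix a
      have "AE x in ?M. T (\<lambda>y. a * f y) x = a * T f x"
        by (rule L2_operator_cmult[OF T f])
      from AE_gauss_dilation[OF this c]
      show "AE x in ?M. T (\<lambda>y. a * f y) (c *\<^sub>R x) = a * T f (c *\<^sub>R x)" . }
  next
    let ?D = "(1 / c ^ CARD('n)) * (\<bar>B\<bar> + 1)\<^sup>2"
    have "Lp_norm ?M 2 (\<lambda>x. T f (c *\<^sub>R x)) \<le> ennreal (sqrt ?D) * Lp_norm ?M 2 f" if f: "f \<in> L2 ?M" for f
    proof (rule Lp_norm_2_bound)
      have [measurable]: "T f \<in> borel_measurable borel" using L2_measurable[OF TL[OF f]] by simp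
      have "sqnorm ?M (\<lambda>x. T f (c *\<^sub>R x)) \<le> ennreal (1 / c ^ CARD('n)) * sqnorm ?M (T f)"
        by (rule sqnorm_gauss_dilation[OF _ c]) simp
      also have "\<dots> \<le> ennreal (1 / c ^ CARD('n)) * (ennreal ((\<bar>B\<bar> + 1)\<^sup>2) * sqnorm ?M f)"
        by (intro mult_left_mono Lp_norm_2_boundD B f) auto
      also have "\<dots> = ennreal ?D * sqnorm ?M f"
        using c by (subst ennreal_mult) (auto simp: mult.assoc)
      finally show "sqnorm ?M (\<lambda>x. T f (c *\<^sub>R x)) \<le> ennreal ?D * sqnorm ?M f" .
      show "0 < ?D" using c by (intro mult_pos_pos) auto
    qed
    then show "\<exists>B. \<forall>f\<in>L2 ?M. Lp_norm ?M 2 (\<lambda>x. T f (c *\<^sub>R x)) \<le> ennreal B * Lp_norm ?M 2 f" by blast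
  qed
qed

text \<open>A multiplier operator followed by a dilation by \<open>c \<le> 1\<close> has the prescribed values on the basis, so the
  choice in the definition of \<open>hermite_operator\<close> is made from a nonempty set.\<close>

lemma hermite_operator_spec:
  assumes \<mu>: "\<And>m. cmod (\<mu> m) = 1" and c: "0 < c" "c \<le> 1"
  defines "A \<equiv> \<lambda>m x. \<mu> m * hermite_multi m (c *\<^sub>R x)"
  shows "L2_operator gauss (hermite_operator A)"
    "AE x in gauss. hermite_operator A (hermite_multi m) x = A m x"
proof -
  let ?T = "multiplier_op gauss hermite_multi \<mu>"
  have 1: "L2_operator gauss ?T"
    by (rule multiplier_op_L2_operator(1)[OF orthogonal_hermite_multi hermite_multi_norm_pos \<mu>])
  have 2: "AE x in gauss. ?T (hermite_multi m) x = \<mu> m * hermite_multi m x" for m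
    by (rule multiplier_op_L2_operator(2)[OF orthogonal_hermite_multi hermite_multi_norm_pos \<mu>])
  have "\<exists>T. L2_operator gauss T \<and> (\<forall>m. AE x in gauss. T (hermite_multi m) x = A m x)"
    using L2_operator_dilation[OF 1 c] AE_gauss_dilation[OF 2 c] unfolding A_def by blast
  from someI_ex[OF this, folded hermite_operator_def]
  show "L2_operator gauss (hermite_operator A)" "AE x in gauss. hermite_operator A (hermite_multi m) x = A m x"
    by auto
qed

section \<open>The lens transform\<close>

text \<open>At complex time \<open>z\<close> with \<open>Re z = b\<close> the Schroedinger evolution of a Gaussian times a function is,
  up to a rotation of the Hermite coefficients, the function itself, rescaled by \<open>\<surd>b / \<bar>z\<bar>\<close> and
  multiplied by a complex Gaussian.\<close>

definition lens_transform :: "real \<Rightarrow> complex \<Rightarrow> (real ^ 'n \<Rightarrow> complex) \<Rightarrow> real ^ 'n \<Rightarrow> complex"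
  where "lens_transform b z g x = (complex_of_real (sqrt b) / csqrt z) ^ CARD('n)
    * g ((sqrt b / cmod z) *\<^sub>R x) * exp (- complex_of_real ((norm x)\<^sup>2) / (4 * z))"

lemma lens_transform_measurable [measurable]:
  assumes [measurable]: "g \<in> borel_measurable borel"
  shows "lens_transform b z g \<in> borel_measurable borel"
  unfolding lens_transform_def[abs_def] by measurable

lemma cmod_lens_transform:
  fixes g :: "real ^ 'n \<Rightarrow> complex"
  assumes b: "0 < b" and z: "Re z = b"
  shows "cmod (lens_transform b z g x) = sqrt (b / cmod z) ^ CARD('n) * cmod (g ((sqrt b / cmod z) *\<^sub>R x))
    * exp (- b * (norm x)\<^sup>2 / (4 * (cmod z)\<^sup>2))"
proof -
  have z0: "z \<noteq> 0" using assms by auto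
  have "Re (- complex_of_real t / (4 * z)) = - b * t / (4 * (cmod z)\<^sup>2)" for t
  proof -
    have "- complex_of_real t / (4 * z) = complex_of_real (- t / (4 * (cmod z)\<^sup>2)) * cnj z"
      using z0 by (simp add: complex_div_cnj[of _ z] field_simps)
    then show ?thesis using z by simp
  qed
  then show ?thesis using b
    by (simp only: lens_transform_def norm_csqrt norm_mult norm_power norm_divide norm_of_real norm_exp_eq_Re real_sqrt_divide) simp
qed

text \<open>The modulus of the Gaussian factor to the power \<open>p\<close> is \<open>exp (- \<parallel>c x\<parallel>\<^sup>2 / 2)\<close> with
  \<open>c = \<surd>(p b / 2) / \<bar>z\<bar>\<close>. In the variable \<open>y = c x\<close> the measure becomes Gaussian and the argument of
  \<open>g\<close> becomes \<open>\<surd>(2/p) y\<close>: this is the origin of the dilation in the operator \<open>H_op\<close>.\<close>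

lemma nn_integral_lens_transform:
  fixes g :: "real ^ 'n \<Rightarrow> complex"
  assumes b: "0 < b" and z: "Re z = b" and p: "0 < p" and [measurable]: "g \<in> borel_measurable borel"
  shows "(\<integral>\<^sup>+x. ennreal (cmod (lens_transform b z g x) powr p) \<partial>lborel)
    = ennreal (((b / cmod z) powr (p / 2) * sqrt (2 * pi) * cmod z / sqrt (p * b / 2)) ^ CARD('n))
      * (\<integral>\<^sup>+x. ennreal (cmod (g (sqrt (2 / p) *\<^sub>R x)) powr p) \<partial>gauss)"
proof -
  have z0: "0 < cmod z" using assms by auto
  let ?d = "CARD('n)"
  let ?c = "sqrt (p * b / 2) / cmod z"
  let ?A = "((b / cmod z) powr (p / 2)) ^ ?d"
  have c: "0 < ?c" using b p z0 by simp
  have sc: "sqrt (2 / p) * ?c = sqrt b / cmod z"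
    using p b by (simp add: real_sqrt_mult real_sqrt_divide)
  have "cmod (lens_transform b z g x) powr p
      = ?A * (exp (- (?c * norm x)\<^sup>2 / 2) * cmod (g (sqrt (2 / p) *\<^sub>R (?c *\<^sub>R x))) powr p)" for x
  proof -
    have "(sqrt (b / cmod z) ^ ?d) powr p = ?A"
      using b z0 by (simp add: powr_half_sqrt[symmetric] powr_powr powr_realpow[symmetric] mult_ac)
    moreover have "exp (- b * (norm x)\<^sup>2 / (4 * (cmod z)\<^sup>2)) powr p = exp (- (?c * norm x)\<^sup>2 / 2)"
      using b p by (simp add: exp_powr_real power_mult_distrib power_divide)
    ultimately show ?thesis
      unfolding cmod_lens_transform[OF b z] scaleR_scaleR sc
      by (simp add: powr_mult mult_ac)
  qed
  then have "(\<integral>\<^sup>+x. ennreal (cmod (lens_transform b z g x) powr p) \<partial>lborel)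
    = (\<integral>\<^sup>+x. ennreal ?A * (ennreal (exp (- (?c * norm x)\<^sup>2 / 2)) * ennreal (cmod (g (sqrt (2 / p) *\<^sub>R (?c *\<^sub>R x))) powr p)) \<partial>lborel)"
    using b by (simp add: ennreal_mult)
  also have "\<dots> = ennreal ?A * (ennreal ((2 * pi) powr (real ?d / 2) / ?c ^ ?d) * (\<integral>\<^sup>+x. ennreal (cmod (g (sqrt (2 / p) *\<^sub>R x)) powr p) \<partial>gauss))"
    by (subst nn_integral_cmult, measurable, subst nn_integral_gauss_scaled[OF _ c]) auto
  also have "\<dots> = ennreal (?A * ((2 * pi) powr (real ?d / 2) / ?c ^ ?d)) * (\<integral>\<^sup>+x. ennreal (cmod (g (sqrt (2 / p) *\<^sub>R x)) powr p) \<partial>gauss)"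
    using b c by (subst ennreal_mult) (auto simp: mult.assoc)
  also have "?A * ((2 * pi) powr (real ?d / 2) / ?c ^ ?d) = ((b / cmod z) powr (p / 2) * sqrt (2 * pi) * cmod z / sqrt (p * b / 2)) ^ ?d"
  proof -
    have "(2 * pi) powr (real ?d / 2) = sqrt (2 * pi) ^ ?d"
      by (simp add: powr_half_sqrt[symmetric] powr_powr powr_realpow[symmetric])
    then show ?thesis using b p z0 by (simp only: power_mult_distrib power_divide) (simp add: field_simps)
  qed
  finally show ?thesis .
qed

text \<open>For \<open>p = 2\<close> the dilation disappears and the constant is independent of \<open>z\<close>: the lens transform is a multiple of an isometry.\<close>

lemma sqnorm_lens_transform:
  fixes g :: "real ^ 'n \<Rightarrow> complex"
  assumes b: "0 < b" and z: "Re z = b" and g: "g \<in> borel_measurable borel"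
  shows "sqnorm lborel (lens_transform b z g) = ennreal (sqrt (2 * pi * b) ^ CARD('n)) * sqnorm gauss g"
proof -
  have z0: "0 < cmod z" using assms by auto
  have sq: "cmod a powr 2 = (cmod a)\<^sup>2" for a by simp
  have "(b / cmod z) powr (2 / 2) * sqrt (2 * pi) * cmod z / sqrt (2 * b / 2) = sqrt (2 * pi * b)"
  proof -
    have "b / sqrt b = sqrt b" using b by (simp add: real_div_sqrt)
    moreover have "b / cmod z * sqrt (2 * pi) * cmod z / sqrt b = sqrt (2 * pi) * (b / sqrt b)" using z0 by simp
    ultimately have "b / cmod z * sqrt (2 * pi) * cmod z / sqrt b = sqrt (2 * pi) * sqrt b" by simp
    then show ?thesis using b z0 by (simp add: real_sqrt_mult)
  qed
  then show ?thesis
    using nn_integral_lens_transform[OF b z _ g, of 2] unfolding sqnorm_def sq by simp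
qed

lemma lens_transform_diff:
  "lens_transform b z g x - lens_transform b z h x = lens_transform b z (\<lambda>y. g y - h y) x"
  by (simp add: lens_transform_def algebra_simps)

lemma lens_transform_L2:
  assumes "0 < b" "Re z = b" "g \<in> L2 gauss"
  shows "lens_transform b z g \<in> L2 lborel"
proof -
  have m: "g \<in> borel_measurable borel" using L2_measurable[OF assms(3)] by simp
  then show ?thesis
    using L2_finite[OF assms(3)] by (simp add: L2_iff sqnorm_lens_transform[OF assms(1,2) m] ennreal_mult_less_top)
qed

lemma hermite_heat_lens:
  fixes \<alpha> :: "nat ^ 'n \<Rightarrow> complex"
  assumes b: "0 < b" and z: "Re z = b"
  shows "(\<Sum>m\<in>I. \<alpha> m * hermite_heat m b 0 z x)
    = lens_transform b z (\<lambda>y. \<Sum>m\<in>I. (\<alpha> m * (complex_of_real (cmod z) / z) ^ multi_abs m) * hermite_multi m y) x"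
  unfolding lens_transform_def hermite_heat_hermite[OF b z] sum_distrib_left sum_distrib_right
  by (rule sum.cong) (auto simp: mult_ac)

section \<open>Hermite series with rotated coefficients\<close>

text \<open>A pointwise limit, so that \<open>hermite_series \<alpha> I \<omega> x\<close> is jointly measurable in \<open>\<omega>\<close> and \<open>x\<close>.\<close>

definition hermite_series :: "(nat ^ 'n \<Rightarrow> complex) \<Rightarrow> (nat \<Rightarrow> (nat ^ 'n) set) \<Rightarrow> complex \<Rightarrow> real ^ 'n \<Rightarrow> complex"
  where "hermite_series \<alpha> I \<omega> x = lim (\<lambda>k. \<Sum>m\<in>I k. (\<alpha> m * \<omega> ^ multi_abs m) * hermite_multi m x)"

text \<open>The weights do not see the phase \<open>\<omega>\<close>, so the same exhaustion \<open>I\<close> works on the whole unit circle, at a uniform rate.\<close>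

lemma hermite_series_properties:
  fixes \<alpha> :: "nat ^ 'n \<Rightarrow> complex"
  assumes I: "exhausts (series_weight gauss hermite_multi \<alpha>) I" and \<omega>: "cmod \<omega> = 1"
  shows "hermite_series \<alpha> I \<omega> \<in> L2 gauss"
    and "sqnorm gauss (\<lambda>x. hermite_series \<alpha> I \<omega> x - (\<Sum>m\<in>I k. (\<alpha> m * \<omega> ^ multi_abs m) * hermite_multi m x)) \<le> ennreal ((1 / 8) ^ k)"
    and "(\<lambda>k. sqnorm gauss (\<lambda>x. hermite_series \<alpha> I \<omega> x - (\<Sum>m\<in>I k. (\<alpha> m * \<omega> ^ multi_abs m) * hermite_multi m x))) \<longlonglongrightarrow> 0"
    and "L2_has_sum gauss (\<lambda>m x. (\<alpha> m * \<omega> ^ multi_abs m) * hermite_multi m x) (hermite_series \<alpha> I \<omega>)"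
proof -
  have "series_weight gauss hermite_multi (\<lambda>m. \<alpha> m * \<omega> ^ multi_abs m) = series_weight gauss hermite_multi \<alpha>"
    using \<omega> by (auto simp: series_weight_def norm_mult norm_power)
  with I have I': "exhausts (series_weight gauss hermite_multi (\<lambda>m. \<alpha> m * \<omega> ^ multi_abs m)) I" by simp
  note E = orthogonal_hermite_multi
  show "hermite_series \<alpha> I \<omega> \<in> L2 gauss"
    unfolding hermite_series_def[abs_def] by (rule orthogonal_series_limit(1)[OF E I'])
  show "sqnorm gauss (\<lambda>x. hermite_series \<alpha> I \<omega> x - (\<Sum>m\<in>I k. (\<alpha> m * \<omega> ^ multi_abs m) * hermite_multi m x)) \<le> ennreal ((1 / 8) ^ k)"
    unfolding hermite_series_def using I by (intro orthogonal_series_limit(2)[OF E I']) (auto simp: exhausts_def)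
  show "(\<lambda>k. sqnorm gauss (\<lambda>x. hermite_series \<alpha> I \<omega> x - (\<Sum>m\<in>I k. (\<alpha> m * \<omega> ^ multi_abs m) * hermite_multi m x))) \<longlonglongrightarrow> 0"
    unfolding hermite_series_def by (rule orthogonal_series_limit_seq[OF E I'])
  show "L2_has_sum gauss (\<lambda>m x. (\<alpha> m * \<omega> ^ multi_abs m) * hermite_multi m x) (hermite_series \<alpha> I \<omega>)"
    unfolding hermite_series_def[abs_def] by (rule L2_has_sum_orthogonal[OF E I'])
qed

lemma hermite_series_minus: "hermite_series \<alpha> I (- \<omega>) x = hermite_series \<alpha> I \<omega> (- x)"
  unfolding hermite_series_def hermite_multi_minus power_minus[of \<omega>] by (simp add: mult_ac)

lemma hermite_series_measurable [measurable]:
  "(\<lambda>(\<omega>, x). hermite_series \<alpha> I \<omega> x) \<in> borel_measurable (borel \<Otimes>\<^sub>M borel)"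
  unfolding hermite_series_def by measurable

section \<open>Evolution of Hermite series\<close>

text \<open>The finite partial sums evolve explicitly. Since the lens transform is isometric up to a constant and
  the series converges at a rate independent of \<open>\<omega>\<close>, they approximate the right-hand side uniformly in
  time, which is therefore a solution, and the only one.\<close>

lemma schroedinger_hermite_series:
  fixes \<alpha> :: "nat ^ 'n \<Rightarrow> complex"
  assumes I: "exhausts (series_weight gauss hermite_multi \<alpha>) I" and b: "0 < b"
    and f: "f \<in> borel_measurable borel"
    and f0: "AE x in lborel. f x = lens_transform b (complex_of_real b) (hermite_series \<alpha> I 1) x"
  shows "AE x in lborel. schroedinger t f x
    = lens_transform b (Complex b t) (hermite_series \<alpha> I (complex_of_real (cmod (Complex b t)) / Complex b t)) x"
proof -
  let ?\<omega> = "\<lambda>t. complex_of_real (cmod (Complex b t)) / Complex b t"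
  let ?u = "\<lambda>t. lens_transform b (Complex b t) (hermite_series \<alpha> I (?\<omega> t))"
  let ?v = "\<lambda>k z x. \<Sum>m\<in>I k. \<alpha> m * hermite_heat m b 0 z x"
  have nz: "Complex b t \<noteq> 0" for t using b by (auto simp: complex_eq_iff)
  have \<omega>: "cmod (?\<omega> t) = 1" for t using nz[of t] by (simp add: norm_divide)
  have fin: "finite (I k)" for k using I by (auto simp: exhausts_def)
  note hs = hermite_series_properties[OF I \<omega>]
  have [measurable]: "hermite_series \<alpha> I (?\<omega> t) \<in> borel_measurable borel" for t using L2_measurable[OF hs(1)] by simp
  have "schroedinger_solution f ?u"
  proof (rule schroedinger_solution_limit[where v = ?v and c = 0])
    show "?u t \<in> L2 lborel" for t by (rule lens_transform_L2[OF b _ hs(1)]) simp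
    show "0 < b" by (rule b)
    show "heat_solution 0 (?v k)" for k by (intro heat_solution_sum fin heat_solution_hermite_heat b)
    let ?K = "ennreal (sqrt (2 * pi * b) ^ CARD('n))"
    show "sqnorm lborel (\<lambda>x. ?u t x - ?v k (Complex b t) x) \<le> ?K * ennreal ((1 / 8) ^ k)" for k t
    proof -
      have z: "Re (Complex b t) = b" by simp
      have "sqnorm lborel (\<lambda>x. ?u t x - ?v k (Complex b t) x)
        = sqnorm lborel (lens_transform b (Complex b t) (\<lambda>x. hermite_series \<alpha> I (?\<omega> t) x - (\<Sum>m\<in>I k. (\<alpha> m * ?\<omega> t ^ multi_abs m) * hermite_multi m x)))"
        unfolding hermite_heat_lens[OF b z] lens_transform_diff ..
      also have "\<dots> = ?K * sqnorm gauss (\<lambda>x. hermite_series \<alpha> I (?\<omega> t) x - (\<Sum>m\<in>I k. (\<alpha> m * ?\<omega> t ^ multi_abs m) * hermite_multi m x))"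
        by (rule sqnorm_lens_transform[OF b z]) measurable
      also have "\<dots> \<le> ?K * ennreal ((1 / 8) ^ k)" by (intro mult_left_mono hs(2)) auto
      finally show ?thesis .
    qed
    show "(\<lambda>k. ?K * ennreal ((1 / 8) ^ k)) \<longlonglongrightarrow> 0"
      using ennreal_tendsto_cmult[OF ennreal_less_top power_eighth_tendsto_0] by simp
    have "Complex b 0 = complex_of_real b" by (simp add: complex_eq_iff)
    moreover have "?\<omega> 0 = 1" using b calculation by simp
    ultimately show "AE x in lborel. ?u 0 x = f x" using f0 by (auto elim: eventually_mono)
  qed
  then have "schroedinger_solution f (SOME u. schroedinger_solution f u)" by (rule someI[where P = "schroedinger_solution f"])
  from schroedinger_solution_unique[OF this \<open>schroedinger_solution f ?u\<close> f, of t]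
  show ?thesis by (simp add: schroedinger_def)
qed

section \<open>Operators on Hermite series\<close>

text \<open>Both operators are evaluated on the partial sums; \<open>T_op (- \<i>)\<close> merely adds \<open>- \<i>\<close> to the rotation.\<close>

lemma H_op_T_op_hermite_series:
  fixes \<alpha> :: "nat ^ 'n \<Rightarrow> complex"
  assumes I: "exhausts (series_weight gauss hermite_multi \<alpha>) I" and p: "2 \<le> p"
    and g: "AE x in gauss. g x = hermite_series \<alpha> I 1 x" "g \<in> L2 gauss"
  shows "AE x in gauss. H_op p t (T_op (- \<i>) g) x = hermite_series \<alpha> I (- \<i> * cis (2 * pi * t)) (sqrt (2 / p) *\<^sub>R x)"
proof -
  let ?c = "sqrt (2 / p)"
  let ?w = "- \<i> * cis (2 * pi * t)"
  have c: "0 < ?c" "?c \<le> 1" using p by auto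
  have fin: "finite (I k)" for k using I by (auto simp: exhausts_def)
  have T_def: "T_op (- \<i>) = hermite_operator (\<lambda>m (x :: real ^ 'n). (- \<i>) ^ multi_abs m * hermite_multi m (1 *\<^sub>R x))"
    by (simp add: T_op_def)
  have T: "L2_operator gauss (T_op (- \<i>) :: (real ^ 'n \<Rightarrow> complex) \<Rightarrow> _)"
    "AE x in gauss. T_op (- \<i>) (hermite_multi m) x = (- \<i>) ^ multi_abs m * hermite_multi m x" for m :: "nat ^ 'n"
    using hermite_operator_spec[where \<mu> = "\<lambda>m :: nat ^ 'n. (- \<i>) ^ multi_abs m" and c = 1]
    unfolding T_def by (auto simp: norm_power)
  have e: "exp (2 * complex_of_real pi * of_nat n * \<i> * complex_of_real t) = cis (2 * pi * t) ^ n" for n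
    by (simp add: cis_conv_exp exp_of_nat_mult[symmetric] mult_ac)
  have H: "L2_operator gauss (H_op p t :: (real ^ 'n \<Rightarrow> complex) \<Rightarrow> _)"
    "AE x in gauss. H_op p t (hermite_multi m) x = cis (2 * pi * t) ^ multi_abs m * hermite_multi m (?c *\<^sub>R x)" for m :: "nat ^ 'n"
    unfolding H_op_def e
    by (rule hermite_operator_spec[where \<mu> = "\<lambda>m :: nat ^ 'n. cis (2 * pi * t) ^ multi_abs m", OF _ c]; simp add: norm_power)+
  have one: "cmod (1 :: complex) = 1" "cmod ?w = 1" by (auto simp: norm_mult)
  note hs1 = hermite_series_properties[OF I one(1)] and hsw = hermite_series_properties[OF I one(2)]
  have hm: "hermite_series \<alpha> I ?w \<in> borel_measurable borel" using L2_measurable[OF hsw(1)] by simp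
  have "sqnorm gauss (\<lambda>x. g x - (\<Sum>m\<in>I k. \<alpha> m * hermite_multi m x)) = sqnorm gauss (\<lambda>x. hermite_series \<alpha> I 1 x - (\<Sum>m\<in>I k. \<alpha> m * hermite_multi m x))" for k
    using g(1) by (intro sqnorm_cong_AE) (auto elim: eventually_mono)
  then have lim: "(\<lambda>k. sqnorm gauss (\<lambda>x. g x - (\<Sum>m\<in>I k. \<alpha> m * hermite_multi m x))) \<longlonglongrightarrow> 0"
    using hs1(3) by simp
  have "(\<lambda>k. sqnorm gauss (\<lambda>x. T_op (- \<i>) g x - (\<Sum>m\<in>I k. \<alpha> m * ((- \<i>) ^ multi_abs m * hermite_multi m x)))) \<longlonglongrightarrow> 0"
    by (rule L2_operator_series[OF T(1) hermite_multi_L2 T(2) g(2) fin lim])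
  then have lim2: "(\<lambda>k. sqnorm gauss (\<lambda>x. T_op (- \<i>) g x - (\<Sum>m\<in>I k. (\<alpha> m * (- \<i>) ^ multi_abs m) * hermite_multi m x))) \<longlonglongrightarrow> 0"
    by (simp only: mult.assoc)
  have TL: "T_op (- \<i>) g \<in> L2 gauss" by (rule L2_operator_in[OF T(1) g(2)])
  let ?S = "\<lambda>k x. \<Sum>m\<in>I k. (\<alpha> m * ?w ^ multi_abs m) * hermite_multi m (?c *\<^sub>R x)"
  have "(\<lambda>k. sqnorm gauss (\<lambda>x. H_op p t (T_op (- \<i>) g) x - (\<Sum>m\<in>I k. (\<alpha> m * (- \<i>) ^ multi_abs m) * (cis (2 * pi * t) ^ multi_abs m * hermite_multi m (?c *\<^sub>R x))))) \<longlonglongrightarrow> 0"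
    by (rule L2_operator_series[OF H(1) hermite_multi_L2 H(2) TL fin lim2])
  then have 1: "(\<lambda>k. sqnorm gauss (\<lambda>x. H_op p t (T_op (- \<i>) g) x - ?S k x)) \<longlonglongrightarrow> 0"
    by (simp only: mult.assoc power_mult_distrib)
  have le: "sqnorm gauss (\<lambda>x. hermite_series \<alpha> I ?w (?c *\<^sub>R x) - ?S k x)
      \<le> ennreal (1 / ?c ^ CARD('n)) * sqnorm gauss (\<lambda>x. hermite_series \<alpha> I ?w x - (\<Sum>m\<in>I k. (\<alpha> m * ?w ^ multi_abs m) * hermite_multi m x))" for k
    by (rule sqnorm_gauss_dilation[OF _ c, of "\<lambda>x. hermite_series \<alpha> I ?w x - (\<Sum>m\<in>I k. (\<alpha> m * ?w ^ multi_abs m) * hermite_multi m x)"])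
      (use hm in measurable)
  have upper: "(\<lambda>k. ennreal (1 / ?c ^ CARD('n)) * sqnorm gauss (\<lambda>x. hermite_series \<alpha> I ?w x - (\<Sum>m\<in>I k. (\<alpha> m * ?w ^ multi_abs m) * hermite_multi m x))) \<longlonglongrightarrow> 0"
    using ennreal_tendsto_cmult[OF ennreal_less_top hsw(3)] by simp
  have 2: "(\<lambda>k. sqnorm gauss (\<lambda>x. hermite_series \<alpha> I ?w (?c *\<^sub>R x) - ?S k x)) \<longlonglongrightarrow> 0"
    by (rule tendsto_sandwich[OF _ always_eventually[OF allI[OF le]] tendsto_const upper]) simp
  show ?thesis
  proof (rule L2_limit_unique[OF _ _ _ 1 2])
    show "H_op p t (T_op (- \<i>) g) \<in> borel_measurable gauss" by (rule L2_measurable[OF L2_operator_in[OF H(1) TL]])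
    show "(\<lambda>x. hermite_series \<alpha> I ?w (?c *\<^sub>R x)) \<in> borel_measurable gauss" using hm by measurable
    show "?S k \<in> borel_measurable gauss" for k by measurable
  qed simp
qed

section \<open>Compactified time\<close>

text \<open>The angle swept until time \<open>t\<close>, measured in full turns. All of real time covers an open half turn.\<close>

definition arctan_time :: "real \<Rightarrow> real"
  where "arctan_time t = arctan (4 * pi * t) / (2 * pi)"

lemma arctan_time_mono: "x \<le> y \<Longrightarrow> arctan_time x \<le> arctan_time y"
  unfolding arctan_time_def by (intro divide_right_mono arctan_monotone' mult_left_mono) auto

lemma arctan_time_bounds: "- (1 / 4) < arctan_time t" "arctan_time t < 1 / 4"
  using arctan_bounded[of "4 * pi * t"] by (auto simp: arctan_time_def field_simps)

lemma borel_measurable_arctan_time [measurable]: "arctan_time \<in> borel_measurable borel"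
  unfolding arctan_time_def[abs_def] by (intro borel_measurable_continuous_onI continuous_intros) auto

lemma arctan_time_exhaust: "(\<Union>n. {arctan_time (- real n)..arctan_time (real n)}) = {- (1 / 4)<..<1 / 4}"
proof (intro equalityI subsetI)
  fix y assume "y \<in> (\<Union>n. {arctan_time (- real n)..arctan_time (real n)})"
  then obtain n where "arctan_time (- real n) \<le> y" "y \<le> arctan_time (real n)" by auto
  then show "y \<in> {- (1 / 4)<..<1 / 4}"
    using arctan_time_bounds(1)[of "- real n"] arctan_time_bounds(2)[of "real n"] by simp
next
  fix y :: real assume y: "y \<in> {- (1 / 4)<..<1 / 4}"
  have "arctan (tan (2 * pi * y)) = 2 * pi * y"
    using y mult_strict_left_mono[of "- 1 / 4" y "2 * pi"] mult_strict_left_mono[of y "1 / 4" "2 * pi"]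
    by (intro arctan_tan) auto
  then have eq: "arctan_time (tan (2 * pi * y) / (4 * pi)) = y" by (simp add: arctan_time_def)
  obtain n :: nat where n: "\<bar>tan (2 * pi * y) / (4 * pi)\<bar> \<le> real n" using real_arch_simple by blast
  have "arctan_time (- real n) \<le> y" "y \<le> arctan_time (real n)"
    using n by (subst eq[symmetric]; intro arctan_time_mono; linarith)+
  then show "y \<in> (\<Union>n. {arctan_time (- real n)..arctan_time (real n)})" by auto
qed

text \<open>Change of variable from time to angle. It is proved as an equality of two measures on the line, because
  the integrand \<open>Q\<close> may take the value \<open>\<infinity>\<close>. Compact intervals exhaust the line.\<close>

lemma nn_integral_arctan_time:
  fixes Q :: "real \<Rightarrow> ennreal"
  assumes [measurable]: "Q \<in> borel_measurable borel"
  shows "(\<integral>\<^sup>+t. ennreal (2 / (1 + (4 * pi * t)\<^sup>2)) * Q (arctan_time t) \<partial>lborel)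
    = (\<integral>\<^sup>+y. indicator {- (1 / 4)<..<1 / 4} y * Q y \<partial>lborel)"
proof -
  let ?w = "\<lambda>t. 2 / (1 + (4 * pi * t)\<^sup>2)"
  let ?M = "distr (density lborel (\<lambda>t. ennreal (?w t))) borel arctan_time"
  let ?N = "density lborel (indicator {- (1 / 4)<..<1 / 4 :: real})"
  have nz: "1 + (4 * pi * t)\<^sup>2 \<noteq> 0" for t :: real
    using zero_le_power2[of "4 * pi * t"] by linarith
  have d: "(arctan_time has_real_derivative ?w t) (at t)" for t
  proof -
    have 1: "((\<lambda>t. 4 * pi * t) has_real_derivative 4 * pi) (at t)"
      by (rule DERIV_cmult_Id)
    have 2: "inverse w * (4 * pi) / (2 * pi) = 2 / w" for w :: real by (cases "w = 0") (simp_all add: field_simps)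
    from DERIV_cdivide[OF DERIV_chain2[OF DERIV_arctan 1], of "2 * pi"]
    show ?thesis unfolding arctan_time_def[abs_def] 2 .
  qed
  have "?M = ?N"
  proof (rule measure_eqI)
    fix A assume "A \<in> sets ?M"
    then have [measurable]: "A \<in> sets borel" by simp
    have [measurable]: "arctan_time -` A \<in> sets borel"
      using measurable_sets[OF borel_measurable_arctan_time, of A] by simp
    let ?f = "indicator A :: real \<Rightarrow> real"
    have sub: "(\<integral>\<^sup>+y. ennreal (?f y) * indicator {arctan_time (- real n)..arctan_time (real n)} y \<partial>lborel)
      = (\<integral>\<^sup>+t. ennreal (?f (arctan_time t) * ?w t) * indicator {- real n..real n} t \<partial>lborel)" for n
    proof -
      have "(\<integral>\<^sup>+y. ennreal (?f y * indicator {arctan_time (- real n)..arctan_time (real n)} y) \<partial>lborel)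
        = (\<integral>\<^sup>+t. ennreal (?f (arctan_time t) * ?w t * indicator {- real n..real n} t) \<partial>lborel)"
        by (rule nn_integral_substitution)
          (use d nz in \<open>auto simp: set_borel_measurable_def intro!: continuous_intros\<close>)
      moreover have "ennreal (a * indicator S x) = ennreal a * indicator S x" for a x :: real and S
        by (auto split: split_indicator)
      ultimately show ?thesis by (simp only:)
    qed
    have "emeasure ?M A = (\<integral>\<^sup>+t. ennreal (?w t) * indicator (arctan_time -` A) t \<partial>lborel)"
      by (subst emeasure_distr) (auto simp: emeasure_density)
    also have "\<dots> = (\<integral>\<^sup>+t. ennreal (?f (arctan_time t) * ?w t) \<partial>lborel)"
      by (rule nn_integral_cong) (auto split: split_indicator)
    also have "\<dots> = emeasure (density lborel (\<lambda>t. ennreal (?f (arctan_time t) * ?w t))) (\<Union>n. {- real n..real n})"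
    proof -
      have "(\<Union>n. {- real n..real n}) = UNIV"
      proof (intro equalityI subset_UNIV subsetI)
        fix t :: real
        obtain n :: nat where "\<bar>t\<bar> \<le> real n" using real_arch_simple by blast
        then show "t \<in> (\<Union>n. {- real n..real n})" by (intro UN_I[of n]) auto
      qed
      then show ?thesis by (simp add: emeasure_density)
    qed
    also have "\<dots> = (SUP n. emeasure (density lborel (\<lambda>t. ennreal (?f (arctan_time t) * ?w t))) {- real n..real n})"
      by (rule SUP_emeasure_incseq[symmetric]) (auto simp: incseq_def)
    also have "\<dots> = (SUP n. emeasure (density lborel (\<lambda>y. ennreal (?f y))) {arctan_time (- real n)..arctan_time (real n)})"
      by (subst (1 2) emeasure_density) (auto simp: sub)
    also have "\<dots> = emeasure (density lborel (\<lambda>y. ennreal (?f y))) (\<Union>n. {arctan_time (- real n)..arctan_time (real n)})"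
    proof (rule SUP_emeasure_incseq)
      show "incseq (\<lambda>n. {arctan_time (- real n)..arctan_time (real n)})"
        unfolding incseq_def
        using arctan_time_mono by (auto intro: order_trans)
    qed auto
    also have "\<dots> = emeasure ?N A"
      unfolding arctan_time_exhaust
      by (subst (1 2) emeasure_density) (auto intro!: nn_integral_cong split: split_indicator)
    finally show "emeasure ?M A = emeasure ?N A" .
  qed simp
  then have "(\<integral>\<^sup>+y. Q y \<partial>?M) = (\<integral>\<^sup>+y. Q y \<partial>?N)" by simp
  then show ?thesis by (simp add: nn_integral_distr nn_integral_density)
qed

text \<open>An interval of length \<open>1\<close> consists of two periods. The shift by \<open>1/4\<close> and the reflection leave the
  integral over a period unchanged.\<close>

lemma nn_integral_half_periodic:
  fixes Q :: "real \<Rightarrow> ennreal"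
  assumes [measurable]: "Q \<in> borel_measurable borel" and per: "\<And>y. Q (y + 1 / 2) = Q y"
  shows "(\<integral>\<^sup>+t. Q (t - 1 / 4) * indicator {- 1 / 2..1 / 2} t \<partial>lborel)
    = 2 * (\<integral>\<^sup>+y. indicator {- (1 / 4)<..<1 / 4} y * Q (- y) \<partial>lborel)"
proof -
  let ?i = "indicator {- (1 / 4)<..<1 / 4 :: real} :: real \<Rightarrow> ennreal"
  have "(\<integral>\<^sup>+t. Q (t - 1 / 4) * indicator {- 1 / 2..1 / 2} t \<partial>lborel)
    = (\<integral>\<^sup>+y. Q y * indicator {- 3 / 4..1 / 4} y \<partial>lborel)"
    by (subst nn_integral_real_affine[where c = 1 and t = "1 / 4"])
      (auto intro!: nn_integral_cong split: split_indicator)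
  also have "\<dots> = (\<integral>\<^sup>+y. ?i y * Q y + ?i (y + 1 / 2) * Q (y + 1 / 2) \<partial>lborel)"
  proof (rule nn_integral_cong_AE)
    have "AE y :: real in lborel. y \<noteq> - 3 / 4" "AE y :: real in lborel. y \<noteq> - 1 / 4" "AE y :: real in lborel. y \<noteq> 1 / 4"
      by (rule AE_lborel_singleton)+
    then show "AE y in lborel. Q y * indicator {- 3 / 4..1 / 4} y = ?i y * Q y + ?i (y + 1 / 2) * Q (y + 1 / 2)"
      by eventually_elim (auto simp: per split: split_indicator)
  qed
  also have "\<dots> = (\<integral>\<^sup>+y. ?i y * Q y \<partial>lborel) + (\<integral>\<^sup>+y. ?i (y + 1 / 2) * Q (y + 1 / 2) \<partial>lborel)"
    by (rule nn_integral_add) auto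
  also have "(\<integral>\<^sup>+y. ?i (y + 1 / 2) * Q (y + 1 / 2) \<partial>lborel) = (\<integral>\<^sup>+y. ?i y * Q y \<partial>lborel)"
    by (subst (2) nn_integral_real_affine[where c = 1 and t = "1 / 2"]) (auto simp: add.commute)
  also have "(\<integral>\<^sup>+y. ?i y * Q y \<partial>lborel) = (\<integral>\<^sup>+y. ?i y * Q (- y) \<partial>lborel)"
    by (subst nn_integral_real_affine[where c = "- 1" and t = 0])
      (auto intro!: nn_integral_cong split: split_indicator)
  finally show ?thesis by (simp only: mult_2)
qed

lemma cmod_time: "cmod (Complex (1 / (4 * pi)) t) = sqrt (1 + (4 * pi * t)\<^sup>2) / (4 * pi)"
proof -
  have "(1 / (4 * pi))\<^sup>2 + t\<^sup>2 = (1 + (4 * pi * t)\<^sup>2) / (4 * pi)\<^sup>2" by (simp add: field_simps power2_eq_square)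
  then show ?thesis by (simp only: cmod_def complex.sel real_sqrt_divide real_sqrt_abs) simp
qed

text \<open>The argument of \<open>b + i t\<close> is \<open>arctan (t / b)\<close>, here with \<open>b = 1 / (4\<pi>)\<close>.\<close>

lemma cis_arctan_time:
  "complex_of_real (cmod (Complex (1 / (4 * pi)) t)) / Complex (1 / (4 * pi)) t = cis (2 * pi * - arctan_time t)"
proof -
  let ?z = "Complex (1 / (4 * pi)) t" and ?T = "4 * pi * t"
  have nz: "cmod ?z \<noteq> 0" by (auto simp: complex_eq_iff)
  note cm = cmod_time[of t]
  have "complex_of_real (cmod ?z) / ?z = cnj ?z / complex_of_real (cmod ?z)"
    using nz complex_norm_square[of ?z] by (auto simp: field_simps power2_eq_square)
  also have "\<dots> = cis (- arctan ?T)"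
    unfolding cm by (rule complex_eqI) (simp_all add: cos_arctan sin_arctan mult_ac)
  finally show ?thesis by (simp add: arctan_time_def)
qed

lemma sqrt_4pi: "sqrt (1 / (4 * pi)) / cmod (complex_of_real (1 / (4 * pi))) = sqrt (4 * pi)"
proof -
  have "sqrt (1 / (4 * pi)) / cmod (complex_of_real (1 / (4 * pi))) = (4 * pi) / sqrt (4 * pi)"
    by (simp only: norm_of_real) (simp add: real_sqrt_divide)
  also have "\<dots> = sqrt (4 * pi)" by (rule real_div_sqrt) simp
  finally show ?thesis .
qed

section \<open>The two identities\<close>

lemma hermite_fun_lens: "hermite_fun m x = lens_transform (1 / (4 * pi)) (complex_of_real (1 / (4 * pi))) (hermite_multi m) x"
proof -
  have 1: "complex_of_real (sqrt (1 / (4 * pi))) / csqrt (complex_of_real (1 / (4 * pi))) = 1"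
    by (subst of_real_sqrt[symmetric]) auto
  note 2 = sqrt_4pi
  have 3: "- complex_of_real ((norm x)\<^sup>2) / (4 * complex_of_real (1 / (4 * pi))) = complex_of_real (- pi * (norm x)\<^sup>2)"
    by simp
  show ?thesis unfolding lens_transform_def 1 2 3 hermite_fun_def exp_of_real by simp
qed

lemma inverse_lens_transform:
  fixes f :: "real ^ 'n \<Rightarrow> complex"
  defines "F \<equiv> \<lambda>y. f ((1 / sqrt (4 * pi)) *\<^sub>R y) * complex_of_real (exp ((norm y)\<^sup>2 / 4))"
  shows "lens_transform (1 / (4 * pi)) (complex_of_real (1 / (4 * pi))) F x = f x"
proof -
  have 1: "complex_of_real (sqrt (1 / (4 * pi))) / csqrt (complex_of_real (1 / (4 * pi))) = 1"
    by (subst of_real_sqrt[symmetric]) auto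
  note 2 = sqrt_4pi
  have 3: "- complex_of_real ((norm x)\<^sup>2) / (4 * complex_of_real (1 / (4 * pi))) = complex_of_real (- pi * (norm x)\<^sup>2)"
    by simp
  show ?thesis unfolding lens_transform_def 1 2 3 F_def exp_of_real
    by (simp add: power_mult_distrib of_real_mult[symmetric] exp_add[symmetric] del: of_real_mult)
qed

text \<open>At \<open>z = b = 1 / (4\<pi>)\<close> the lens transform maps \<open>hermite_multi m\<close> to \<open>hermite_fun m\<close>, it is invertible, and
  it multiplies all norms by the same constant, so that it carries one expansion to the other.\<close>

lemma L2_has_sum_transfer:
  fixes f :: "real ^ 'n \<Rightarrow> complex"
  assumes s: "L2_has_sum lborel (\<lambda>m x. \<alpha> m * hermite_fun m x) f"
  obtains F where "L2_has_sum gauss (\<lambda>m x. \<alpha> m * hermite_multi m x) F"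
    "\<And>x. f x = lens_transform (1 / (4 * pi)) (complex_of_real (1 / (4 * pi))) F x"
proof -
  let ?b = "1 / (4 * pi)"
  let ?L = "lens_transform ?b (complex_of_real ?b) :: (real ^ 'n \<Rightarrow> complex) \<Rightarrow> _"
  define F where "F = (\<lambda>y. f ((1 / sqrt (4 * pi)) *\<^sub>R y) * complex_of_real (exp ((norm y)\<^sup>2 / 4)))"
  have fL: "f \<in> L2 lborel" using s by (simp add: L2_has_sum_def)
  have [measurable]: "f \<in> borel_measurable borel" using L2_measurable[OF fL] by simp
  have mF [measurable]: "F \<in> borel_measurable borel" unfolding F_def by measurable
  have f: "f x = ?L F x" for x unfolding F_def by (rule inverse_lens_transform[symmetric])
  let ?K = "sqrt (2 * pi * ?b) ^ CARD('n)"
  have K: "0 < ?K" by simp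
  have sq: "sqnorm gauss g = ennreal (1 / ?K) * sqnorm lborel (?L g)" if "g \<in> borel_measurable borel" for g
  proof -
    have "sqnorm lborel (?L g) = ennreal ?K * sqnorm gauss g" by (rule sqnorm_lens_transform) (use that in auto)
    then show ?thesis using K by (simp add: mult.assoc[symmetric] ennreal_mult[symmetric])
  qed
  have "L2_has_sum gauss (\<lambda>m x. \<alpha> m * hermite_multi m x) F"
    unfolding L2_has_sum_iff_sqnorm
  proof (intro conjI allI)
    show "(\<lambda>x. \<alpha> m * hermite_multi m x) \<in> L2 gauss" for m by (intro L2_cmult hermite_multi_L2)
    have "sqnorm gauss F < \<infinity>"
    proof -
      have "?L F = f" by (rule ext) (simp only: f)
      then show ?thesis unfolding sq[OF mF] using L2_finite[OF fL] by (simp add: ennreal_mult_less_top)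
    qed
    then show "F \<in> L2 gauss" by (simp add: L2_iff)
    have "sqnorm gauss (\<lambda>x. F x - (\<Sum>m\<in>I. \<alpha> m * hermite_multi m x))
      = ennreal (1 / ?K) * sqnorm lborel (\<lambda>x. f x - (\<Sum>m\<in>I. \<alpha> m * hermite_fun m x))" for I
    proof -
      have "?L (\<lambda>x. F x - (\<Sum>m\<in>I. \<alpha> m * hermite_multi m x)) x = f x - (\<Sum>m\<in>I. \<alpha> m * hermite_fun m x)" for x
      proof -
        have "(\<Sum>m\<in>I. \<alpha> m * hermite_fun m x) = ?L (\<lambda>x. \<Sum>m\<in>I. \<alpha> m * hermite_multi m x) x"
          unfolding hermite_fun_lens by (simp add: lens_transform_def sum_distrib_left sum_distrib_right mult_ac)
        then show ?thesis by (simp only: f lens_transform_diff)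
      qed
      then have "?L (\<lambda>x. F x - (\<Sum>m\<in>I. \<alpha> m * hermite_multi m x)) = (\<lambda>x. f x - (\<Sum>m\<in>I. \<alpha> m * hermite_fun m x))" by (rule ext)
      moreover have "(\<lambda>x. F x - (\<Sum>m\<in>I. \<alpha> m * hermite_multi m x)) \<in> borel_measurable borel" by measurable
      ultimately show ?thesis by (simp only: sq)
    qed
    then show "((\<lambda>I. sqnorm gauss (\<lambda>x. F x - (\<Sum>m\<in>I. \<alpha> m * hermite_multi m x))) \<longlongrightarrow> 0) (finite_subsets_at_top UNIV)"
      using s ennreal_tendsto_cmult[of "ennreal (1 / ?K)" "\<lambda>I. sqnorm lborel (\<lambda>x. f x - (\<Sum>m\<in>I. \<alpha> m * hermite_fun m x))" 0]
      by (simp add: L2_has_sum_iff_sqnorm)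
  qed
  then show ?thesis using f by (rule that)
qed

definition hermite_mean :: "real \<Rightarrow> (nat ^ 'n \<Rightarrow> complex) \<Rightarrow> (nat \<Rightarrow> (nat ^ 'n) set) \<Rightarrow> complex \<Rightarrow> ennreal"
  where "hermite_mean p \<alpha> I \<omega> = (\<integral>\<^sup>+x. ennreal (cmod (hermite_series \<alpha> I \<omega> (sqrt (2 / p) *\<^sub>R x)) powr p) \<partial>gauss)"

lemma hermite_series_measurable_x [measurable]: "hermite_series \<alpha> I \<omega> \<in> borel_measurable borel"
  unfolding hermite_series_def[abs_def] by measurable

text \<open>The polynomials \<open>H\<^sub>m\<close> have the parity of \<open>\<bar>m\<bar>\<close>, and the Gaussian measure is symmetric.\<close>

lemma hermite_mean_minus: "hermite_mean p \<alpha> I (- \<omega>) = hermite_mean p \<alpha> I \<omega>"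
proof -
  have "hermite_mean p \<alpha> I (- \<omega>) = (\<integral>\<^sup>+x. ennreal (cmod (hermite_series \<alpha> I \<omega> (sqrt (2 / p) *\<^sub>R (- x))) powr p) \<partial>gauss)"
    unfolding hermite_mean_def hermite_series_minus by simp
  also have "\<dots> = hermite_mean p \<alpha> I \<omega>"
    unfolding hermite_mean_def
    by (rule nn_integral_gauss_minus[of "\<lambda>x. ennreal (cmod (hermite_series \<alpha> I \<omega> (sqrt (2 / p) *\<^sub>R x)) powr p)"]) measurable
  finally show ?thesis .
qed

lemma hermite_mean_measurable [measurable]: "hermite_mean p \<alpha> I \<in> borel_measurable borel"
proof -
  interpret prob_space "gauss :: (real ^ 'a) measure" by (rule prob_space_gauss)
  show ?thesis unfolding hermite_mean_def[abs_def] by measurable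
qed

lemma borel_measurable_cis [measurable]: "cis \<in> borel_measurable borel"
  by (intro borel_measurable_continuous_onI continuous_intros)

text \<open>The constant of the lens transform in terms of \<open>s = \<surd>(1 + (4\<pi>t)\<^sup>2) = \<bar>z\<bar> / b\<close>.\<close>

lemma Lp_norm_schroedinger:
  fixes \<alpha> :: "nat ^ 'n \<Rightarrow> complex"
  assumes I: "exhausts (series_weight gauss hermite_multi \<alpha>) I" and p: "2 \<le> p"
    and f: "f \<in> borel_measurable borel"
    and f0: "AE x in lborel. f x = lens_transform (1 / (4 * pi)) (complex_of_real (1 / (4 * pi))) (hermite_series \<alpha> I 1) x"
  shows "Lp_norm lborel p (schroedinger t f) = ennreal_powr
    (ennreal ((sqrt (1 + (4 * pi * t)\<^sup>2) powr (1 - p / 2) * p powr (- 1 / 2)) ^ CARD('n))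
      * hermite_mean p \<alpha> I (cis (2 * pi * - arctan_time t))) (1 / p)"
proof -
  let ?b = "1 / (4 * pi)"
  let ?z = "Complex ?b t"
  let ?s = "sqrt (1 + (4 * pi * t)\<^sup>2)"
  have s: "0 < ?s" by (simp add: add_pos_nonneg)
  have b: "0 < ?b" by simp
  have ae: "AE x in lborel. schroedinger t f x = lens_transform ?b ?z (hermite_series \<alpha> I (cis (2 * pi * - arctan_time t))) x"
    using schroedinger_hermite_series[OF I b f f0, of t] by (simp only: cis_arctan_time)
  have "(\<integral>\<^sup>+x. ennreal_powr (ennreal (cmod (schroedinger t f x))) p \<partial>lborel)
    = (\<integral>\<^sup>+x. ennreal (cmod (lens_transform ?b ?z (hermite_series \<alpha> I (cis (2 * pi * - arctan_time t))) x) powr p) \<partial>lborel)"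
    by (rule nn_integral_cong_AE) (use ae in \<open>auto elim!: eventually_mono simp: ennreal_powr_ennreal\<close>)
  also have "\<dots> = ennreal (((?b / cmod ?z) powr (p / 2) * sqrt (2 * pi) * cmod ?z / sqrt (p * ?b / 2)) ^ CARD('n))
      * hermite_mean p \<alpha> I (cis (2 * pi * - arctan_time t))"
    unfolding hermite_mean_def by (rule nn_integral_lens_transform[OF b]) (use p in auto)
  also have "(?b / cmod ?z) powr (p / 2) * sqrt (2 * pi) * cmod ?z / sqrt (p * ?b / 2) = ?s powr (1 - p / 2) * p powr (- 1 / 2)"
  proof -
    have c: "cmod ?z = ?s * ?b" unfolding cmod_time by simp
    have 1: "(?b / cmod ?z) powr (p / 2) = ?s powr (- (p / 2))"
    proof -
      have "?b / cmod ?z = inverse ?s" unfolding c using s by (simp add: field_simps)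
      then show ?thesis using s by (simp only: powr_minus inverse_powr)
    qed
    have 2: "sqrt (2 * pi) * ?b / sqrt (p * ?b / 2) = p powr (- 1 / 2)"
    proof -
      have "sqrt (2 * pi) * ?b / sqrt (p * ?b / 2) = sqrt (2 * pi) * sqrt (?b\<^sup>2) / sqrt (p * ?b / 2)" by simp
      also have "\<dots> = sqrt (2 * pi * ?b\<^sup>2 / (p * ?b / 2))" by (simp only: real_sqrt_mult real_sqrt_divide)
      also have "2 * pi * ?b\<^sup>2 / (p * ?b / 2) = inverse p" using p by (simp add: field_simps power2_eq_square)
      also have "sqrt (inverse p) = p powr (- 1 / 2)"
        using p by (simp add: real_sqrt_inverse powr_minus powr_half_sqrt)
      finally show ?thesis .
    qed
    have "(?b / cmod ?z) powr (p / 2) * sqrt (2 * pi) * cmod ?z / sqrt (p * ?b / 2)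
      = (?s powr (- (p / 2)) * ?s) * (sqrt (2 * pi) * ?b / sqrt (p * ?b / 2))"
      unfolding 1 unfolding c by simp
    also have "?s powr (- (p / 2)) * ?s = ?s powr (1 - p / 2)"
      using s powr_add[of ?s "- (p / 2)" 1] by (simp add: add.commute)
    finally show ?thesis unfolding 2 .
  qed
  finally show ?thesis by (simp only: Lp_norm_def Lp_norm_ennreal_def)
qed

text \<open>The first identity is the change of variable from time to angle. The factor \<open>1/4\<close> between the two
  integrals is \<open>1/2\<close> from the Jacobian times \<open>1/2\<close> because real time covers only half of the circle; its
  \<open>q\<close>-th root is \<open>2\<close> to the power \<open>d (1/p - 1/2)\<close>.\<close>

theorem theorem1:
  fixes p q :: real
    and f g :: "real ^ 'n \<Rightarrow> complex"
    and \<alpha> :: "nat ^ 'n \<Rightarrow> complex"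
  assumes "2 \<le> p" and "2 \<le> q"
    and "real CARD('n) / p + 2 / q = real CARD('n) / 2"
    and "f \<in> L2 lborel"
    and "L2_has_sum lborel (\<lambda>m x. \<alpha> m * hermite_fun m x) f"
    and "g = L2_sum gauss (\<lambda>m x. \<alpha> m * hermite_multi m x)"
  shows "Lp_norm_ennreal lborel q (\<lambda>t. Lp_norm lborel p (schroedinger t f))
        / ennreal ((p powr (- 1 / (2 * p)) * 2 powr (1 / p - 1 / 2)) ^ CARD('n))
      = ennreal_powr
          (\<integral>\<^sup>+t\<in>{-1/2..1/2}. ennreal_powr
             (\<integral>\<^sup>+x. ennreal (cmod (H_op p t (T_op (- \<i>) g) x) powr p) \<partial>gauss) (q / p) \<partial>lborel)
          (1 / q)
    \<and> ennreal (C_const p CARD('n) / (p powr (- 1 / (2 * p)) * 2 powr (1 / p - 1 / 2)) ^ CARD('n))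
        * Lp_norm lborel 2 f
      = ennreal_powr (\<integral>\<^sup>+x. ennreal ((cmod (g x))\<^sup>2) \<partial>gauss) (1 / 2)"
proof -
  let ?d = "CARD('n)"
  let ?b = "1 / (4 * pi)"
  let ?L = "lens_transform ?b (complex_of_real ?b) :: (real ^ 'n \<Rightarrow> complex) \<Rightarrow> _"
  let ?D = "(p powr (- 1 / (2 * p)) * 2 powr (1 / p - 1 / 2)) ^ ?d"
  have p: "2 \<le> p" and q: "2 \<le> q" by fact+
  have D: "0 < ?D" using p by simp
  obtain F where F: "L2_has_sum gauss (\<lambda>m x. \<alpha> m * hermite_multi m x) F" "\<And>x. f x = ?L F x"
    using L2_has_sum_transfer[OF assms(5)] by blast
  have gs: "L2_has_sum gauss (\<lambda>m x. \<alpha> m * hermite_multi m x) g"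
    unfolding assms(6) by (rule L2_sum_has_sum[OF F(1)])
  have gL: "g \<in> L2 gauss" and FL: "F \<in> L2 gauss" using gs F(1) by (auto simp: L2_has_sum_def)
  have [measurable]: "g \<in> borel_measurable borel" "F \<in> borel_measurable borel" "f \<in> borel_measurable borel"
    using L2_measurable[OF gL] L2_measurable[OF FL] L2_measurable[OF assms(4)] by auto
  obtain I where I: "exhausts (series_weight gauss hermite_multi \<alpha>) I"
    using L2_has_sum_weights_bounded[OF orthogonal_hermite_multi gs] exhausts_exists[of "series_weight gauss hermite_multi \<alpha>"]
      series_weight_nonneg by metis
  have hs: "L2_has_sum gauss (\<lambda>m x. \<alpha> m * hermite_multi m x) (hermite_series \<alpha> I 1)"
    using hermite_series_properties(4)[OF I, of 1] by simp
  have g1: "AE x in gauss. g x = hermite_series \<alpha> I 1 x" by (rule L2_has_sum_unique[OF gs hs])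
  have gF: "AE x in gauss. g x = F x" by (rule L2_has_sum_unique[OF gs F(1)])
  have "AE x in gauss. F x - hermite_series \<alpha> I 1 x = 0"
    using g1 gF by eventually_elim simp
  then have "sqnorm gauss (\<lambda>x. F x - hermite_series \<alpha> I 1 x) = 0"
    by (subst sqnorm_eq_0_iff) auto
  then have "sqnorm lborel (?L (\<lambda>x. F x - hermite_series \<alpha> I 1 x)) = 0"
    by (subst sqnorm_lens_transform) auto
  then have "AE x in lborel. ?L (\<lambda>x. F x - hermite_series \<alpha> I 1 x) x = 0"
    by (subst (asm) sqnorm_eq_0_iff) auto
  then have f0: "AE x in lborel. f x = ?L (hermite_series \<alpha> I 1) x"
    unfolding lens_transform_diff[symmetric] F(2) by eventually_elim simp

  define Q where "Q = (\<lambda>y. ennreal_powr (hermite_mean p \<alpha> I (cis (2 * pi * y))) (q / p))"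
  have [measurable]: "Q \<in> borel_measurable borel" unfolding Q_def by measurable
  have per: "Q (y + 1 / 2) = Q y" for y
  proof -
    \<comment> \<open>A half turn changes the sign of \<open>\<omega>\<close>.\<close>
    have "cis (2 * pi * (y + 1 / 2)) = - cis (2 * pi * y)"
      by (simp add: distrib_left cis_mult[symmetric])
    then show ?thesis by (simp only: Q_def hermite_mean_minus)
  qed
  let ?R = "\<integral>\<^sup>+t\<in>{-1/2..1/2}. ennreal_powr
             (\<integral>\<^sup>+x. ennreal (cmod (H_op p t (T_op (- \<i>) g) x) powr p) \<partial>gauss) (q / p) \<partial>lborel"
  let ?J = "\<integral>\<^sup>+y. indicator {- (1 / 4)<..<1 / 4} y * Q (- y) \<partial>lborel"
  have R: "?R = 2 * ?J"
  proof -
    have "ennreal_powr (\<integral>\<^sup>+x. ennreal (cmod (H_op p t (T_op (- \<i>) g) x) powr p) \<partial>gauss) (q / p) = Q (t - 1 / 4)" for t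
    proof -
      \<comment> \<open>Multiplication by \<open>- \<i>\<close> is a quarter turn backwards.\<close>
      have "- \<i> * cis (2 * pi * t) = cis (2 * pi * (t - 1 / 4))"
        by (simp add: complex_eq_iff right_diff_distrib cos_diff sin_diff)
      then have "AE x in gauss. H_op p t (T_op (- \<i>) g) x = hermite_series \<alpha> I (cis (2 * pi * (t - 1 / 4))) (sqrt (2 / p) *\<^sub>R x)"
        using H_op_T_op_hermite_series[OF I p g1 gL, of t] by (simp only:)
      then have "(\<integral>\<^sup>+x. ennreal (cmod (H_op p t (T_op (- \<i>) g) x) powr p) \<partial>gauss) = hermite_mean p \<alpha> I (cis (2 * pi * (t - 1 / 4)))"
        unfolding hermite_mean_def by (intro nn_integral_cong_AE) (auto elim!: eventually_mono)
      then show ?thesis by (simp only: Q_def)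
    qed
    then show ?thesis using nn_integral_half_periodic[of Q] per by simp
  qed
  let ?P = "p powr (- real ?d * q / (2 * p))"
  have inner: "ennreal_powr (Lp_norm lborel p (schroedinger t f)) q
      = ennreal (?P / 2) * (ennreal (2 / (1 + (4 * pi * t)\<^sup>2)) * Q (- arctan_time t))" for t
  proof -
    let ?s = "sqrt (1 + (4 * pi * t)\<^sup>2)"
    let ?A = "(?s powr (1 - p / 2) * p powr (- 1 / 2)) ^ ?d"
    have s: "0 < ?s" by (simp add: add_pos_nonneg)
    have A: "0 < ?A" using s p by simp
    have "ennreal_powr (Lp_norm lborel p (schroedinger t f)) q
      = ennreal_powr (ennreal ?A * hermite_mean p \<alpha> I (cis (2 * pi * - arctan_time t))) (q / p)"
      unfolding Lp_norm_schroedinger[OF I p \<open>f \<in> borel_measurable borel\<close> f0]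
      using p q by (subst ennreal_powr_powr) auto
    also have "\<dots> = ennreal (?A powr (q / p)) * Q (- arctan_time t)"
      unfolding Q_def using p q A by (subst ennreal_powr_mult_const) auto
    also have "?A powr (q / p) = ?P / 2 * (2 / (1 + (4 * pi * t)\<^sup>2))"
    proof -
      have "?A powr (q / p) = ?s powr ((1 - p / 2) * real ?d * (q / p)) * p powr (- 1 / 2 * real ?d * (q / p))"
        using s p by (simp add: powr_realpow[symmetric] powr_mult powr_powr)
      \<comment> \<open>This is where the admissibility of the exponents enters: the power of \<open>s\<close> is exactly the Jacobian.\<close>
      also have "(1 - p / 2) * real ?d * (q / p) = - 2"
      proof -
        have "(1 - p / 2) * real ?d * (q / p) = q * (real ?d / p - real ?d / 2)" using p by (simp add: field_simps)
        also have "real ?d / p - real ?d / 2 = - 2 / q" using assms(3) by linarith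
        finally show ?thesis using q by simp
      qed
      also have "?s powr - 2 = 1 / (1 + (4 * pi * t)\<^sup>2)"
        using s by (simp add: powr_minus_divide add_nonneg_nonneg)
      also have "- 1 / 2 * real ?d * (q / p) = - real ?d * q / (2 * p)" by simp
      finally show ?thesis by simp
    qed
    also have "ennreal (?P / 2 * (2 / (1 + (4 * pi * t)\<^sup>2))) = ennreal (?P / 2) * ennreal (2 / (1 + (4 * pi * t)\<^sup>2))"
      by (rule ennreal_mult') simp
    finally show ?thesis by (simp only: mult.assoc)
  qed
  have "(\<integral>\<^sup>+t. ennreal_powr (Lp_norm lborel p (schroedinger t f)) q \<partial>lborel)
    = ennreal (?P / 2) * (\<integral>\<^sup>+t. ennreal (2 / (1 + (4 * pi * t)\<^sup>2)) * Q (- arctan_time t) \<partial>lborel)"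
    unfolding inner by (rule nn_integral_cmult) measurable
  also have "(\<integral>\<^sup>+t. ennreal (2 / (1 + (4 * pi * t)\<^sup>2)) * Q (- arctan_time t) \<partial>lborel) = ?J"
    by (rule nn_integral_arctan_time[of "\<lambda>y. Q (- y)"]) measurable
  also have "ennreal (?P / 2) * ?J = ennreal (?P / 4) * ?R"
  proof -
    have "ennreal (?P / 4) * 2 = ennreal (?P / 4) * ennreal 2" by simp
    also have "\<dots> = ennreal (?P / 4 * 2)" by (rule ennreal_mult[symmetric]) simp_all
    finally have "ennreal (?P / 4) * 2 = ennreal (?P / 2)" by simp
    then show ?thesis unfolding R mult.assoc[symmetric] by simp
  qed
  finally have "Lp_norm_ennreal lborel q (\<lambda>t. Lp_norm lborel p (schroedinger t f)) = ennreal_powr (ennreal (?P / 4) * ?R) (1 / q)"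
    by (simp only: Lp_norm_ennreal_def)
  also have "\<dots> = ennreal ((?P / 4) powr (1 / q)) * ennreal_powr ?R (1 / q)"
    by (rule ennreal_powr_mult_const) (use p q in auto)
  also have "(?P / 4) powr (1 / q) = ?D"
  proof -
    have "(?P / 4) powr (1 / q) = (?P * 2 powr (- 2)) powr (1 / q)" by (simp add: powr_minus_divide)
    also have "\<dots> = p powr (- real ?d * q / (2 * p) * (1 / q)) * 2 powr (- 2 * (1 / q))"
      using p by (simp only: powr_mult powr_powr powr_ge_zero)
    also have "- real ?d * q / (2 * p) * (1 / q) = - 1 / (2 * p) * real ?d" using q by simp
    also have "- 2 * (1 / q) = (1 / p - 1 / 2) * real ?d"
    proof -
      have "(1 / p - 1 / 2) * real ?d = real ?d / p - real ?d / 2" by (simp add: left_diff_distrib)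
      moreover have "- 2 * (1 / q) = - (2 / q)" by simp
      ultimately show ?thesis using assms(3) by linarith
    qed
    also have "p powr (- 1 / (2 * p) * real ?d) * 2 powr ((1 / p - 1 / 2) * real ?d) = ?D"
      using p by (simp add: powr_realpow[symmetric] powr_mult powr_powr)
    finally show ?thesis .
  qed
  finally have eq: "Lp_norm_ennreal lborel q (\<lambda>t. Lp_norm lborel p (schroedinger t f)) = ennreal ?D * ennreal_powr ?R (1 / q)" .
  have cancel: "ennreal a * y / ennreal a = y" if "0 < a" for a y
    using that by (subst mult.commute, intro ennreal_mult_divide_eq) auto
  have first: "Lp_norm_ennreal lborel q (\<lambda>t. Lp_norm lborel p (schroedinger t f)) / ennreal ?D = ennreal_powr ?R (1 / q)"
    unfolding eq by (rule cancel[OF D])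

  have sf: "sqnorm lborel f = ennreal (sqrt (1 / 2) ^ ?d) * sqnorm gauss g"
  proof -
    have "f = ?L F" using F(2) by (rule ext)
    then have "sqnorm lborel f = ennreal (sqrt (2 * pi * ?b) ^ ?d) * sqnorm gauss F"
      by (simp only:) (rule sqnorm_lens_transform; simp)
    also have "sqnorm gauss F = sqnorm gauss g" using gF by (intro sqnorm_cong_AE) (auto elim: eventually_mono)
    also have "2 * pi * ?b = 1 / 2" by simp
    finally show ?thesis .
  qed
  have const: "C_const p ?d / ?D * (sqrt (1 / 2) ^ ?d) powr (1 / 2) = 1"
  proof -
    have p0: "p powr (- 1 / (2 * p)) \<noteq> 0" using p by simp
    have "C_const p ?d / ?D = (2 powr (1 / p - 1 / 4) / 2 powr (1 / p - 1 / 2)) ^ ?d"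
      unfolding C_const_def power_divide[symmetric] using p0 by simp
    also have "(2 :: real) powr (1 / p - 1 / 4) / 2 powr (1 / p - 1 / 2) = 2 powr (1 / 4)"
      by (simp add: powr_diff[symmetric])
    finally have 1: "C_const p ?d / ?D = (2 powr (1 / 4)) ^ ?d" .
    have "(sqrt (1 / 2) ^ ?d) powr (1 / 2) = (2 powr (- 1 / 4)) ^ ?d"
      by (simp add: powr_realpow[symmetric] powr_powr powr_half_sqrt[symmetric] powr_divide powr_minus_divide)
    then show ?thesis unfolding 1 by (simp add: power_mult_distrib[symmetric] powr_add[symmetric])
  qed
  have "ennreal (C_const p ?d / ?D) * Lp_norm lborel 2 f = ennreal_powr (sqnorm gauss g) (1 / 2)"
  proof -
    have C: "0 \<le> C_const p ?d / ?D" using D by (simp add: C_const_def)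
    have "Lp_norm lborel 2 f = ennreal ((sqrt (1 / 2) ^ ?d) powr (1 / 2)) * ennreal_powr (sqnorm gauss g) (1 / 2)"
      unfolding Lp_norm_2 sf by (rule ennreal_powr_mult_const) simp_all
    then show ?thesis by (simp only: mult.assoc[symmetric] ennreal_mult'[OF C, symmetric] const ennreal_1 mult_1_left)
  qed
  with first show ?thesis unfolding sqnorm_def by (intro conjI)
qed

end
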